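(* Let $n\ge1$, $s\in(0,1)$, let $\Omega\subset\mathbb{R}^n$ be a bounded domain, let $(\psi_h)$ be a sequence in $L^\infty(\Omega)$ and let $f\in\widetilde H^s(\Omega)'$. Assume that there exists $v_0\in\widetilde H^s(\Omega)$ such that $v_0\ge\psi_h$ a.e. on $\Omega$ for any $h$. Denote by $u_h$ the solution to the obstacle problem $\mathcal P(\psi_h,f)$. If $\psi_h\to\psi$ in $L^\infty(\Omega)$, then $u_h\to u$ in $\widetilde H^s(\Omega)$, where $u$ is the solution to the limiting problem $\mathcal P(\psi,f)$.
   Context: No regularity of $\partial\Omega$ is assumed. The fractional Laplacian is defined through the Fourier transform, $\mathcal F[(-\Delta)^s u]=|\xi|^{2s}\mathcal F[u]$. $H^s(\mathbb{R}^n)=\{u\in L^2(\mathbb{R}^n): (-\Delta)^{s/2}u\in L^2(\mathbb{R}^n)\}$ and $\widetilde H^s(\Omega)=\{u\in H^s(\mathbb{R}^n): u=0 \text{ a.e. on }\mathbb{R}^n\setminus\overline\Omega\}$, a Hilbert space with norm $\|(-\Delta)^{s/2}u\|_{L^2(\mathbb{R}^n)}$; $\widetilde H^s(\Omega)'$ is its dual and $\langle\cdot,\cdot\rangle$ the duality product. For $u\in\widetilde H^s(\Omega)$, $\langle(-\Delta)^s u,v\rangle=\int_{\mathbb{R}^n}(-\Delta)^{s/2}u\,(-\Delta)^{s/2}v\,dx$. For a measurable $\psi$ on $\Omega$ let $K^s_\psi=\{v\in\widetilde H^s(\Omega): v\ge\psi\text{ a.e. on }\Omega\}$. The problem $\mathcal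 P(\psi,f)$ is: find $u\in K^s_\psi$ such that $\langle(-\Delta)^s u-f,v-u\rangle\ge0$ for all $v\in K^s_\psi$. When $K^s_\psi\neq\emptyset$ it has a unique solution (here $v_0$ belongs to all the sets $K^s_{\psi_h}$ and to $K^s_\psi$). *)

theory Defs
  imports "HOL-Analysis.Analysis" "HOL-Probability.Essential_Supremum"
begin

text \<open>The Lebesgue and Sobolev spaces below consist of functions, not of classes modulo equality
  a.e.; membership and norms do not distinguish functions that are equal a.e.\<close>

definition Lsq :: "('a::euclidean_space \<Rightarrow> 'b::euclidean_space) set" where
  "Lsq = {u. u \<in> borel_measurable lebesgue \<and> integrable lebesgue (\<lambda>x. (norm (u x))\<^sup>2)}"

definition Lsq_norm :: "('a::euclidean_space \<Rightarrow> 'b::euclidean_space) \<Rightarrow> real" where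
  "Lsq_norm u = sqrt (LINT x|lebesgue. (norm (u x))\<^sup>2)"

definition Linfty :: "'a::euclidean_space set \<Rightarrow> ('a \<Rightarrow> real) set" where
  "Linfty \<Omega> = {\<psi>. \<psi> \<in> borel_measurable (lebesgue_on \<Omega>) \<and>
     esssup (lebesgue_on \<Omega>) (\<lambda>x. ereal \<bar>\<psi> x\<bar>) < \<infinity>}"

definition Linfty_tendsto ::
    "'a::euclidean_space set \<Rightarrow> (nat \<Rightarrow> 'a \<Rightarrow> real) \<Rightarrow> ('a \<Rightarrow> real) \<Rightarrow> bool" where
  "Linfty_tendsto \<Omega> \<psi>h \<psi> \<longleftrightarrow> \<psi> \<in> Linfty \<Omega> \<and> (\<forall>h. \<psi>h h \<in> Linfty \<Omega>) \<and>
     (\<lambda>h. esssup (lebesgue_on \<Omega>) (\<lambda>x. ereal \<bar>\<psi>h h x - \<psi> x\<bar>)) \<longlonglongrightarrow> 0"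

text \<open>The unitary Fourier transform, with kernel \<open>(2\<pi>)\<^sup>-\<^sup>n\<^sup>/\<^sup>2 e\<^sup>-\<^sup>i\<^sup>x\<^sup>\<xi>\<close>. The integral makes sense for
  integrable \<open>u\<close>; on \<open>L\<^sup>2\<close> the transform is the \<open>L\<^sup>2\<close>-limit of the transforms of the truncations
  of \<open>u\<close> to balls, which are integrable. The limit is taken with the nonnegative integral, which
  is infinite (and not 0) on functions that are not square integrable.\<close>

definition fourier_integral :: "('a::euclidean_space \<Rightarrow> complex) \<Rightarrow> 'a \<Rightarrow> complex" where
  "fourier_integral u \<xi> =
     of_real ((2 * pi) powr (- real DIM('a) / 2)) * (LINT x|lebesgue. cis (- (x \<bullet> \<xi>)) * u x)"

definition has_fourier_transform ::
    "('a::euclidean_space \<Rightarrow> complex) \<Rightarrow> ('a \<Rightarrow> complex) \<Rightarrow> bool" where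
  "has_fourier_transform u g \<longleftrightarrow> u \<in> Lsq \<and> g \<in> Lsq \<and>
     ((\<lambda>R::real. \<integral>\<^sup>+\<xi>. ennreal ((norm
         (fourier_integral (\<lambda>x. indicator (ball 0 R) x * u x) \<xi> - g \<xi>))\<^sup>2) \<partial>lebesgue)
       \<longlongrightarrow> 0) at_top"

text \<open>\<open>w = (-\<Delta>)\<^sup>t u\<close> for real functions \<open>u\<close> and \<open>w\<close> in \<open>L\<^sup>2\<close>. A real \<open>w\<close> is no restriction: the
  symbol is even and real, so the operator preserves realness.\<close>

definition has_frac_laplacian ::
    "real \<Rightarrow> ('a::euclidean_space \<Rightarrow> real) \<Rightarrow> ('a \<Rightarrow> real) \<Rightarrow> bool" where
  "has_frac_laplacian t u w \<longleftrightarrow> u \<in> Lsq \<and> w \<in> Lsq \<and>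
     (\<exists>g. has_fourier_transform (\<lambda>x. of_real (u x)) g \<and>
          has_fourier_transform (\<lambda>x. of_real (w x)) (\<lambda>\<xi>. of_real (norm \<xi> powr (2 * t)) * g \<xi>))"

text \<open>The choice of \<open>w\<close> matters only up to null sets, by injectivity of the Fourier transform.\<close>

definition frac_laplacian :: "real \<Rightarrow> ('a::euclidean_space \<Rightarrow> real) \<Rightarrow> 'a \<Rightarrow> real" where
  "frac_laplacian t u = (SOME w. has_frac_laplacian t u w)"

definition Hs :: "real \<Rightarrow> ('a::euclidean_space \<Rightarrow> real) set" where
  "Hs s = {u \<in> Lsq. \<exists>w\<in>Lsq. has_frac_laplacian (s / 2) u w}"

definition Htilde :: "real \<Rightarrow> 'a::euclidean_space set \<Rightarrow> ('a \<Rightarrow> real) set" where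
  "Htilde s \<Omega> = {u \<in> Hs s. AE x in lebesgue. x \<in> - closure \<Omega> \<longrightarrow> u x = 0}"

definition Htilde_norm :: "real \<Rightarrow> ('a::euclidean_space \<Rightarrow> real) \<Rightarrow> real" where
  "Htilde_norm s u = Lsq_norm (frac_laplacian (s / 2) u)"

text \<open>Functionals are functions on all of \<open>'a \<Rightarrow> real\<close>, of which only the values on
  \<open>Htilde s \<Omega>\<close> are relevant. The bound makes them respect equality a.e.\<close>

definition Htilde_dual :: "real \<Rightarrow> 'a::euclidean_space set \<Rightarrow> (('a \<Rightarrow> real) \<Rightarrow> real) set" where
  "Htilde_dual s \<Omega> = {f.
     (\<forall>u\<in>Htilde s \<Omega>. \<forall>v\<in>Htilde s \<Omega>. f (\<lambda>x. u x + v x) = f u + f v) \<and>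
     (\<forall>c. \<forall>v\<in>Htilde s \<Omega>. f (\<lambda>x. c * v x) = c * f v) \<and>
     (\<exists>C. \<forall>v\<in>Htilde s \<Omega>. \<bar>f v\<bar> \<le> C * Htilde_norm s v)}"

text \<open>\<open>(-\<Delta>)\<^sup>s u\<close> as a functional.\<close>

definition frac_laplacian_dual ::
    "real \<Rightarrow> ('a::euclidean_space \<Rightarrow> real) \<Rightarrow> ('a \<Rightarrow> real) \<Rightarrow> real" where
  "frac_laplacian_dual s u v =
     (LINT x|lebesgue. frac_laplacian (s / 2) u x * frac_laplacian (s / 2) v x)"

definition obstacle_set ::
    "real \<Rightarrow> 'a::euclidean_space set \<Rightarrow> ('a \<Rightarrow> real) \<Rightarrow> ('a \<Rightarrow> real) set" where
  "obstacle_set s \<Omega> \<psi> = {v \<in> Htilde s \<Omega>. AE x in lebesgue_on \<Omega>. v x \<ge> \<psi> x}"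

definition solves_obstacle_problem ::
    "real \<Rightarrow> 'a::euclidean_space set \<Rightarrow> ('a \<Rightarrow> real) \<Rightarrow> (('a \<Rightarrow> real) \<Rightarrow> real) \<Rightarrow> ('a \<Rightarrow> real) \<Rightarrow> bool"
  where
  "solves_obstacle_problem s \<Omega> \<psi> f u \<longleftrightarrow> u \<in> obstacle_set s \<Omega> \<psi> \<and>
     (\<forall>v\<in>obstacle_set s \<Omega> \<psi>.
        frac_laplacian_dual s u (\<lambda>x. v x - u x) - f (\<lambda>x. v x - u x) \<ge> 0)"

end

theory Submission
  imports Defs "HOL-Probability.Characteristic_Functions"
begin

text \<open>Let \<open>\<epsilon> h\<close> be the distance of \<open>\<psi>h h\<close> to \<open>\<psi>\<close> in \<open>L\<^sup>\<infinity>\<close>, let \<open>\<langle>\<cdot>, \<cdot>\<rangle>\<close> be the inner product of \<open>Htilde s \<Omega>\<close>,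
  and let \<open>cap \<epsilon> a = min (max a 0) \<epsilon>\<close>. A solution of one problem has to be made admissible for the
  other one. Adding the constant \<open>\<epsilon> h\<close> would do, but leaves the space. Since \<open>v0\<close> is above all obstacles
  (hence also above \<open>\<psi>\<close>), it is enough to add \<open>e = cap (\<epsilon> h) (v0 - u)\<close> to \<open>u\<close> and
  \<open>d = cap (\<epsilon> h) (v0 - uh h)\<close> to \<open>uh h\<close>. Testing the two variational inequalities with \<open>u + e\<close> and
  \<open>uh h + d\<close> and adding them gives
  \<open>\<parallel>uh h - u\<parallel>\<^sup>2 \<le> \<langle>uh h, e\<rangle> + \<langle>u, d\<rangle> - f e - f d\<close>.

  The right-hand side tends to 0. Testing with \<open>v0\<close> shows that the \<open>uh h\<close> are bounded. The corrections
  are at most \<open>\<epsilon> h\<close> and supported in a bounded set, so they tend to 0 in \<open>L\<^sup>2\<close>; and they are bounded in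
  energy, because \<open>cap\<close> does not increase it. Hence they tend to 0 weakly
  (\<open>frac_symbol_weakly_null\<close>, and \<open>Htilde_dual_weakly_null\<close> for \<open>f\<close>, which is
  approximated by inner products with elements of the space). This covers all terms but the first one,
  for which \<open>e\<close> has to converge strongly; it does, since \<open>\<parallel>e\<parallel>\<^sup>2 \<le> \<langle>v0 - u, e\<rangle>\<close>.

  Both facts about \<open>cap\<close> follow from the Markov property \<open>\<parallel>Tw\<parallel>\<^sup>2 + \<parallel>w - Tw\<parallel>\<^sup>2 \<le> \<parallel>w\<parallel>\<^sup>2\<close> for nondecreasing
  \<open>T\<close> with Lipschitz constant 1 and \<open>T 0 = 0\<close> (\<open>frac_energy_contraction\<close>). Up to a constant,
  \<open>|\<xi>|\<^sup>2\<^sup>s\<close> is the integral of \<open>(1 - exp (-t |\<xi>|\<^sup>2)) t\<^sup>-\<^sup>1\<^sup>-\<^sup>s\<close> over \<open>t > 0\<close>, and \<open>1 - exp (-t |\<xi>|\<^sup>2)\<close> has the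
  quadratic form \<open>1/2 \<integral>\<integral> p\<^sub>t(x - y) |w(x) - w(y)|\<^sup>2 dx dy\<close> with the heat kernel \<open>p\<^sub>t\<close>, for which the property
  holds pointwise in \<open>x\<close> and \<open>y\<close>.

  All this takes place on the Fourier side, and rests on Plancherel's theorem. The isometry
  (\<open>Plancherel_bounded_support\<close>, \<open>Plancherel\<close>) comes from the same heat kernel
  identity as \<open>t\<close> tends to 0. Surjectivity (\<open>has_fourier_transform_surj_real\<close>) is what shows
  that a truncated function has a fractional Laplacian in \<open>L\<^sup>2\<close>.\<close>

section \<open>The space of square integrable functions\<close>

definition Lsq_inner :: "('a::euclidean_space \<Rightarrow> 'b::euclidean_space) \<Rightarrow> ('a \<Rightarrow> 'b) \<Rightarrow> real" where
  "Lsq_inner u v = (LINT x|lebesgue. u x \<bullet> v x)"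

lemma Lsq_measurable [measurable_dest]: "u \<in> Lsq \<Longrightarrow> u \<in> borel_measurable lebesgue"
  by (simp add: Lsq_def)

lemma Lsq_integrable_square: "u \<in> Lsq \<Longrightarrow> integrable lebesgue (\<lambda>x. (norm (u x))\<^sup>2)"
  by (simp add: Lsq_def)

lemma Lsq_iff_nn_integral:
  "u \<in> Lsq \<longleftrightarrow> u \<in> borel_measurable lebesgue \<and>
     (\<integral>\<^sup>+x. ennreal ((norm (u x))\<^sup>2) \<partial>lebesgue) < \<infinity>"
  by (auto simp: Lsq_def integrable_iff_bounded)

lemma Lsq_bound:
  assumes "w \<in> Lsq" "u \<in> borel_measurable lebesgue" "\<And>x. norm (u x) \<le> norm (w x)"
  shows "u \<in> Lsq"
proof -
  have "integrable lebesgue (\<lambda>x. (norm (u x))\<^sup>2)"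
  proof (rule Bochner_Integration.integrable_bound[OF Lsq_integrable_square[OF assms(1)]])
    show "(\<lambda>x. (norm (u x))\<^sup>2) \<in> borel_measurable lebesgue" using assms(2) by measurable
    show "AE x in lebesgue. norm ((norm (u x))\<^sup>2) \<le> norm ((norm (w x))\<^sup>2)"
      using assms(3) by (auto intro!: power_mono)
  qed
  then show ?thesis using assms(2) by (simp add: Lsq_def)
qed

lemma abs_inner_le_sum_squares: "\<bar>a \<bullet> b\<bar> \<le> (norm a)\<^sup>2 + (norm b)\<^sup>2"
  using Cauchy_Schwarz_ineq2[of a b] sum_squares_bound[of "norm a" "norm b"]
    mult_nonneg_nonneg[of "norm a" "norm b"] by simp

lemma Lsq_inner_integrable:
  assumes "u \<in> Lsq" "v \<in> Lsq"
  shows "integrable lebesgue (\<lambda>x. u x \<bullet> v x)"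
proof (rule Bochner_Integration.integrable_bound)
  show "integrable lebesgue (\<lambda>x. (norm (u x))\<^sup>2 + (norm (v x))\<^sup>2)"
    using assms by (intro Bochner_Integration.integrable_add Lsq_integrable_square)
  show "(\<lambda>x. u x \<bullet> v x) \<in> borel_measurable lebesgue" using assms by measurable
  show "AE x in lebesgue. norm (u x \<bullet> v x) \<le> norm ((norm (u x))\<^sup>2 + (norm (v x))\<^sup>2)"
    by (simp add: abs_inner_le_sum_squares)
qed

lemma Lsq_add:
  assumes "u \<in> Lsq" "v \<in> Lsq"
  shows "(\<lambda>x. u x + v x) \<in> Lsq"
proof -
  have "integrable lebesgue (\<lambda>x. (norm (u x))\<^sup>2 + (norm (v x))\<^sup>2 + 2 * (u x \<bullet> v x))"
    using assms by (intro Bochner_Integration.integrable_add integrable_mult_right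
        Lsq_integrable_square Lsq_inner_integrable)
  moreover have "(\<lambda>x. (norm (u x))\<^sup>2 + (norm (v x))\<^sup>2 + 2 * (u x \<bullet> v x)) = (\<lambda>x. (norm (u x + v x))\<^sup>2)"
    by (simp add: power2_norm_eq_inner inner_add inner_commute algebra_simps)
  moreover have "(\<lambda>x. u x + v x) \<in> borel_measurable lebesgue" using assms by measurable
  ultimately show ?thesis by (simp add: Lsq_def)
qed

lemma Lsq_scaleR: "u \<in> Lsq \<Longrightarrow> (\<lambda>x. c *\<^sub>R u x) \<in> Lsq"
  by (auto simp: Lsq_def power_mult_distrib)

lemma Lsq_zero [simp]: "(\<lambda>x. 0) \<in> Lsq"
  by (simp add: Lsq_def)

lemma Lsq_diff: "u \<in> Lsq \<Longrightarrow> v \<in> Lsq \<Longrightarrow> (\<lambda>x. u x - v x) \<in> Lsq"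
  using Lsq_add[of u "\<lambda>x. (-1) *\<^sub>R v x"] Lsq_scaleR[of v "-1"] by simp

lemma Lsq_inner_commute: "Lsq_inner u v = Lsq_inner v u"
  by (simp add: Lsq_inner_def inner_commute)

lemma Lsq_inner_add_left:
  "u \<in> Lsq \<Longrightarrow> v \<in> Lsq \<Longrightarrow> w \<in> Lsq \<Longrightarrow>
     Lsq_inner (\<lambda>x. u x + v x) w = Lsq_inner u w + Lsq_inner v w"
  by (simp add: Lsq_inner_def inner_add_left Lsq_inner_integrable)

lemma Lsq_inner_diff_left:
  "u \<in> Lsq \<Longrightarrow> v \<in> Lsq \<Longrightarrow> w \<in> Lsq \<Longrightarrow>
     Lsq_inner (\<lambda>x. u x - v x) w = Lsq_inner u w - Lsq_inner v w"
  by (simp add: Lsq_inner_def inner_diff_left Lsq_inner_integrable)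

lemma Lsq_inner_add_right:
  "u \<in> Lsq \<Longrightarrow> v \<in> Lsq \<Longrightarrow> w \<in> Lsq \<Longrightarrow>
     Lsq_inner w (\<lambda>x. u x + v x) = Lsq_inner w u + Lsq_inner w v"
  by (simp add: Lsq_inner_def inner_add_right Lsq_inner_integrable)

lemma Lsq_inner_diff_right:
  "u \<in> Lsq \<Longrightarrow> v \<in> Lsq \<Longrightarrow> w \<in> Lsq \<Longrightarrow>
     Lsq_inner w (\<lambda>x. u x - v x) = Lsq_inner w u - Lsq_inner w v"
  by (simp add: Lsq_inner_def inner_diff_right Lsq_inner_integrable)

lemma Lsq_inner_scaleR_right: "Lsq_inner w (\<lambda>x. c *\<^sub>R u x) = c * Lsq_inner w u"
  by (simp add: Lsq_inner_def)

lemma Lsq_norm_square: "(Lsq_norm u)\<^sup>2 = Lsq_inner u u"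
  by (simp add: Lsq_norm_def Lsq_inner_def power2_norm_eq_inner)

lemma Lsq_norm_nonneg [simp]: "0 \<le> Lsq_norm u"
  by (simp add: Lsq_norm_def)

lemma Lsq_norm_zero [simp]: "Lsq_norm (\<lambda>x. 0) = 0"
  by (simp add: Lsq_norm_def)

lemma Lsq_norm_minus: "Lsq_norm (\<lambda>x. u x - v x) = Lsq_norm (\<lambda>x. v x - u x)"
  by (simp add: Lsq_norm_def norm_minus_commute)

lemma nn_integral_Lsq:
  "u \<in> Lsq \<Longrightarrow> (\<integral>\<^sup>+x. ennreal ((norm (u x))\<^sup>2) \<partial>lebesgue) = ennreal ((Lsq_norm u)\<^sup>2)"
  by (subst nn_integral_eq_integral) (auto simp: Lsq_def Lsq_norm_def)

lemma Lsq_norm_le_iff: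
  assumes "u \<in> Lsq" "0 \<le> c"
  shows "Lsq_norm u \<le> c \<longleftrightarrow> (\<integral>\<^sup>+x. ennreal ((norm (u x))\<^sup>2) \<partial>lebesgue) \<le> ennreal (c\<^sup>2)"
  using assms by (simp add: nn_integral_Lsq ennreal_le_iff abs_le_square_iff[symmetric])

lemma Lsq_norm_scaleR: "Lsq_norm (\<lambda>x. c *\<^sub>R u x) = \<bar>c\<bar> * Lsq_norm u"
  by (simp add: Lsq_norm_def power_mult_distrib real_sqrt_mult)

lemma Lsq_norm_add_square:
  assumes "u \<in> Lsq" "v \<in> Lsq"
  shows "(Lsq_norm (\<lambda>x. u x + v x))\<^sup>2 = (Lsq_norm u)\<^sup>2 + 2 * Lsq_inner u v + (Lsq_norm v)\<^sup>2"
  using assms unfolding Lsq_norm_square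
  by (simp add: Lsq_inner_add_left Lsq_inner_add_right Lsq_add Lsq_inner_commute)

lemma Lsq_norm_diff_square:
  assumes "u \<in> Lsq" "v \<in> Lsq"
  shows "(Lsq_norm (\<lambda>x. u x - v x))\<^sup>2 = (Lsq_norm u)\<^sup>2 - 2 * Lsq_inner u v + (Lsq_norm v)\<^sup>2"
  using assms unfolding Lsq_norm_square
  by (simp add: Lsq_inner_diff_left Lsq_inner_diff_right Lsq_diff Lsq_inner_commute)

lemma Lsq_Cauchy_Schwarz:
  assumes "u \<in> Lsq" "v \<in> Lsq"
  shows "\<bar>Lsq_inner u v\<bar> \<le> Lsq_norm u * Lsq_norm v"
proof -
  define a b c where "a = (Lsq_norm u)\<^sup>2" and "b = Lsq_inner u v" and "c = (Lsq_norm v)\<^sup>2"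
  have q: "0 \<le> a + 2 * t * b + t\<^sup>2 * c" for t
  proof -
    have "(Lsq_norm (\<lambda>x. t *\<^sub>R v x))\<^sup>2 = t\<^sup>2 * c"
      by (simp add: Lsq_norm_scaleR c_def power_mult_distrib)
    then have "(Lsq_norm (\<lambda>x. u x + t *\<^sub>R v x))\<^sup>2 = a + 2 * t * b + t\<^sup>2 * c"
      using Lsq_norm_add_square[OF assms(1) Lsq_scaleR[OF assms(2)], of t]
      by (simp add: a_def b_def Lsq_inner_scaleR_right)
    then show ?thesis by (metis zero_le_power2)
  qed
  have "b\<^sup>2 \<le> a * c"
  proof (cases "c = 0")
    case True
    have "b = 0"
    proof (rule ccontr)
      assume "b \<noteq> 0"
      with q[of "- (a + 1) / (2 * b)"] True show False by (simp add: field_simps)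
    qed
    then show ?thesis using True by simp
  next
    case False
    then have "c > 0" by (simp add: c_def)
    with q[of "- b / c"] show ?thesis by (simp add: field_simps power2_eq_square)
  qed
  then have "\<bar>b\<bar>\<^sup>2 \<le> (Lsq_norm u * Lsq_norm v)\<^sup>2" by (simp add: a_def c_def power_mult_distrib)
  then show ?thesis unfolding b_def by (rule power2_le_imp_le) simp
qed

lemma Lsq_norm_triangle:
  assumes "u \<in> Lsq" "v \<in> Lsq"
  shows "Lsq_norm (\<lambda>x. u x + v x) \<le> Lsq_norm u + Lsq_norm v"
proof (rule power2_le_imp_le)
  show "(Lsq_norm (\<lambda>x. u x + v x))\<^sup>2 \<le> (Lsq_norm u + Lsq_norm v)\<^sup>2"
    using Lsq_Cauchy_Schwarz[OF assms] by (simp add: Lsq_norm_add_square[OF assms] power2_sum)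
qed simp

lemma Lsq_norm_triangle_diff:
  assumes "u \<in> Lsq" "v \<in> Lsq" "w \<in> Lsq"
  shows "Lsq_norm (\<lambda>x. u x - w x) \<le> Lsq_norm (\<lambda>x. u x - v x) + Lsq_norm (\<lambda>x. v x - w x)"
  using Lsq_norm_triangle[OF Lsq_diff[OF assms(1,2)] Lsq_diff[OF assms(2,3)]] by simp

lemma Lsq_norm_diff_bound:
  assumes "u \<in> Lsq" "v \<in> Lsq"
  shows "\<bar>Lsq_norm u - Lsq_norm v\<bar> \<le> Lsq_norm (\<lambda>x. u x - v x)"
  using Lsq_norm_triangle[OF Lsq_diff[OF assms] assms(2)]
    Lsq_norm_triangle[OF Lsq_diff[OF assms(2,1)] assms(1)] Lsq_norm_minus[of u v] by simp

lemma Lsq_norm_eq_0_iff: "u \<in> Lsq \<Longrightarrow> Lsq_norm u = 0 \<longleftrightarrow> (AE x in lebesgue. u x = 0)"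
  using integral_nonneg_eq_0_iff_AE[of lebesgue "\<lambda>x. (norm (u x))\<^sup>2"]
  by (simp add: Lsq_norm_def Lsq_def)

lemma Lsq_norm_cong_AE:
  assumes "u \<in> Lsq" "v \<in> Lsq" "AE x in lebesgue. u x = v x"
  shows "Lsq_norm u = Lsq_norm v"
  unfolding Lsq_norm_def
  by (rule arg_cong[where f = sqrt], rule integral_cong_AE) (use assms in \<open>auto intro: borel_measurable_power\<close>)

text \<open>Riesz--Fischer: along a subsequence whose increments are geometrically small in norm, the
  increments are summable almost everywhere, and Fatou's lemma turns the pointwise limit into a
  limit in norm.\<close>

lemma Lsq_complete:
  fixes f :: "nat \<Rightarrow> 'a::euclidean_space \<Rightarrow> 'b::euclidean_space"
  assumes f: "\<And>n. f n \<in> Lsq"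
    and Cauchy: "\<And>e. 0 < e \<Longrightarrow> \<exists>N. \<forall>m\<ge>N. \<forall>n\<ge>N. Lsq_norm (\<lambda>x. f m x - f n x) \<le> e"
  shows "\<exists>g\<in>Lsq. (\<lambda>n. Lsq_norm (\<lambda>x. f n x - g x)) \<longlonglongrightarrow> 0"
proof -
  have [measurable]: "f n \<in> borel_measurable lebesgue" for n using f by measurable
  obtain N where N: "\<And>k m n. N k \<le> m \<Longrightarrow> N k \<le> n \<Longrightarrow> Lsq_norm (\<lambda>x. f m x - f n x) \<le> (1/2)^k"
    using Cauchy[of "(1/2)^k" for k] by (metis half_gt_zero_iff zero_less_one zero_less_power)
  define r where "r k = (\<Sum>i\<le>k. N i) + k" for k
  have rN: "N k \<le> r k" for k unfolding r_def by (simp add: trans_le_add1 member_le_sum)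
  have rmono: "r k \<le> r (Suc k)" for k unfolding r_def by simp
  have rk: "k \<le> r k" for k unfolding r_def by simp
  define D where "D k x = f (r (Suc k)) x - f (r k) x" for k x
  have [measurable]: "D k \<in> borel_measurable lebesgue" for k unfolding D_def by measurable
  have Dn: "(\<integral>\<^sup>+x. ennreal ((norm (D k x))\<^sup>2) \<partial>lebesgue) \<le> ennreal ((1/4)^k)" for k
  proof -
    have "Lsq_norm (D k) \<le> (1/2)^k"
      unfolding D_def using N[of k "r (Suc k)" "r k"] rN[of k] rmono[of k] by (auto simp: D_def)
    moreover have "D k \<in> Lsq" unfolding D_def by (intro Lsq_diff f)
    ultimately have "(\<integral>\<^sup>+x. ennreal ((norm (D k x))\<^sup>2) \<partial>lebesgue) \<le> ennreal (((1/2)^k)\<^sup>2)"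
      by (subst Lsq_norm_le_iff[symmetric]) auto
    moreover have "((1/2::real)^k)\<^sup>2 = (1/4)^k" by (simp add: power2_eq_square flip: power_mult_distrib)
    ultimately show ?thesis by simp
  qed
  have "(\<integral>\<^sup>+x. (\<Sum>k. ennreal (2^k * (norm (D k x))\<^sup>2)) \<partial>lebesgue)
        = (\<Sum>k. \<integral>\<^sup>+x. ennreal (2^k * (norm (D k x))\<^sup>2) \<partial>lebesgue)"
    by (rule nn_integral_suminf) measurable
  also have "\<dots> \<le> (\<Sum>k. ennreal ((1/2)^k))"
  proof (rule suminf_le)
    fix k
    have "(\<integral>\<^sup>+x. ennreal (2^k * (norm (D k x))\<^sup>2) \<partial>lebesgue)
      = ennreal (2^k) * (\<integral>\<^sup>+x. ennreal ((norm (D k x))\<^sup>2) \<partial>lebesgue)"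
      by (subst nn_integral_cmult[symmetric]) (auto simp: ennreal_mult)
    also have "\<dots> \<le> ennreal (2^k) * ennreal ((1/4)^k)" by (intro mult_left_mono Dn) simp
    also have "\<dots> = ennreal ((1/2)^k)"
      by (simp flip: ennreal_mult power_mult_distrib)
    finally show "(\<integral>\<^sup>+x. ennreal (2^k * (norm (D k x))\<^sup>2) \<partial>lebesgue) \<le> ennreal ((1/2)^k)" .
  qed auto
  also have "\<dots> = ennreal (\<Sum>k. (1/2)^k)" by (rule suminf_ennreal2) auto
  also have "\<dots> < \<infinity>" by simp
  finally have "AE x in lebesgue. (\<Sum>k. ennreal (2^k * (norm (D k x))\<^sup>2)) \<noteq> \<infinity>"
    by (intro nn_integral_PInf_AE) auto
  then have conv: "AE x in lebesgue. convergent (\<lambda>n. f (r n) x)"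
  proof eventually_elim
    case (elim x)
    have "summable (\<lambda>k. 2^k * (norm (D k x))\<^sup>2)"
      using elim by (intro summable_suminf_not_top) auto
    then have sum: "summable (\<lambda>k. 2^k * (norm (D k x))\<^sup>2 + (1/2)^k)"
      by (intro summable_add) auto
    have bound: "norm (D k x) \<le> 2^k * (norm (D k x))\<^sup>2 + (1/2)^k" for k
    proof -
      \<comment> \<open>the arithmetic--geometric mean inequality for the two terms\<close>
      have "0 \<le> (2^k * norm (D k x) - 1)\<^sup>2" by simp
      also have "\<dots> = 2^k * (2^k * (norm (D k x))\<^sup>2 + (1/2)^k - 2 * norm (D k x))"
        by (simp add: power2_eq_square algebra_simps flip: power_mult_distrib)
      finally have nonneg: "0 \<le> 2^k * (2^k * (norm (D k x))\<^sup>2 + (1/2)^k - 2 * norm (D k x))" .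
      have "2 * norm (D k x) \<le> 2^k * (norm (D k x))\<^sup>2 + (1/2)^k"
      proof (rule ccontr)
        assume "\<not> ?thesis"
        then have neg: "2^k * (norm (D k x))\<^sup>2 + (1/2)^k - 2 * norm (D k x) < 0" by linarith
        have "(0::real) < 2^k" by simp
        from mult_pos_neg[OF this neg] nonneg show False by linarith
      qed
      then show ?thesis using norm_ge_zero[of "D k x"] by linarith
    qed
    have "summable (\<lambda>k. D k x)"
      by (rule summable_comparison_test'[OF sum, of 0]) (rule bound)
    then have "convergent (\<lambda>n. \<Sum>k<n. D k x)" by (simp add: summable_iff_convergent)
    moreover have "(\<Sum>k<n. D k x) = f (r n) x - f (r 0) x" for n
      unfolding D_def by (rule sum_lessThan_telescope)
    ultimately have "convergent (\<lambda>n. (f (r n) x - f (r 0) x) + f (r 0) x)"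
      by (intro convergent_add convergent_const) simp
    then show ?case by simp
  qed
  define g where "g x = lim (\<lambda>n. f (r n) x)" for x
  have [measurable]: "g \<in> borel_measurable lebesgue"
    unfolding g_def by (rule borel_measurable_lim_metric) measurable
  have lim: "AE x in lebesgue. (\<lambda>n. f (r n) x) \<longlonglongrightarrow> g x"
    using conv by eventually_elim (simp add: g_def convergent_LIMSEQ_iff)
  have Fatou: "(\<integral>\<^sup>+x. ennreal ((norm (f m x - g x))\<^sup>2) \<partial>lebesgue) \<le> ennreal (e\<^sup>2)"
    if e: "0 < e" and m: "m \<ge> M" and M: "\<forall>m\<ge>M. \<forall>n\<ge>M. Lsq_norm (\<lambda>x. f m x - f n x) \<le> e" for e m M
  proof -
    have "(\<integral>\<^sup>+x. ennreal ((norm (f m x - g x))\<^sup>2) \<partial>lebesgue)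
      = (\<integral>\<^sup>+x. liminf (\<lambda>n. ennreal ((norm (f m x - f (r n) x))\<^sup>2)) \<partial>lebesgue)"
      using lim
    proof (intro nn_integral_cong_AE, eventually_elim)
      case (elim x)
      then have "(\<lambda>n. ennreal ((norm (f m x - f (r n) x))\<^sup>2)) \<longlonglongrightarrow> ennreal ((norm (f m x - g x))\<^sup>2)"
        by (intro tendsto_intros)
      then show ?case by (rule lim_imp_Liminf[OF sequentially_bot, symmetric])
    qed
    also have "\<dots> \<le> liminf (\<lambda>n. \<integral>\<^sup>+x. ennreal ((norm (f m x - f (r n) x))\<^sup>2) \<partial>lebesgue)"
      by (rule nn_integral_liminf) measurable
    also have "\<dots> \<le> liminf (\<lambda>n. ennreal (e\<^sup>2))"
    proof (rule Liminf_mono)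
      show "\<forall>\<^sub>F n in sequentially. (\<integral>\<^sup>+x. ennreal ((norm (f m x - f (r n) x))\<^sup>2) \<partial>lebesgue) \<le> ennreal (e\<^sup>2)"
        using eventually_ge_at_top[of M]
      proof eventually_elim
        case (elim n)
        then have "Lsq_norm (\<lambda>x. f m x - f (r n) x) \<le> e" using M m rk[of n] by auto
        then show ?case using e by (subst Lsq_norm_le_iff[symmetric]) (auto intro!: Lsq_diff f)
      qed
    qed
    also have "\<dots> = ennreal (e\<^sup>2)" by (simp add: Liminf_const)
    finally show ?thesis .
  qed
  have fg: "(\<lambda>x. f m x - g x) \<in> Lsq" if "0 < e" "m \<ge> M"
     "\<forall>m\<ge>M. \<forall>n\<ge>M. Lsq_norm (\<lambda>x. f m x - f n x) \<le> e" for e m M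
    unfolding Lsq_iff_nn_integral using Fatou[OF that]
    by (auto simp: le_less_trans[OF _ ennreal_less_top])
  have "g \<in> Lsq"
  proof -
    obtain M where "\<forall>m\<ge>M. \<forall>n\<ge>M. Lsq_norm (\<lambda>x. f m x - f n x) \<le> 1" using Cauchy[of 1] by auto
    then have "(\<lambda>x. f M x - (f M x - g x)) \<in> Lsq" by (intro Lsq_diff f fg[of 1 M M]) auto
    then show ?thesis by simp
  qed
  moreover have "(\<lambda>n. Lsq_norm (\<lambda>x. f n x - g x)) \<longlonglongrightarrow> 0"
  proof (rule LIMSEQ_I)
    fix e :: real assume "0 < e"
    then obtain M where M: "\<forall>m\<ge>M. \<forall>n\<ge>M. Lsq_norm (\<lambda>x. f m x - f n x) \<le> e/2" using Cauchy[of "e/2"] by auto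
    have "Lsq_norm (\<lambda>x. f n x - g x) \<le> e/2" if "n \<ge> M" for n
      using Fatou[of "e/2" M n] fg[of "e/2" M n] \<open>0 < e\<close> M that by (subst Lsq_norm_le_iff) auto
    then show "\<exists>M. \<forall>n\<ge>M. norm (Lsq_norm (\<lambda>x. f n x - g x) - 0) < e"
      using \<open>0 < e\<close> by (intro exI[of _ M]) fastforce
  qed
  ultimately show ?thesis by blast
qed

section \<open>The heat kernel\<close>

text \<open>The characteristic function of the standard normal distribution, rescaled. Writing the
  integrand as a single exponential makes the products over the coordinates below sums of exponents.\<close>

lemma gaussian_fourier_real:
  fixes a b :: real
  assumes "0 < a"
  shows "integrable lborel (\<lambda>x. exp (complex_of_real (- a * x\<^sup>2) - \<i> * of_real (x * b)))" (is ?I)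
    and "(LINT x|lborel. exp (complex_of_real (- a * x\<^sup>2) - \<i> * of_real (x * b)))
           = of_real (sqrt (pi / a) * exp (- b\<^sup>2 / (4 * a)))" (is ?E)
proof -
  define c where "c = sqrt (2 * a)"
  have c: "0 < c" "c\<^sup>2 = 2 * a" using assms by (auto simp: c_def)
  define F where "F x = std_normal_density x *\<^sub>R exp (\<i> * complex_of_real (- b / c * x))" for x
  have intF: "integrable lborel F" unfolding F_def
  proof (rule Bochner_Integration.integrable_bound)
    show "integrable lborel std_normal_density"
      by (rule integrable_normal_density) simp
  qed auto
  have "complex_of_real (exp (- (- b / c)\<^sup>2 / 2)) = char std_normal_distribution (- b / c)"
    by (simp add: char_std_normal_distribution)
  also have "\<dots> = (LINT x|lborel. F x)"
    unfolding char_def F_def by (subst integral_density) (auto simp: normal_density_nonneg)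
  also have "\<dots> = \<bar>c\<bar> *\<^sub>R (LINT x|lborel. F (0 + c * x))"
    using c by (intro lborel_integral_real_affine) auto
  also have F_eq: "(\<lambda>x. F (0 + c * x)) =
     (\<lambda>x. of_real (1 / sqrt (2 * pi)) * exp (complex_of_real (- a * x\<^sup>2) - \<i> * of_real (x * b)))"
  proof
    fix x
    have "complex_of_real (- a * x\<^sup>2) - \<i> * of_real (x * b)
      = of_real (- a * x\<^sup>2) + \<i> * complex_of_real (- b / c * (c * x))"
      using c by simp
    then have "exp (complex_of_real (- a * x\<^sup>2) - \<i> * of_real (x * b))
      = of_real (exp (- a * x\<^sup>2)) * exp (\<i> * complex_of_real (- b / c * (c * x)))"
      by (simp only: exp_add exp_of_real)
    then show "F (0 + c * x) = of_real (1 / sqrt (2 * pi)) * exp (complex_of_real (- a * x\<^sup>2) - \<i> * of_real (x * b))"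
      using c by (simp add: F_def std_normal_density_def power_mult_distrib scaleR_conv_of_real)
  qed
  finally have *: "complex_of_real (exp (- (- b / c)\<^sup>2 / 2)) =
     of_real (c / sqrt (2 * pi)) * (LINT x|lborel. exp (complex_of_real (- a * x\<^sup>2) - \<i> * of_real (x * b)))"
    using c by (simp add: scaleR_conv_of_real)
  have "(- b / c)\<^sup>2 / 2 = b\<^sup>2 / (4 * a)" using c by (simp add: power_divide)
  moreover have "c / sqrt (2 * pi) = 1 / sqrt (pi / a)"
    unfolding c_def by (simp add: real_sqrt_mult real_sqrt_divide)
  ultimately have "complex_of_real (exp (- b\<^sup>2 / (4 * a))) = of_real (1 / sqrt (pi / a)) *
      (LINT x|lborel. exp (complex_of_real (- a * x\<^sup>2) - \<i> * of_real (x * b)))"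
    using * by simp
  then have "of_real (sqrt (pi / a)) * complex_of_real (exp (- b\<^sup>2 / (4 * a)))
      = (of_real (sqrt (pi / a)) * of_real (1 / sqrt (pi / a))) *
      (LINT x|lborel. exp (complex_of_real (- a * x\<^sup>2) - \<i> * of_real (x * b)))"
    by (simp only: mult.assoc)
  moreover have "complex_of_real (sqrt (pi / a)) * of_real (1 / sqrt (pi / a)) = 1"
    using assms by (simp flip: of_real_mult)
  ultimately show ?E by (simp only: of_real_mult mult_1)
  have "integrable lborel (\<lambda>x. F (0 + c * x))"
    using intF c by (intro lborel_integrable_real_affine) auto
  then have "integrable lborel (\<lambda>x. of_real (sqrt (2 * pi)) * (of_real (1 / sqrt (2 * pi)) *
      exp (complex_of_real (- a * x\<^sup>2) - \<i> * of_real (x * b))))"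
    unfolding F_eq by (rule integrable_mult_right)
  moreover have "complex_of_real (sqrt (2 * pi)) * of_real (1 / sqrt (2 * pi)) = 1"
    by (simp flip: of_real_mult)
  ultimately show ?I by (simp only: mult.assoc[symmetric] mult_1)
qed


text \<open>Both the Gaussian and the character are products over the coordinates, and so is the
  Lebesgue measure.\<close>

lemma gaussian_fourier:
  fixes b :: "'a::euclidean_space"
  assumes "0 < a"
  shows "integrable lborel (\<lambda>x. of_real (exp (- a * (norm x)\<^sup>2)) * cis (- (x \<bullet> b)))" (is ?I)
    and "(LINT x|lborel. of_real (exp (- a * (norm x)\<^sup>2)) * cis (- (x \<bullet> b)))
           = of_real ((pi / a) powr (real DIM('a) / 2) * exp (- (norm b)\<^sup>2 / (4 * a)))" (is ?E)
proof -
  interpret product_sigma_finite "\<lambda>_::'a. lborel :: real measure" ..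
  define h where "h j x = exp (complex_of_real (- a * x\<^sup>2) - \<i> * of_real (x * (b \<bullet> j)))" for j x
  have meas [measurable]: "h j \<in> borel_measurable borel" for j unfolding h_def by measurable
  have h_int: "integrable lborel (h j)" for j
    unfolding h_def using gaussian_fourier_real(1)[OF assms] by simp
  have prod: "of_real (exp (- a * (norm x)\<^sup>2)) * cis (- (x \<bullet> b)) = (\<Prod>j\<in>Basis. h j (x \<bullet> j))" for x
  proof -
    have "(\<Prod>j\<in>Basis. h j (x \<bullet> j))
      = exp (\<Sum>j\<in>Basis. complex_of_real (- a * (x \<bullet> j)\<^sup>2) - \<i> * of_real ((x \<bullet> j) * (b \<bullet> j)))"
      unfolding h_def by (simp add: exp_sum)
    also have "(\<Sum>j\<in>Basis. complex_of_real (- a * (x \<bullet> j)\<^sup>2) - \<i> * of_real ((x \<bullet> j) * (b \<bullet> j)))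
      = of_real (- a * (\<Sum>j\<in>Basis. (x \<bullet> j)\<^sup>2)) - \<i> * of_real (\<Sum>j\<in>Basis. (x \<bullet> j) * (b \<bullet> j))"
      by (simp add: sum_subtractf sum_distrib_left sum_negf)
    also have "(\<Sum>j\<in>Basis. (x \<bullet> j)\<^sup>2) = (norm x)\<^sup>2"
      by (subst power2_norm_eq_inner, subst euclidean_inner) (simp add: power2_eq_square)
    also have "(\<Sum>j\<in>Basis. (x \<bullet> j) * (b \<bullet> j)) = x \<bullet> b" by (rule euclidean_inner[symmetric])
    finally show ?thesis
      by (simp add: exp_diff cis_conv_exp exp_minus divide_inverse flip: exp_of_real)
  qed
  have coord: "(\<Sum>k\<in>Basis. f k *\<^sub>R k) \<bullet> j = f j" if "j \<in> Basis" for f :: "'a \<Rightarrow> real" and j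
    using that by simp
  have prodm: "(\<lambda>x::'a. \<Prod>j\<in>Basis. h j (x \<bullet> j)) \<in> borel_measurable borel" by measurable
  have I': "integrable (\<Pi>\<^sub>M j\<in>Basis. lborel) (\<lambda>f. \<Prod>j\<in>Basis. h j (f j))"
    by (rule product_integrable_prod) (auto intro: h_int)
  have "integrable (\<Pi>\<^sub>M j\<in>Basis. lborel) (\<lambda>f. \<Prod>j\<in>(Basis::'a set). h j ((\<Sum>k\<in>Basis. f k *\<^sub>R k) \<bullet> j))"
    using I' by (simp add: coord cong: prod.cong)
  then show ?I unfolding prod
    by (subst lborel_eq, subst integrable_distr_eq) (use prodm in auto)
  have "(LINT x|lborel. (\<Prod>j\<in>(Basis::'a set). h j (x \<bullet> j)))
     = (LINT f|(\<Pi>\<^sub>M j\<in>(Basis::'a set). lborel). (\<Prod>j\<in>(Basis::'a set). h j ((\<Sum>k\<in>Basis. f k *\<^sub>R k) \<bullet> j)))"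
    by (subst lborel_eq, subst integral_distr) (use prodm in auto)
  also have "\<dots> = (LINT f|(\<Pi>\<^sub>M j\<in>(Basis::'a set). lborel). (\<Prod>j\<in>(Basis::'a set). h j (f j)))"
    by (simp add: coord cong: prod.cong)
  also have "\<dots> = (\<Prod>j\<in>(Basis::'a set). integral\<^sup>L lborel (h j))"
    by (rule product_integral_prod) (auto intro: h_int)
  also have "\<dots> = (\<Prod>j\<in>(Basis::'a set). of_real (sqrt (pi / a) * exp (- (b \<bullet> j)\<^sup>2 / (4 * a))))"
    unfolding h_def gaussian_fourier_real(2)[OF assms] ..
  also have "\<dots> = of_real (sqrt (pi / a) ^ DIM('a) * exp (\<Sum>j\<in>Basis. - (b \<bullet> j)\<^sup>2 / (4 * a)))"
    by (simp add: prod.distrib exp_sum)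
  also have "(\<Sum>j\<in>Basis. - (b \<bullet> j)\<^sup>2 / (4 * a)) = - (norm b)\<^sup>2 / (4 * a)"
  proof -
    have "(norm b)\<^sup>2 = (\<Sum>j\<in>Basis. (b \<bullet> j)\<^sup>2)"
      by (subst power2_norm_eq_inner, subst euclidean_inner) (simp add: power2_eq_square)
    then show ?thesis by (simp add: sum_negf sum_divide_distrib)
  qed
  also have "sqrt (pi / a) ^ DIM('a) = (pi / a) powr (real DIM('a) / 2)"
    using assms by (simp add: powr_half_sqrt[symmetric] powr_powr flip: powr_realpow)
  finally show ?E unfolding prod .
qed

text \<open>The fundamental solution of \<open>\<partial>\<^sub>t = \<Delta>\<close>: the normal density with variance \<open>2t\<close> in each
  coordinate. Its semigroup has the Fourier multiplier \<open>exp (-t |\<xi>|\<^sup>2)\<close>.\<close>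

definition heat_kernel :: "real \<Rightarrow> 'a::euclidean_space \<Rightarrow> real" where
  "heat_kernel t x = (4 * pi * t) powr (- real DIM('a) / 2) * exp (- (norm x)\<^sup>2 / (4 * t))"

lemma heat_kernel_nonneg: "0 \<le> heat_kernel t x"
  by (simp add: heat_kernel_def)

lemma heat_kernel_measurable [measurable]: "heat_kernel t \<in> borel_measurable borel"
  unfolding heat_kernel_def by measurable

lemma heat_kernel_minus_commute: "heat_kernel t (x - y) = heat_kernel t (y - x)"
  by (simp add: heat_kernel_def norm_minus_commute)

text \<open>The Gaussian with parameter \<open>t\<close> is the Fourier transform of the heat kernel at time \<open>t\<close>, up to
  the normalisation.\<close>

lemma heat_kernel_fourier:
  fixes z :: "'a::euclidean_space"
  assumes "0 < t"
  shows "(LINT \<xi>|lborel. of_real (exp (- t * (norm \<xi>)\<^sup>2)) * cis (- (\<xi> \<bullet> z)))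
     = of_real ((2 * pi) powr real DIM('a) * heat_kernel t z)"
proof -
  have "(2 * pi) powr real DIM('a) * (4 * pi * t) powr (- real DIM('a) / 2) = (pi / t) powr (real DIM('a) / 2)"
  proof -
    have "ln (4::real) = 2 * ln 2" using ln_realpow[of 2 2] by simp
    then show ?thesis using assms
      by (simp add: powr_def ln_mult ln_div exp_add[symmetric]) (simp add: field_simps)
  qed
  then show ?thesis
    unfolding gaussian_fourier(2)[OF assms] heat_kernel_def by (simp add: mult.assoc[symmetric])
qed

text \<open>The heat kernel is itself a Gaussian, with parameter \<open>1 / (4t)\<close>; its mass is the value of the
  Fourier transform at 0.\<close>

lemma heat_kernel_mass:
  assumes "0 < t"
  shows "integrable lborel (heat_kernel t :: 'a::euclidean_space \<Rightarrow> real)"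
    and "(LINT x|lborel. heat_kernel t (x::'a)) = 1"
proof -
  let ?g = "\<lambda>x::'a. of_real (exp (- (1 / (4 * t)) * (norm x)\<^sup>2)) * cis (- (x \<bullet> 0))"
  have pos: "0 < 1 / (4 * t)" using assms by simp
  have eq: "heat_kernel t x = (4 * pi * t) powr (- real DIM('a) / 2) * Re (?g x)" for x :: 'a
    by (simp add: heat_kernel_def)
  have int: "integrable lborel ?g" by (rule gaussian_fourier(1)[OF pos])
  show "integrable lborel (heat_kernel t :: 'a \<Rightarrow> real)"
    unfolding eq[abs_def] by (intro integrable_mult_right integrable_Re int)
  have "(LINT x|lborel. heat_kernel t (x::'a)) = (4 * pi * t) powr (- real DIM('a) / 2) * Re (LINT x|lborel. ?g x)"
    unfolding eq[abs_def] using int by (simp del: of_real_exp)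
  also have "\<dots> = (4 * pi * t) powr (- real DIM('a) / 2) * (4 * pi * t) powr (real DIM('a) / 2)"
    unfolding gaussian_fourier(2)[OF pos] by (simp add: mult_ac)
  also have "\<dots> = 1" using assms by (simp flip: powr_add)
  finally show "(LINT x|lborel. heat_kernel t (x::'a)) = 1" .
qed

lemma heat_kernel_mass_nn:
  fixes x :: "'a::euclidean_space"
  assumes "0 < t"
  shows "(\<integral>\<^sup>+y. ennreal (heat_kernel t (x - y)) \<partial>lebesgue) = 1"
proof -
  have "(\<integral>\<^sup>+y. ennreal (heat_kernel t (x - y)) \<partial>lborel)
     = (\<integral>\<^sup>+y. ennreal (heat_kernel t (y - x)) \<partial>lborel)"
    by (simp add: heat_kernel_minus_commute)
  also have "\<dots> = (\<integral>\<^sup>+y. ennreal (heat_kernel t y) \<partial>distr lborel borel (\<lambda>y. - x + y))"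
    by (subst nn_integral_distr) auto
  also have "\<dots> = (\<integral>\<^sup>+y. ennreal (heat_kernel t (y::'a)) \<partial>lborel)"
    by (simp only: lborel_distr_plus)
  also have "\<dots> = ennreal (LINT y|lborel. heat_kernel t (y::'a))"
    by (rule nn_integral_eq_integral) (auto simp: heat_kernel_nonneg heat_kernel_mass assms)
  finally show ?thesis by (simp add: nn_integral_completion heat_kernel_mass assms)
qed

section \<open>The Fourier transform with a Gaussian weight\<close>

lemma sigma_finite_lebesgue: "sigma_finite_measure (lebesgue :: 'a::euclidean_space measure)"
proof -
  have "\<exists>A :: 'a set set. countable A \<and> A \<subseteq> sets lborel \<and> \<Union>A = space lborel
      \<and> (\<forall>a\<in>A. emeasure lborel a \<noteq> \<infinity>)"
    by (rule lborel.sigma_finite_countable)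
  then obtain A :: "'a set set" where A: "countable A" "A \<subseteq> sets lborel" "\<Union>A = space lborel"
      "\<forall>a\<in>A. emeasure lborel a \<noteq> \<infinity>"
    by (elim exE conjE)
  have eq: "emeasure lebesgue a = emeasure lborel a" if "a \<in> A" for a
  proof -
    have "a \<in> sets lborel" using that A(2) by blast
    then show ?thesis
      by (simp only: emeasure_completion sets_completionI_sets main_part)
  qed
  show ?thesis
  proof
    show "\<exists>B :: 'a set set. countable B \<and> B \<subseteq> sets lebesgue \<and> \<Union>B = space lebesgue \<and> (\<forall>a\<in>B. emeasure lebesgue a \<noteq> \<infinity>)"
    proof (intro exI[of _ A] conjI ballI)
      show "A \<subseteq> sets lebesgue" using A(2) sets_completionI_sets[of _ lborel] by blast
      show "\<Union>A = space lebesgue" using A(3) by (simp only: space_completion)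
      show "emeasure lebesgue a \<noteq> \<infinity>" if "a \<in> A" for a
        unfolding eq[OF that] by (rule bspec[OF A(4) that])
    qed (rule A(1))
  qed
qed

interpretation lebesgue: sigma_finite_measure "lebesgue :: 'a::euclidean_space measure"
  by (rule sigma_finite_lebesgue)

interpretation lebesgue_pair: pair_sigma_finite
    "lebesgue :: 'a::euclidean_space measure" "lebesgue :: 'b::euclidean_space measure" ..

lemma ident_borel_measurable_lebesgue [measurable]: "(\<lambda>x. x) \<in> borel_measurable lebesgue"
  by (simp add: measurable_completion)

lemma fst_borel_measurable [measurable]: "fst \<in> borel_measurable (lebesgue \<Otimes>\<^sub>M M)"
  by (rule measurable_compose[OF measurable_fst ident_borel_measurable_lebesgue])

lemma snd_borel_measurable [measurable]: "snd \<in> borel_measurable (M \<Otimes>\<^sub>M lebesgue)"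
  by (rule measurable_compose[OF measurable_snd ident_borel_measurable_lebesgue])

lemma (in pair_sigma_finite) integral_tensor:
  fixes f :: "'a \<Rightarrow> complex" and g :: "'b \<Rightarrow> complex"
  assumes f: "integrable M1 f" and g: "integrable M2 g"
  shows "integrable (M1 \<Otimes>\<^sub>M M2) (\<lambda>z. f (fst z) * g (snd z))"
    and "(LINT z|(M1 \<Otimes>\<^sub>M M2). f (fst z) * g (snd z)) = integral\<^sup>L M1 f * integral\<^sup>L M2 g"
proof -
  have [measurable]: "f \<in> borel_measurable M1" "g \<in> borel_measurable M2" using f g by auto
  show int: "integrable (M1 \<Otimes>\<^sub>M M2) (\<lambda>z. f (fst z) * g (snd z))"
  proof (rule Fubini_integrable)
    show "(\<lambda>z. f (fst z) * g (snd z)) \<in> borel_measurable (M1 \<Otimes>\<^sub>M M2)" by measurable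
    show "integrable M1 (\<lambda>x. \<integral>y. norm (f (fst (x, y)) * g (snd (x, y))) \<partial>M2)"
      using f g by (simp add: norm_mult)
    show "AE x in M1. integrable M2 (\<lambda>y. f (fst (x, y)) * g (snd (x, y)))"
      using g by simp
  qed
  show "(LINT z|(M1 \<Otimes>\<^sub>M M2). f (fst z) * g (snd z)) = integral\<^sup>L M1 f * integral\<^sup>L M2 g"
    using integral_fst'[OF int] by simp
qed

lemma fourier_integral_measurable [measurable]:
  assumes [measurable]: "u \<in> borel_measurable lebesgue"
  shows "fourier_integral u \<in> borel_measurable lebesgue"
  unfolding fourier_integral_def cis_conv_exp by measurable

lemma integrable_cis_mult:
  fixes u :: "'a::euclidean_space \<Rightarrow> complex"
  assumes "integrable lebesgue u"
  shows "integrable lebesgue (\<lambda>x. cis (- (x \<bullet> \<xi>)) * u x)"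
proof (rule Bochner_Integration.integrable_bound[OF assms])
  have [measurable]: "u \<in> borel_measurable lebesgue" using assms by auto
  show "(\<lambda>x. cis (- (x \<bullet> \<xi>)) * u x) \<in> borel_measurable lebesgue"
    unfolding cis_conv_exp by measurable
qed (simp add: norm_mult)

text \<open>The square of the modulus of the Fourier integral is the double integral of
  \<open>u(x) u(y)\<^sup>* exp (-i (x - y) \<bullet> \<xi>)\<close>. The Gaussian weight makes this absolutely integrable jointly
  in \<open>\<xi>\<close> and \<open>(x, y)\<close>, and integrating over \<open>\<xi>\<close> first produces the heat kernel at \<open>x - y\<close>.\<close>

lemma fourier_integral_gaussian_weight:
  fixes u :: "'a::euclidean_space \<Rightarrow> complex"
  assumes u: "integrable lebesgue u" and t: "0 < t"
  shows "integrable lebesgue (\<lambda>\<xi>. exp (- t * (norm \<xi>)\<^sup>2) * (norm (fourier_integral u \<xi>))\<^sup>2)" (is ?I)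
    and "(LINT \<xi>|lebesgue. exp (- t * (norm \<xi>)\<^sup>2) * (norm (fourier_integral u \<xi>))\<^sup>2)
       = (LINT z|(lebesgue \<Otimes>\<^sub>M lebesgue). heat_kernel t (fst z - snd z) * (u (fst z) \<bullet> u (snd z)))" (is ?E)
proof -
  let ?P = "(lebesgue :: 'a measure) \<Otimes>\<^sub>M (lebesgue :: 'a measure)"
  have P: "sigma_finite_measure ?P" by (intro sigma_finite_pair_measure sigma_finite_lebesgue)
  interpret Q: pair_sigma_finite "lebesgue :: 'a measure" ?P
    by (intro pair_sigma_finite.intro sigma_finite_lebesgue P)
  have [measurable]: "u \<in> borel_measurable lebesgue" using u by auto
  define W where "W z = u (fst z) * cnj (u (snd z))" for z :: "'a \<times> 'a"
  have W: "integrable ?P W"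
    unfolding W_def by (rule lebesgue_pair.integral_tensor(1)) (use u in auto)
  have [measurable]: "W \<in> borel_measurable ?P" using W by auto
  define G where "G \<xi> = complex_of_real (exp (- t * (norm \<xi>)\<^sup>2))" for \<xi> :: 'a
  have G: "integrable lebesgue G"
  proof -
    have *: "integrable lborel G"
      using gaussian_fourier(1)[OF t, of "0::'a"] by (simp add: G_def[abs_def])
    then have "G \<in> borel_measurable lborel" by (rule borel_measurable_integrable)
    with * show ?thesis by (simp add: integrable_completion)
  qed
  define Q where "Q p = G (fst p) * cis (- (fst p \<bullet> (fst (snd p) - snd (snd p)))) * W (snd p)"
    for p :: "'a \<times> 'a \<times> 'a"
  have fst2 [measurable]: "(\<lambda>p. fst (snd p)) \<in> borel_measurable (lebesgue \<Otimes>\<^sub>M ?P)"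
    by (rule measurable_compose[OF measurable_snd fst_borel_measurable])
  have snd2 [measurable]: "(\<lambda>p. snd (snd p)) \<in> borel_measurable (lebesgue \<Otimes>\<^sub>M ?P)"
    by (rule measurable_compose[OF measurable_snd snd_borel_measurable])
  have Q: "integrable (lebesgue \<Otimes>\<^sub>M ?P) Q"
  proof (rule Bochner_Integration.integrable_bound)
    show "integrable (lebesgue \<Otimes>\<^sub>M ?P) (\<lambda>p. G (fst p) * W (snd p))"
      by (rule Q.integral_tensor(1)[OF G W])
    show "Q \<in> borel_measurable (lebesgue \<Otimes>\<^sub>M ?P)"
      unfolding Q_def G_def cis_conv_exp by measurable
    show "AE p in lebesgue \<Otimes>\<^sub>M ?P. norm (Q p) \<le> norm (G (fst p) * W (snd p))"
      by (simp add: Q_def norm_mult)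
  qed
  define K where "K = (2 * pi) powr (- real DIM('a))"
  have K_pos: "0 < K" by (simp add: K_def)
  have inner1: "(LINT z|?P. Q (\<xi>, z)) =
      of_real (exp (- t * (norm \<xi>)\<^sup>2) * (norm (fourier_integral u \<xi>))\<^sup>2 / K)" for \<xi>
  proof -
    let ?A = "LINT x|lebesgue. cis (- (x \<bullet> \<xi>)) * u x"
    have "(LINT z|?P. Q (\<xi>, z)) = (LINT z|?P. G \<xi> *
        ((cis (- (fst z \<bullet> \<xi>)) * u (fst z)) * cnj (cis (- (snd z \<bullet> \<xi>)) * u (snd z))))"
      unfolding Q_def W_def
      by (rule Bochner_Integration.integral_cong)
         (simp_all add: inner_diff_right cis_cnj cis_mult[symmetric] cis_divide[symmetric]
           divide_inverse cis_inverse inner_commute algebra_simps)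
    also have "\<dots> = G \<xi> * (LINT z|?P.
        (cis (- (fst z \<bullet> \<xi>)) * u (fst z)) * cnj (cis (- (snd z \<bullet> \<xi>)) * u (snd z)))"
      by (rule integral_mult_right_zero)
    also have "\<dots> = G \<xi> * (?A * cnj ?A)"
      by (subst lebesgue_pair.integral_tensor(2)) (use integrable_cis_mult[OF u] in \<open>auto simp del: complex_cnj_mult\<close>)
    also have "?A * cnj ?A = of_real ((norm ?A)\<^sup>2)"
      by (metis complex_norm_square)
    also have "(norm ?A)\<^sup>2 = (norm (fourier_integral u \<xi>))\<^sup>2 / K"
    proof -
      have "((2 * pi) powr (- real DIM('a) / 2))\<^sup>2 = K"
        unfolding K_def by (simp add: power2_eq_square flip: powr_add)
      then show ?thesis using K_pos
        by (simp add: fourier_integral_def norm_mult power_mult_distrib)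
    qed
    finally show ?thesis by (simp add: G_def)
  qed
  have inner2: "(LINT \<xi>|lebesgue. Q (\<xi>, z)) = of_real (heat_kernel t (fst z - snd z) / K) * W z" for z
  proof -
    have "(LINT \<xi>|lebesgue. Q (\<xi>, z)) = (LINT \<xi>|lebesgue. G \<xi> * cis (- (\<xi> \<bullet> (fst z - snd z)))) * W z"
      unfolding Q_def by simp
    also have "(LINT \<xi>|lebesgue. G \<xi> * cis (- (\<xi> \<bullet> (fst z - snd z))))
       = (LINT \<xi>|lborel. G \<xi> * cis (- (\<xi> \<bullet> (fst z - snd z))))"
      by (rule integral_completion) (simp add: G_def cis_conv_exp)
    also have "\<dots> = of_real ((2 * pi) powr real DIM('a) * heat_kernel t (fst z - snd z))"
      unfolding G_def by (rule heat_kernel_fourier[OF t])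
    finally show ?thesis by (simp add: K_def powr_minus divide_inverse mult.commute)
  qed
  have I1: "integrable lebesgue (\<lambda>\<xi>. LINT z|?P. Q (\<xi>, z))"
    by (rule Q.integrable_fst'[OF Q])
  then have "integrable lebesgue (\<lambda>\<xi>. K * Re (LINT z|?P. Q (\<xi>, z)))"
    by (intro integrable_mult_right integrable_Re)
  then show ?I unfolding inner1 using K_pos by simp
  have "(LINT \<xi>|lebesgue. LINT z|?P. Q (\<xi>, z)) = (LINT z|?P. LINT \<xi>|lebesgue. Q (\<xi>, z))"
    using Q.Fubini_integral[of "\<lambda>\<xi> z. Q (\<xi>, z)"] Q by simp
  then have "Re (LINT \<xi>|lebesgue. LINT z|?P. Q (\<xi>, z)) = Re (LINT z|?P. LINT \<xi>|lebesgue. Q (\<xi>, z))"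
    by simp
  moreover have "Re (LINT \<xi>|lebesgue. LINT z|?P. Q (\<xi>, z))
     = (LINT \<xi>|lebesgue. exp (- t * (norm \<xi>)\<^sup>2) * (norm (fourier_integral u \<xi>))\<^sup>2) / K"
    unfolding inner1 integral_complex_of_real by simp
  moreover have "Re (LINT z|?P. LINT \<xi>|lebesgue. Q (\<xi>, z))
     = (LINT z|?P. heat_kernel t (fst z - snd z) * (u (fst z) \<bullet> u (snd z))) / K"
  proof -
    have "integrable ?P (\<lambda>z. LINT \<xi>|lebesgue. Q (\<xi>, z))"
      using Q.integrable_snd[of "\<lambda>\<xi> z. Q (\<xi>, z)"] Q by simp
    from integral_Re[OF this, symmetric] show ?thesis
      unfolding inner2 by (simp add: W_def inner_complex_def)
  qed
  ultimately show ?E using K_pos by simp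
qed

text \<open>For square integrable \<open>u\<close> this is \<open>2 \<langle>u - P\<^sub>t u, u\<rangle>\<close> with the heat semigroup \<open>P\<^sub>t\<close>. Written with the
  differences of values of \<open>u\<close>, it visibly decreases when a contraction is applied to \<open>u\<close>.\<close>

definition heat_energy :: "real \<Rightarrow> ('a::euclidean_space \<Rightarrow> 'b::euclidean_space) \<Rightarrow> real" where
  "heat_energy t u = (LINT z|(lebesgue \<Otimes>\<^sub>M lebesgue).
     heat_kernel t (fst z - snd z) * (norm (u (fst z) - u (snd z)))\<^sup>2)"

lemma heat_kernel_square_fst:
  fixes u :: "'a::euclidean_space \<Rightarrow> 'b::euclidean_space"
  assumes u: "u \<in> Lsq" and t: "0 < t"
  shows "has_bochner_integral (lebesgue \<Otimes>\<^sub>M lebesgue)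
    (\<lambda>z. heat_kernel t (fst z - snd z) * (norm (u (fst z)))\<^sup>2) ((Lsq_norm u)\<^sup>2)"
proof (rule has_bochner_integral_nn_integral)
  have [measurable]: "u \<in> borel_measurable lebesgue" using u by measurable
  show meas: "(\<lambda>z. heat_kernel t (fst z - snd z) * (norm (u (fst z)))\<^sup>2) \<in> borel_measurable (lebesgue \<Otimes>\<^sub>M lebesgue)"
    by measurable
  have "(\<integral>\<^sup>+z. ennreal (heat_kernel t (fst z - snd z) * (norm (u (fst z)))\<^sup>2) \<partial>(lebesgue \<Otimes>\<^sub>M lebesgue))
     = (\<integral>\<^sup>+x. \<integral>\<^sup>+y. ennreal (heat_kernel t (x - y) * (norm (u x))\<^sup>2) \<partial>lebesgue \<partial>lebesgue)"
    by (subst lebesgue.nn_integral_fst[symmetric]) (use meas in auto)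
  also have "\<dots> = (\<integral>\<^sup>+x. ennreal ((norm (u x))\<^sup>2) \<partial>lebesgue)"
  proof (rule nn_integral_cong)
    fix x :: 'a
    have "(\<lambda>y. ennreal (heat_kernel t (x - y))) \<in> borel_measurable lebesgue" by measurable
    then show "(\<integral>\<^sup>+y. ennreal (heat_kernel t (x - y) * (norm (u x))\<^sup>2) \<partial>lebesgue) = ennreal ((norm (u x))\<^sup>2)"
      by (simp add: ennreal_mult heat_kernel_nonneg nn_integral_multc heat_kernel_mass_nn[OF t])
  qed
  also have "\<dots> = ennreal ((Lsq_norm u)\<^sup>2)" by (rule nn_integral_Lsq[OF u])
  finally show "(\<integral>\<^sup>+z. ennreal (heat_kernel t (fst z - snd z) * (norm (u (fst z)))\<^sup>2) \<partial>(lebesgue \<Otimes>\<^sub>M lebesgue))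
     = ennreal ((Lsq_norm u)\<^sup>2)" .
qed (auto simp: heat_kernel_nonneg)

lemma heat_kernel_square_snd:
  fixes u :: "'a::euclidean_space \<Rightarrow> 'b::euclidean_space"
  assumes u: "u \<in> Lsq" and t: "0 < t"
  shows "has_bochner_integral (lebesgue \<Otimes>\<^sub>M lebesgue)
    (\<lambda>z. heat_kernel t (fst z - snd z) * (norm (u (snd z)))\<^sup>2) ((Lsq_norm u)\<^sup>2)"
proof (rule has_bochner_integral_nn_integral)
  have [measurable]: "u \<in> borel_measurable lebesgue" using u by measurable
  show meas: "(\<lambda>z. heat_kernel t (fst z - snd z) * (norm (u (snd z)))\<^sup>2) \<in> borel_measurable (lebesgue \<Otimes>\<^sub>M lebesgue)"
    by measurable
  have "(\<integral>\<^sup>+z. ennreal (heat_kernel t (fst z - snd z) * (norm (u (snd z)))\<^sup>2) \<partial>(lebesgue \<Otimes>\<^sub>M lebesgue))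
     = (\<integral>\<^sup>+y. \<integral>\<^sup>+x. ennreal (heat_kernel t (y - x) * (norm (u y))\<^sup>2) \<partial>lebesgue \<partial>lebesgue)"
    by (subst lebesgue_pair.nn_integral_snd[symmetric])
       (use meas in \<open>auto simp: heat_kernel_minus_commute\<close>)
  also have "\<dots> = (\<integral>\<^sup>+x. ennreal ((norm (u x))\<^sup>2) \<partial>lebesgue)"
  proof (rule nn_integral_cong)
    fix x :: 'a
    have "(\<lambda>y. ennreal (heat_kernel t (x - y))) \<in> borel_measurable lebesgue" by measurable
    then show "(\<integral>\<^sup>+y. ennreal (heat_kernel t (x - y) * (norm (u x))\<^sup>2) \<partial>lebesgue) = ennreal ((norm (u x))\<^sup>2)"
      by (simp add: ennreal_mult heat_kernel_nonneg nn_integral_multc heat_kernel_mass_nn[OF t])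
  qed
  also have "\<dots> = ennreal ((Lsq_norm u)\<^sup>2)" by (rule nn_integral_Lsq[OF u])
  finally show "(\<integral>\<^sup>+z. ennreal (heat_kernel t (fst z - snd z) * (norm (u (snd z)))\<^sup>2) \<partial>(lebesgue \<Otimes>\<^sub>M lebesgue))
     = ennreal ((Lsq_norm u)\<^sup>2)" .
qed (auto simp: heat_kernel_nonneg)

lemma heat_energy:
  fixes u :: "'a::euclidean_space \<Rightarrow> 'b::euclidean_space"
  assumes u: "u \<in> Lsq" and t: "0 < t"
  shows heat_energy_integrable: "integrable (lebesgue \<Otimes>\<^sub>M lebesgue)
      (\<lambda>z. heat_kernel t (fst z - snd z) * (norm (u (fst z) - u (snd z)))\<^sup>2)" (is ?I)
    and heat_energy_eq: "heat_energy t u = 2 * (Lsq_norm u)\<^sup>2 -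
      2 * (LINT z|(lebesgue \<Otimes>\<^sub>M lebesgue). heat_kernel t (fst z - snd z) * (u (fst z) \<bullet> u (snd z)))" (is ?E)
proof -
  let ?P = "(lebesgue :: 'a measure) \<Otimes>\<^sub>M (lebesgue :: 'a measure)"
  have [measurable]: "u \<in> borel_measurable lebesgue" using u by measurable
  define a where "a z = heat_kernel t (fst z - snd z) * (norm (u (fst z)))\<^sup>2" for z :: "'a \<times> 'a"
  define b where "b z = heat_kernel t (fst z - snd z) * (norm (u (snd z)))\<^sup>2" for z :: "'a \<times> 'a"
  define c where "c z = heat_kernel t (fst z - snd z) * (u (fst z) \<bullet> u (snd z))" for z :: "'a \<times> 'a"
  have a: "integrable ?P a" "integral\<^sup>L ?P a = (Lsq_norm u)\<^sup>2"
    using heat_kernel_square_fst[OF u t] unfolding a_def[abs_def] has_bochner_integral_iff by auto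
  have b: "integrable ?P b" "integral\<^sup>L ?P b = (Lsq_norm u)\<^sup>2"
    using heat_kernel_square_snd[OF u t] unfolding b_def[abs_def] has_bochner_integral_iff by auto
  have c: "integrable ?P c"
  proof (rule Bochner_Integration.integrable_bound[OF Bochner_Integration.integrable_add[OF a(1) b(1)]])
    show "c \<in> borel_measurable ?P" unfolding c_def by measurable
    have "\<bar>c z\<bar> \<le> a z + b z" for z
      unfolding a_def b_def c_def distrib_left[symmetric]
      by (simp add: abs_mult heat_kernel_nonneg mult_left_mono abs_inner_le_sum_squares)
    moreover have "0 \<le> a z" "0 \<le> b z" for z by (simp_all add: a_def b_def heat_kernel_nonneg)
    ultimately show "AE z in ?P. norm (c z) \<le> norm (a z + b z)" by (simp add: add_nonneg_nonneg)
  qed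
  have eq: "heat_kernel t (fst z - snd z) * (norm (u (fst z) - u (snd z)))\<^sup>2 = a z + b z - 2 * c z" for z
    by (simp add: a_def b_def c_def power2_norm_eq_inner inner_diff inner_commute algebra_simps)
  show ?I unfolding eq using a b c by auto
  show ?E unfolding heat_energy_def eq using a b c by (simp add: c_def[symmetric])
qed

lemma heat_energy_nonneg: "0 \<le> heat_energy t u"
  unfolding heat_energy_def by (rule integral_nonneg_AE) (simp add: heat_kernel_nonneg)

lemma gaussian_weight_energy:
  fixes u :: "'a::euclidean_space \<Rightarrow> complex"
  assumes "integrable lebesgue u" "u \<in> Lsq" "0 < t"
  shows "(LINT \<xi>|lebesgue. exp (- t * (norm \<xi>)\<^sup>2) * (norm (fourier_integral u \<xi>))\<^sup>2)
     = (Lsq_norm u)\<^sup>2 - heat_energy t u / 2"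
  unfolding fourier_integral_gaussian_weight(2)[OF assms(1,3)] heat_energy_eq[OF assms(2,3)] by (simp add: field_simps)

section \<open>Plancherel for functions with bounded support\<close>

definition Lsq_bdd :: "('a::euclidean_space \<Rightarrow> 'b::euclidean_space) set" where
  "Lsq_bdd = {u \<in> Lsq. \<exists>R. AE x in lebesgue. R \<le> norm x \<longrightarrow> u x = 0}"

lemma Lsq_bdd_Lsq: "u \<in> Lsq_bdd \<Longrightarrow> u \<in> Lsq"
  by (simp add: Lsq_bdd_def)

lemma Lsq_bdd_add:
  assumes "u \<in> Lsq_bdd" "v \<in> Lsq_bdd"
  shows "(\<lambda>x. u x + v x) \<in> Lsq_bdd"
proof -
  obtain R S where "AE x in lebesgue. R \<le> norm x \<longrightarrow> u x = 0" "AE x in lebesgue. S \<le> norm x \<longrightarrow> v x = 0"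
    using assms by (auto simp: Lsq_bdd_def)
  then have "AE x in lebesgue. max R S \<le> norm x \<longrightarrow> u x + v x = 0" by eventually_elim auto
  moreover have "(\<lambda>x. u x + v x) \<in> Lsq" using assms by (simp add: Lsq_bdd_def Lsq_add)
  ultimately show ?thesis unfolding Lsq_bdd_def by blast
qed

lemma Lsq_bdd_scaleR: "u \<in> Lsq_bdd \<Longrightarrow> (\<lambda>x. c *\<^sub>R u x) \<in> Lsq_bdd"
  by (fastforce simp: Lsq_bdd_def intro: Lsq_scaleR)

lemma Lsq_bdd_diff: "u \<in> Lsq_bdd \<Longrightarrow> v \<in> Lsq_bdd \<Longrightarrow> (\<lambda>x. u x - v x) \<in> Lsq_bdd"
  using Lsq_bdd_add[of u "\<lambda>x. (-1) *\<^sub>R v x"] Lsq_bdd_scaleR[of v "-1"] by simp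

lemma Lsq_bdd_integrable:
  assumes "u \<in> Lsq_bdd"
  shows "integrable lebesgue u"
proof -
  obtain R where R: "AE x in lebesgue. R \<le> norm x \<longrightarrow> u x = 0" and u: "u \<in> Lsq"
    using assms by (auto simp: Lsq_bdd_def)
  have ball: "integrable lebesgue (indicator (ball 0 R) :: 'a \<Rightarrow> real)"
    by (rule integrable_real_indicator) (use emeasure_bounded_finite[OF bounded_ball, of 0 R] in auto)
  show ?thesis
  proof (rule Bochner_Integration.integrable_bound)
    show "integrable lebesgue (\<lambda>x. indicator (ball 0 R) x + (norm (u x))\<^sup>2)"
      using ball Lsq_integrable_square[OF u] by (rule Bochner_Integration.integrable_add)
    show "u \<in> borel_measurable lebesgue" using u by measurable
    show "AE x in lebesgue. norm (u x) \<le> norm (indicator (ball 0 R) x + (norm (u x))\<^sup>2)"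
      using R
    proof eventually_elim
      case (elim x)
      show ?case
      proof (cases "R \<le> norm x")
        case False
        have "2 * norm (u x) \<le> 1 + (norm (u x))\<^sup>2"
          using sum_squares_bound[of 1 "norm (u x)"] by simp
        then have "norm (u x) \<le> 1 + (norm (u x))\<^sup>2" using norm_ge_zero[of "u x"] by linarith
        then show ?thesis using False by simp
      qed (use elim in simp)
    qed
  qed
qed

lemma fourier_integral_add:
  assumes "integrable lebesgue u" "integrable lebesgue v"
  shows "fourier_integral (\<lambda>x. u x + v x) \<xi> = fourier_integral u \<xi> + fourier_integral v \<xi>"
  using integrable_cis_mult[OF assms(1)] integrable_cis_mult[OF assms(2)]
  by (simp add: fourier_integral_def distrib_left)

lemma fourier_integral_diff:
  assumes "integrable lebesgue u" "integrable lebesgue v"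
  shows "fourier_integral (\<lambda>x. u x - v x) \<xi> = fourier_integral u \<xi> - fourier_integral v \<xi>"
  using integrable_cis_mult[OF assms(1)] integrable_cis_mult[OF assms(2)]
  by (simp add: fourier_integral_def right_diff_distrib)

lemma fourier_integral_scaleR:
  "fourier_integral (\<lambda>x. c *\<^sub>R u x) \<xi> = c *\<^sub>R fourier_integral u \<xi>"
  by (simp add: fourier_integral_def)

text \<open>With the weight \<open>exp (-t |\<xi>|\<^sup>2)\<close> the inequality holds because the heat energy is nonnegative;
  Fatou's lemma removes the weight as \<open>t\<close> tends to 0.\<close>

lemma fourier_integral_contraction:
  fixes u :: "'a::euclidean_space \<Rightarrow> complex"
  assumes "u \<in> Lsq_bdd"
  shows "fourier_integral u \<in> Lsq" and "Lsq_norm (fourier_integral u) \<le> Lsq_norm u"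
proof -
  have int: "integrable lebesgue u" and u: "u \<in> Lsq"
    using assms Lsq_bdd_integrable by (auto simp: Lsq_bdd_def)
  have [measurable]: "u \<in> borel_measurable lebesgue" using u by measurable
  define F where "F n \<xi> = exp (- (1 / real (Suc n)) * (norm \<xi>)\<^sup>2) * (norm (fourier_integral u \<xi>))\<^sup>2" for n \<xi>
  have [measurable]: "F n \<in> borel_measurable lebesgue" for n unfolding F_def by measurable
  have F: "(\<integral>\<^sup>+\<xi>. ennreal (F n \<xi>) \<partial>lebesgue) \<le> ennreal ((Lsq_norm u)\<^sup>2)" for n
  proof -
    have "(\<integral>\<^sup>+\<xi>. ennreal (F n \<xi>) \<partial>lebesgue) = ennreal (LINT \<xi>|lebesgue. F n \<xi>)"
      unfolding F_def by (rule nn_integral_eq_integral[OF fourier_integral_gaussian_weight(1)[OF int]]) auto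
    also have "(LINT \<xi>|lebesgue. F n \<xi>) = (Lsq_norm u)\<^sup>2 - heat_energy (1 / real (Suc n)) u / 2"
      unfolding F_def by (rule gaussian_weight_energy[OF int u]) simp
    finally show ?thesis using heat_energy_nonneg[of "1 / real (Suc n)" u] by (simp add: ennreal_leI)
  qed
  have lim: "(\<lambda>n. ennreal (F n \<xi>)) \<longlonglongrightarrow> ennreal ((norm (fourier_integral u \<xi>))\<^sup>2)" for \<xi>
  proof -
    have "(\<lambda>n. 1 / real (Suc n)) \<longlonglongrightarrow> 0" by (rule lim_1_over_n[THEN LIMSEQ_Suc])
    then have "(\<lambda>n. exp (- (1 / real (Suc n)) * (norm \<xi>)\<^sup>2) * (norm (fourier_integral u \<xi>))\<^sup>2)
       \<longlonglongrightarrow> exp (- 0 * (norm \<xi>)\<^sup>2) * (norm (fourier_integral u \<xi>))\<^sup>2"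
      by (intro tendsto_intros)
    then show ?thesis by (auto simp: F_def intro!: tendsto_ennrealI)
  qed
  have "(\<integral>\<^sup>+\<xi>. ennreal ((norm (fourier_integral u \<xi>))\<^sup>2) \<partial>lebesgue)
     = (\<integral>\<^sup>+\<xi>. liminf (\<lambda>n. ennreal (F n \<xi>)) \<partial>lebesgue)"
    by (rule nn_integral_cong) (rule lim_imp_Liminf[OF sequentially_bot lim, symmetric])
  also have "\<dots> \<le> liminf (\<lambda>n. \<integral>\<^sup>+\<xi>. ennreal (F n \<xi>) \<partial>lebesgue)"
    by (rule nn_integral_liminf) measurable
  also have "\<dots> \<le> liminf (\<lambda>n. ennreal ((Lsq_norm u)\<^sup>2))"
    by (rule Liminf_mono) (simp add: F)
  also have "\<dots> = ennreal ((Lsq_norm u)\<^sup>2)" by (simp add: Liminf_const)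
  finally have le: "(\<integral>\<^sup>+\<xi>. ennreal ((norm (fourier_integral u \<xi>))\<^sup>2) \<partial>lebesgue) \<le> ennreal ((Lsq_norm u)\<^sup>2)" .
  show mem: "fourier_integral u \<in> Lsq"
    unfolding Lsq_iff_nn_integral using le_less_trans[OF le ennreal_less_top] by auto
  show "Lsq_norm (fourier_integral u) \<le> Lsq_norm u"
    using le by (subst Lsq_norm_le_iff[OF mem]) auto
qed

text \<open>The proofs below concern Borel functions under both \<open>lborel\<close> and its completion. As a rule of the
  measurability prover, the identity on the completion would be tried in the wrong one.\<close>

declare ident_borel_measurable_lebesgue [measurable del]

lemma Lsq_norm_dominated_convergence:
  fixes d :: "nat \<Rightarrow> 'a::euclidean_space \<Rightarrow> 'b::euclidean_space"
    and w :: "'a \<Rightarrow> 'c::euclidean_space"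
  assumes w: "w \<in> Lsq" and d: "\<And>n. d n \<in> borel_measurable lebesgue"
    and lim: "AE x in lebesgue. (\<lambda>n. d n x) \<longlonglongrightarrow> 0"
    and bound: "\<And>n. AE x in lebesgue. norm (d n x) \<le> norm (w x)"
  shows "(\<lambda>n. Lsq_norm (d n)) \<longlonglongrightarrow> 0"
proof -
  have "(\<lambda>n. LINT x|lebesgue. (norm (d n x))\<^sup>2) \<longlonglongrightarrow> (LINT x|(lebesgue :: 'a measure). (0::real))"
  proof (rule integral_dominated_convergence)
    show "integrable lebesgue (\<lambda>x. (norm (w x))\<^sup>2)" by (rule Lsq_integrable_square[OF w])
    show "AE x in lebesgue. (\<lambda>n. (norm (d n x))\<^sup>2) \<longlonglongrightarrow> 0"
      using lim
    proof eventually_elim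
      case (elim x)
      from tendsto_power[OF tendsto_norm[OF elim], of 2] show ?case by simp
    qed
    show "AE x in lebesgue. norm ((norm (d n x))\<^sup>2) \<le> (norm (w x))\<^sup>2" for n
      using bound[of n] by eventually_elim (simp add: power_mono)
  qed (use d in measurable)
  from tendsto_real_sqrt[OF this] show ?thesis by (simp add: Lsq_norm_def)
qed

lemma Lsq_bdd_boundedI:
  fixes h :: "'a::euclidean_space \<Rightarrow> 'b::euclidean_space"
  assumes h: "h \<in> borel_measurable lebesgue" and B: "\<And>x. norm (h x) \<le> B"
    and R: "\<And>x. R \<le> norm x \<Longrightarrow> h x = 0"
  shows "h \<in> Lsq_bdd"
proof -
  have "integrable lebesgue (\<lambda>x. (norm (h x))\<^sup>2)"
  proof (rule Bochner_Integration.integrable_bound)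
    show "integrable lebesgue (\<lambda>x. B\<^sup>2 * indicator (ball 0 R) x)"
      by (intro integrable_mult_right integrable_real_indicator)
         (use emeasure_bounded_finite[OF bounded_ball, of 0 R] in auto)
    show "AE x in lebesgue. norm ((norm (h x))\<^sup>2) \<le> norm (B\<^sup>2 * indicator (ball 0 R) x)"
      using B R by (auto simp: indicator_def not_less intro!: power_mono)
  qed (use h in measurable)
  then have "h \<in> Lsq" using h by (simp add: Lsq_def)
  moreover have "AE x in lebesgue. R \<le> norm x \<longrightarrow> h x = 0" using R by simp
  ultimately show ?thesis unfolding Lsq_bdd_def by blast
qed

text \<open>A measurable function is an a.e. limit of continuous functions, and truncating these in their
  values and by a cutoff makes the convergence dominated. Since \<open>u\<close> may be unbounded, its values
  are truncated first.\<close>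

lemma Lsq_bdd_continuous_approx:
  fixes u :: "'a::euclidean_space \<Rightarrow> 'b::euclidean_space"
  assumes u: "u \<in> Lsq_bdd" and e: "0 < e"
  shows "\<exists>h R B. continuous_on UNIV h \<and> (\<forall>x. norm (h x) \<le> B) \<and> (\<forall>x. R \<le> norm x \<longrightarrow> h x = 0)
    \<and> Lsq_norm (\<lambda>x. u x - h x) \<le> e"
proof -
  obtain R where R: "AE x in lebesgue. R \<le> norm x \<longrightarrow> u x = 0" and uL: "u \<in> Lsq"
    using u by (auto simp: Lsq_bdd_def)
  have um [measurable]: "u \<in> borel_measurable lebesgue" using uL by measurable
  define v where "v n x = (if norm (u x) \<le> real n then u x else 0)" for n x
  have vm [measurable]: "v n \<in> borel_measurable lebesgue" for n unfolding v_def by measurable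
  have vL: "v n \<in> Lsq" for n by (rule Lsq_bound[OF uL vm]) (simp add: v_def)
  have "(\<lambda>n. Lsq_norm (\<lambda>x. u x - v n x)) \<longlonglongrightarrow> 0"
  proof (rule Lsq_norm_dominated_convergence[OF uL])
    show "AE x in lebesgue. (\<lambda>n. u x - v n x) \<longlonglongrightarrow> 0"
    proof (rule AE_I2)
      fix x
      have "\<forall>\<^sub>F n in sequentially. u x - v n x = 0"
        using eventually_ge_at_top[of "nat \<lceil>norm (u x)\<rceil>"]
      proof eventually_elim
        case (elim n)
        then have "norm (u x) \<le> real n" by linarith
        then show ?case by (simp add: v_def)
      qed
      then show "(\<lambda>n. u x - v n x) \<longlonglongrightarrow> 0" by (rule tendsto_eventually)
    qed
  qed (auto simp: v_def)
  then obtain n where "Lsq_norm (\<lambda>x. u x - v n x) < e / 2"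
    using e by (metis (no_types, lifting) LIMSEQ_iff diff_zero half_gt_zero order_refl real_norm_def abs_of_nonneg Lsq_norm_nonneg)
  then have n: "Lsq_norm (\<lambda>x. u x - v n x) \<le> e / 2" by simp
  define B where "B = real n + 1"
  have B: "0 < B" by (simp add: B_def)
  have vB: "norm (v n x) \<le> B" for x by (simp add: v_def B_def)
  obtain N g where N: "negligible N" and g: "\<And>k. continuous_on UNIV (g k)"
      and lim: "\<And>x. x \<notin> N \<Longrightarrow> (\<lambda>k. g k x) \<longlonglongrightarrow> v n x"
  proof -
    have "v n \<in> borel_measurable (lebesgue_on UNIV)" by (simp add: lebesgue_on_UNIV_eq vm)
    then have "v n measurable_on UNIV" by (intro lebesgue_measurable_imp_measurable_on) auto
    then show ?thesis using that by (auto simp: measurable_on_def)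
  qed
  define c where "c x = max 0 (min 1 (R + 1 - norm x))" for x :: 'a
  define clip where "clip y = (B / max B (norm y)) *\<^sub>R y" for y :: 'b
  define h where "h k x = c x *\<^sub>R clip (g k x)" for k x
  have clip_cont: "continuous_on UNIV clip"
    unfolding clip_def using B by (intro continuous_intros) (auto simp: max_def)
  have h_cont: "continuous_on UNIV (h k)" for k
    unfolding h_def c_def
    by (intro continuous_intros continuous_on_compose2[OF clip_cont g]) auto
  have h_meas [measurable]: "h k \<in> borel_measurable lebesgue" for k
    using h_cont[of k] by (intro measurable_completion) (simp add: borel_measurable_continuous_onI)
  have clip_le: "norm (clip y) \<le> B" for y
    using B by (auto simp: clip_def max_def field_simps)
  have c01: "0 \<le> c x" "c x \<le> 1" for x by (auto simp: c_def)
  have h_le: "norm (h k x) \<le> B" for k x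
    using mult_mono[OF c01(2)[of x] clip_le[of "g k x"]] c01(1)[of x] by (simp add: h_def)
  have h_supp: "h k x = 0" if "R + 1 \<le> norm x" for k x
    using that by (simp add: h_def c_def)
  have "(\<lambda>k. Lsq_norm (\<lambda>x. v n x - h k x)) \<longlonglongrightarrow> 0"
  proof (rule Lsq_norm_dominated_convergence[where w = "\<lambda>x. (2 * B) * indicator (ball 0 (R + 1)) x"])
    show "(\<lambda>x::'a. (2 * B) * indicator (ball 0 (R + 1)) x) \<in> Lsq"
    proof (rule Lsq_bdd_Lsq, rule Lsq_bdd_boundedI)
      show "(\<lambda>x::'a. (2 * B) * indicator (ball 0 (R + 1)) x) \<in> borel_measurable lebesgue"
        by (intro borel_measurable_times borel_measurable_const borel_measurable_indicator) simp
      show "norm ((2 * B) * indicator (ball 0 (R + 1)) x) \<le> 2 * B" for x :: 'a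
        using B by (simp add: indicator_def)
      show "(2 * B) * indicator (ball 0 (R + 1)) x = 0" if "R + 1 \<le> norm x" for x :: 'a
        using that by simp
    qed
    show "(\<lambda>x. v n x - h k x) \<in> borel_measurable lebesgue" for k by measurable
    have supp: "AE x in lebesgue. R \<le> norm x \<longrightarrow> v n x = 0"
      using R by eventually_elim (simp add: v_def)
    have "AE x in lebesgue. x \<notin> N"
      using N by (intro AE_not_in) (simp add: negligible_iff_null_sets)
    with supp show "AE x in lebesgue. (\<lambda>k. v n x - h k x) \<longlonglongrightarrow> 0"
    proof eventually_elim
      case (elim x)
      have "isCont clip (v n x)"
        using clip_cont by (simp add: continuous_on_eq_continuous_at)
      from isCont_tendsto_compose[OF this lim[OF elim(2)]]
      have "(\<lambda>k. clip (g k x)) \<longlonglongrightarrow> clip (v n x)" .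
      then have "(\<lambda>k. v n x - h k x) \<longlonglongrightarrow> v n x - c x *\<^sub>R clip (v n x)"
        unfolding h_def by (intro tendsto_intros)
      moreover have "clip (v n x) = v n x"
        using vB[of x] B by (simp add: clip_def max_def)
      moreover have "c x *\<^sub>R v n x = v n x"
        using elim by (cases "R \<le> norm x") (auto simp: c_def)
      ultimately show ?case by simp
    qed
    show "AE x in lebesgue. norm (v n x - h k x) \<le> norm ((2 * B) * indicator (ball 0 (R + 1)) x)" for k
      using supp
    proof eventually_elim
      case (elim x)
      show ?case
      proof (cases "R + 1 \<le> norm x")
        case True
        then show ?thesis using elim h_supp[of x k] by simp
      next
        case False
        have "norm (v n x - h k x) \<le> norm (v n x) + norm (h k x)" by (rule norm_triangle_ineq4)
        then show ?thesis using False vB[of x] h_le[of k x] B by simp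
      qed
    qed
  qed
  then obtain k where k: "Lsq_norm (\<lambda>x. v n x - h k x) < e / 2"
    using e by (metis (no_types, lifting) LIMSEQ_iff diff_zero half_gt_zero order_refl real_norm_def abs_of_nonneg Lsq_norm_nonneg)
  have hL: "h k \<in> Lsq"
    using Lsq_bdd_boundedI[OF h_meas h_le h_supp] by (rule Lsq_bdd_Lsq)
  have "Lsq_norm (\<lambda>x. u x - h k x) \<le> e"
    using Lsq_norm_triangle_diff[OF uL vL[of n] hL] n k by simp
  then show ?thesis using h_cont[of k] h_le[of k] h_supp[of _ k] by blast
qed


lemma nn_integral_heat_kernel_substitution:
  fixes x :: "'a::euclidean_space"
  assumes F [measurable]: "F \<in> borel_measurable borel" and t: "0 < t"
  shows "(\<integral>\<^sup>+y. ennreal (heat_kernel t (x - y)) * F y \<partial>lborel)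
     = (\<integral>\<^sup>+z. ennreal (heat_kernel 1 z) * F (x + (- sqrt t) *\<^sub>R z) \<partial>lborel)"
proof -
  let ?c = "- sqrt t" and ?n = "DIM('a)"
  have c: "?c \<noteq> 0" using t by simp
  have pw: "\<bar>?c\<bar> ^ ?n * heat_kernel t (x - (x + ?c *\<^sub>R z)) = heat_kernel 1 z" for z
  proof -
    have 1: "\<bar>?c\<bar> ^ ?n = t powr (real ?n / 2)"
      using t by (simp add: powr_half_sqrt[symmetric] powr_powr flip: powr_realpow)
    have 2: "(4 * pi * t) powr (- real ?n / 2) = (4 * pi) powr (- real ?n / 2) * t powr (- real ?n / 2)"
      using t by (simp add: powr_mult)
    have 3: "t powr (real ?n / 2) * t powr (- real ?n / 2) = 1"
      using t by (simp flip: powr_add)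
    have 4: "(norm (x - (x + ?c *\<^sub>R z)))\<^sup>2 / (4 * t) = (norm z)\<^sup>2 / 4"
      using t by (simp add: power_mult_distrib)
    have "\<bar>?c\<bar> ^ ?n * heat_kernel t (x - (x + ?c *\<^sub>R z))
      = (t powr (real ?n / 2) * t powr (- real ?n / 2)) *
        ((4 * pi) powr (- real ?n / 2) * exp (- ((norm (x - (x + ?c *\<^sub>R z)))\<^sup>2 / (4 * t))))"
      unfolding heat_kernel_def 1 2 by (simp add: mult_ac)
    then show ?thesis unfolding 3 4 by (simp add: heat_kernel_def)
  qed
  have "(\<integral>\<^sup>+y. ennreal (heat_kernel t (x - y)) * F y \<partial>lborel)
     = (\<integral>\<^sup>+y. ennreal (heat_kernel t (x - y)) * F y
          \<partial>density (distr lborel borel (\<lambda>z. x + ?c *\<^sub>R z)) (\<lambda>_. ennreal (\<bar>?c\<bar> ^ ?n)))"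
    using lborel_affine[OF c, of x] by simp
  also have "\<dots> = (\<integral>\<^sup>+z. ennreal (\<bar>?c\<bar> ^ ?n) * (ennreal (heat_kernel t (x - (x + ?c *\<^sub>R z))) * F (x + ?c *\<^sub>R z)) \<partial>lborel)"
    by (subst nn_integral_density, measurable, subst nn_integral_distr, measurable)
  also have "\<dots> = (\<integral>\<^sup>+z. ennreal (heat_kernel 1 z) * F (x + ?c *\<^sub>R z) \<partial>lborel)"
    unfolding mult.assoc[symmetric] ennreal_mult[symmetric, OF zero_le_power[OF abs_ge_zero] heat_kernel_nonneg] pw ..
  finally show ?thesis .
qed

text \<open>In the variable \<open>z = (x - y) / \<surd>t\<close> the heat energy is the average, over a fixed probability
  density, of the squared norms of \<open>h - h(\<cdot> - \<surd>t z)\<close>, and these tend to 0 with \<open>t\<close>.\<close>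

lemma heat_energy_tendsto_0:
  fixes h :: "'a::euclidean_space \<Rightarrow> 'b::euclidean_space"
  assumes cont: "continuous_on UNIV h" and B: "\<And>x. norm (h x) \<le> B"
    and R: "\<And>x. R \<le> norm x \<Longrightarrow> h x = 0"
  shows "(\<lambda>k. heat_energy (1 / real (Suc k)) h) \<longlonglongrightarrow> 0"
proof -
  define t where "t k = 1 / real (Suc k)" for k
  have t: "0 < t k" "t k \<le> 1" for k by (auto simp: t_def)
  have t0: "t \<longlonglongrightarrow> 0" unfolding t_def by (rule lim_1_over_n[THEN LIMSEQ_Suc])
  have hb [measurable]: "h \<in> borel_measurable borel"
    using cont by (simp add: borel_measurable_continuous_onI)
  then have hl: "h \<in> borel_measurable lebesgue" by (intro measurable_completion) simp
  have hL: "h \<in> Lsq" using Lsq_bdd_boundedI[OF hl B R] by (rule Lsq_bdd_Lsq)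
  define D where "D k z x = ennreal ((norm (h x - h (x + (- sqrt (t k)) *\<^sub>R z)))\<^sup>2)" for k and z x :: 'a
  have Dm [measurable]: "(\<lambda>p. D k (fst p) (snd p)) \<in> borel_measurable (lborel \<Otimes>\<^sub>M lborel)" for k
    unfolding D_def by measurable
  have Dm1 [measurable]: "D k z \<in> borel_measurable lborel" for k z unfolding D_def by measurable
  have energy: "ennreal (heat_energy (t k) h)
     = (\<integral>\<^sup>+z. ennreal (heat_kernel 1 z) * (\<integral>\<^sup>+x. D k z x \<partial>lborel) \<partial>lborel)" for k
  proof -
    let ?f = "\<lambda>z. heat_kernel (t k) (fst z - snd z) * (norm (h (fst z) - h (snd z)))\<^sup>2"
    have "ennreal (heat_energy (t k) h) = (\<integral>\<^sup>+z. ennreal (?f z) \<partial>(lebesgue \<Otimes>\<^sub>M lebesgue))"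
      unfolding heat_energy_def
      by (rule nn_integral_eq_integral[symmetric, OF heat_energy_integrable[OF hL t(1)]])
         (simp add: heat_kernel_nonneg)
    also have "\<dots> = (\<integral>\<^sup>+x. \<integral>\<^sup>+y. ennreal (?f (x, y)) \<partial>lebesgue \<partial>lebesgue)"
      by (subst lebesgue.nn_integral_fst[symmetric]) auto
    also have "\<dots> = (\<integral>\<^sup>+x. \<integral>\<^sup>+y. ennreal (heat_kernel (t k) (x - y)) * ennreal ((norm (h x - h y))\<^sup>2) \<partial>lborel \<partial>lborel)"
      by (simp add: nn_integral_completion ennreal_mult heat_kernel_nonneg)
    also have "\<dots> = (\<integral>\<^sup>+x. \<integral>\<^sup>+z. ennreal (heat_kernel 1 z) * D k z x \<partial>lborel \<partial>lborel)"
      unfolding D_def by (intro nn_integral_cong nn_integral_heat_kernel_substitution t(1)) measurable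
    also have "\<dots> = (\<integral>\<^sup>+z. \<integral>\<^sup>+x. ennreal (heat_kernel 1 z) * D k z x \<partial>lborel \<partial>lborel)"
    proof (rule lborel_pair.Fubini')
      have "(\<lambda>p. ennreal (heat_kernel 1 (fst p)) * D k (fst p) (snd p)) \<in> borel_measurable (lborel \<Otimes>\<^sub>M lborel)"
        by measurable
      then show "(\<lambda>(z, x). ennreal (heat_kernel 1 z) * D k z x) \<in> borel_measurable (lborel \<Otimes>\<^sub>M lborel)"
        by (simp add: case_prod_beta)
    qed
    also have "\<dots> = (\<integral>\<^sup>+z. ennreal (heat_kernel 1 z) * (\<integral>\<^sup>+x. D k z x \<partial>lborel) \<partial>lborel)"
      by (intro nn_integral_cong nn_integral_cmult) measurable
    finally show ?thesis .
  qed
  have B0: "0 \<le> B" using B[of 0] norm_ge_zero[of "h 0"] by linarith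
  have D_le: "D k z x \<le> ennreal ((2 * B)\<^sup>2)" for k z x
  proof -
    have "norm (h x - h (x + (- sqrt (t k)) *\<^sub>R z)) \<le> 2 * B"
      using norm_triangle_ineq4[of "h x" "h (x + (- sqrt (t k)) *\<^sub>R z)"] B[of x] B[of "x + (- sqrt (t k)) *\<^sub>R z"]
      by linarith
    then show ?thesis unfolding D_def by (intro ennreal_leI power_mono) auto
  qed
  have sqrt_le: "norm (sqrt (t k) *\<^sub>R z) \<le> norm z" for k and z :: 'a
    using t[of k] by (simp add: mult_left_le_one_le)
  have D_supp: "D k z x = 0" if "x \<notin> ball 0 R" "x \<notin> ball (sqrt (t k) *\<^sub>R z) R" for k z x
  proof -
    have "R \<le> norm x" "R \<le> norm (x + (- sqrt (t k)) *\<^sub>R z)"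
      using that by (auto simp: dist_norm norm_minus_commute)
    then show ?thesis by (simp add: D_def R)
  qed
  define V where "V = emeasure lborel (ball (0::'a) (max R 0))"
  have V: "V < \<infinity>" unfolding V_def by (rule emeasure_bounded_finite) simp
  have ball_V: "emeasure lborel (ball c R) \<le> V" for c :: 'a
  proof -
    have "emeasure lborel (ball c R) \<le> emeasure lborel (ball c (max R 0))"
      by (rule emeasure_mono) auto
    also have "\<dots> = V" unfolding V_def by (simp add: emeasure_ball)
    finally show ?thesis .
  qed
  define C where "C = ennreal ((2 * B)\<^sup>2) * (V + V)"
  have C: "C < \<infinity>" using V by (simp add: C_def ennreal_mult_less_top ennreal_add_less_top)
  have bound: "(\<integral>\<^sup>+x. D k z x \<partial>lborel) \<le> C" for k z
  proof -
    have "(\<integral>\<^sup>+x. D k z x \<partial>lborel) \<le> (\<integral>\<^sup>+x. ennreal ((2 * B)\<^sup>2) *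
        (indicator (ball 0 R) x + indicator (ball (sqrt (t k) *\<^sub>R z) R) x) \<partial>lborel)"
    proof (rule nn_integral_mono)
      fix x
      show "D k z x \<le> ennreal ((2 * B)\<^sup>2) * (indicator (ball 0 R) x + indicator (ball (sqrt (t k) *\<^sub>R z) R) x)"
      proof (cases "x \<notin> ball 0 R \<and> x \<notin> ball (sqrt (t k) *\<^sub>R z) R")
        case True
        then show ?thesis using D_supp[of x k z] by simp
      next
        case False
        then have 1: "(1::ennreal) \<le> indicator (ball 0 R) x + indicator (ball (sqrt (t k) *\<^sub>R z) R) x"
          by (auto simp: indicator_def)
        have "D k z x \<le> ennreal ((2 * B)\<^sup>2) * 1" using D_le[of k z x] by simp
        also have "\<dots> \<le> ennreal ((2 * B)\<^sup>2) * (indicator (ball 0 R) x + indicator (ball (sqrt (t k) *\<^sub>R z) R) x)"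
          by (rule mult_left_mono[OF 1]) simp
        finally show ?thesis .
      qed
    qed
    also have "\<dots> = ennreal ((2 * B)\<^sup>2) * (emeasure lborel (ball (0::'a) R) + emeasure lborel (ball (sqrt (t k) *\<^sub>R z) R))"
    proof -
      have m: "(\<lambda>x. indicator (ball c R) x :: ennreal) \<in> borel_measurable lborel" for c :: 'a
        by (rule borel_measurable_indicator) simp
      show ?thesis
        by (subst nn_integral_cmult[OF borel_measurable_add[OF m m]], subst nn_integral_add[OF m m]) simp
    qed
    also have "\<dots> \<le> C" unfolding C_def by (intro mult_left_mono add_mono ball_V) simp
    finally show ?thesis .
  qed
  have inner: "(\<lambda>k. \<integral>\<^sup>+x. D k z x \<partial>lborel) \<longlonglongrightarrow> 0" for z
  proof -
    have [measurable]: "ball (0::'a) (R + norm z) \<in> sets borel" by simp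
    have "(\<lambda>k. \<integral>\<^sup>+x. D k z x \<partial>lborel) \<longlonglongrightarrow> (\<integral>\<^sup>+x. 0 \<partial>(lborel :: 'a measure))"
    proof (rule nn_integral_dominated_convergence)
      show "AE x in lborel. D k z x \<le> ennreal ((2 * B)\<^sup>2) * indicator (ball 0 (R + norm z)) x" for k
      proof (rule AE_I2)
        fix x
        show "D k z x \<le> ennreal ((2 * B)\<^sup>2) * indicator (ball 0 (R + norm z)) x"
        proof (cases "x \<in> ball 0 (R + norm z)")
          case True
          then show ?thesis using D_le by simp
        next
          case False
          have "norm x \<le> norm (x - sqrt (t k) *\<^sub>R z) + norm (sqrt (t k) *\<^sub>R z)"
            using norm_triangle_ineq[of "x - sqrt (t k) *\<^sub>R z" "sqrt (t k) *\<^sub>R z"] by simp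
          moreover have "R + norm z \<le> norm x" using False by simp
          ultimately have "R \<le> norm (x - sqrt (t k) *\<^sub>R z)" "R \<le> norm x"
            using sqrt_le[of k z] norm_ge_zero[of z] by linarith+
          then show ?thesis by (simp add: D_def R)
        qed
      qed
      show "(\<integral>\<^sup>+x. ennreal ((2 * B)\<^sup>2) * indicator (ball 0 (R + norm z)) x \<partial>(lborel :: 'a measure)) < \<infinity>"
        using emeasure_bounded_finite[OF bounded_ball, of "0::'a" "R + norm z"]
        by (simp add: nn_integral_cmult_indicator ennreal_mult_less_top)
      show "AE x in lborel. (\<lambda>k. D k z x) \<longlonglongrightarrow> 0"
      proof (rule AE_I2)
        fix x
        have "(\<lambda>k. x + (- sqrt (t k)) *\<^sub>R z) \<longlonglongrightarrow> x + (- sqrt 0) *\<^sub>R z"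
          by (intro tendsto_intros t0)
        then have lim: "(\<lambda>k. x + (- sqrt (t k)) *\<^sub>R z) \<longlonglongrightarrow> x" by simp
        have "isCont h x" using cont by (simp add: continuous_on_eq_continuous_at)
        from isCont_tendsto_compose[OF this lim]
        have "(\<lambda>k. (norm (h x - h (x + (- sqrt (t k)) *\<^sub>R z)))\<^sup>2) \<longlonglongrightarrow> (norm (h x - h x))\<^sup>2"
          by (intro tendsto_intros)
        from tendsto_ennrealI[OF this] show "(\<lambda>k. D k z x) \<longlonglongrightarrow> 0" by (simp add: D_def)
      qed
    qed measurable
    then show ?thesis by simp
  qed
  have "(\<lambda>k. \<integral>\<^sup>+z. ennreal (heat_kernel 1 z) * (\<integral>\<^sup>+x. D k z x \<partial>lborel) \<partial>lborel)
     \<longlonglongrightarrow> (\<integral>\<^sup>+z. 0 \<partial>(lborel :: 'a measure))"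
  proof (rule nn_integral_dominated_convergence)
    show "AE z in lborel. ennreal (heat_kernel 1 z) * (\<integral>\<^sup>+x. D k z x \<partial>lborel) \<le> ennreal (heat_kernel 1 z) * C" for k
      by (intro AE_I2 mult_left_mono bound) simp
    have "(\<integral>\<^sup>+z. ennreal (heat_kernel 1 (z::'a)) \<partial>lborel) = 1"
      using heat_kernel_mass_nn[of 1 "0::'a"] by (simp add: nn_integral_completion heat_kernel_def)
    then show "(\<integral>\<^sup>+z. ennreal (heat_kernel 1 (z::'a)) * C \<partial>lborel) < \<infinity>"
      using C by (simp add: nn_integral_multc)
    show "AE z in lborel. (\<lambda>k. ennreal (heat_kernel 1 z) * (\<integral>\<^sup>+x. D k z x \<partial>lborel)) \<longlonglongrightarrow> 0"
      using ennreal_tendsto_cmult[OF _ inner] by auto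
    show "(\<lambda>z. ennreal (heat_kernel 1 z) * (\<integral>\<^sup>+x. D k z x \<partial>lborel)) \<in> borel_measurable lborel" for k
    proof -
      have "(\<lambda>z. \<integral>\<^sup>+x. D k z x \<partial>lborel) \<in> borel_measurable lborel"
        using lborel.borel_measurable_nn_integral_fst[OF Dm[of k]] by simp
      then show ?thesis by measurable
    qed
  qed measurable
  then have "(\<lambda>k. ennreal (heat_energy (t k) h)) \<longlonglongrightarrow> ennreal 0" by (simp add: energy)
  then have "(\<lambda>k. heat_energy (t k) h) \<longlonglongrightarrow> 0"
    by (rule tendsto_ennrealD) (auto simp: heat_energy_nonneg)
  then show ?thesis by (simp add: t_def)
qed

text \<open>For continuous functions the heat energy vanishes as \<open>t\<close> tends to 0, so that the contraction
  is an isometry on them; since it is a contraction, this extends to their \<open>L\<^sup>2\<close> limits.\<close>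

theorem Plancherel_bounded_support:
  fixes u :: "'a::euclidean_space \<Rightarrow> complex"
  assumes u: "u \<in> Lsq_bdd"
  shows "Lsq_norm (fourier_integral u) = Lsq_norm u"
proof (rule antisym[OF fourier_integral_contraction(2)[OF u]])
  show "Lsq_norm u \<le> Lsq_norm (fourier_integral u)"
  proof (rule field_le_epsilon)
    fix e :: real assume "0 < e"
    then obtain h R B where cont: "continuous_on UNIV h" and B: "\<And>x. norm (h x) \<le> B"
      and R: "\<And>x. R \<le> norm x \<Longrightarrow> h x = (0::complex)" and uh: "Lsq_norm (\<lambda>x. u x - h x) \<le> e / 2"
      using Lsq_bdd_continuous_approx[OF u, of "e / 2"] by auto
    have hm: "h \<in> borel_measurable lebesgue"
      using cont by (intro measurable_completion) (simp add: borel_measurable_continuous_onI)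
    have h: "h \<in> Lsq_bdd" by (rule Lsq_bdd_boundedI[OF hm B R])
    note uL = Lsq_bdd_Lsq[OF u] and hL = Lsq_bdd_Lsq[OF h]
    note FuL = fourier_integral_contraction(1)[OF u] and FhL = fourier_integral_contraction(1)[OF h]
    have "(\<lambda>k. (Lsq_norm h)\<^sup>2 - heat_energy (1 / real (Suc k)) h / 2) \<longlonglongrightarrow> (Lsq_norm h)\<^sup>2 - 0 / 2"
      by (intro tendsto_intros heat_energy_tendsto_0[OF cont B R]) auto
    moreover have "(Lsq_norm h)\<^sup>2 - heat_energy (1 / real (Suc k)) h / 2 \<le> (Lsq_norm (fourier_integral h))\<^sup>2" for k
    proof -
      have t: "0 < 1 / real (Suc k)" by simp
      have "(LINT \<xi>|lebesgue. exp (- (1 / real (Suc k)) * (norm \<xi>)\<^sup>2) * (norm (fourier_integral h \<xi>))\<^sup>2)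
        \<le> (LINT \<xi>|lebesgue. (norm (fourier_integral h \<xi>))\<^sup>2)"
      proof (rule integral_mono)
        show "exp (- (1 / real (Suc k)) * (norm \<xi>)\<^sup>2) * (norm (fourier_integral h \<xi>))\<^sup>2 \<le> (norm (fourier_integral h \<xi>))\<^sup>2" for \<xi>
          by (intro mult_left_le_one_le) auto
      qed (rule fourier_integral_gaussian_weight(1)[OF Lsq_bdd_integrable[OF h] t] Lsq_integrable_square[OF FhL])+
      then show ?thesis
        unfolding gaussian_weight_energy[OF Lsq_bdd_integrable[OF h] hL t] by (simp add: Lsq_norm_def)
    qed
    ultimately have "(Lsq_norm h)\<^sup>2 \<le> (Lsq_norm (fourier_integral h))\<^sup>2"
      by (intro LIMSEQ_le_const2[where X = "\<lambda>k. (Lsq_norm h)\<^sup>2 - heat_energy (1 / real (Suc k)) h / 2"]) auto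
    then have 1: "Lsq_norm h \<le> Lsq_norm (fourier_integral h)" by (rule power2_le_imp_le) simp
    have "fourier_integral (\<lambda>x. u x - h x) = (\<lambda>\<xi>. fourier_integral u \<xi> - fourier_integral h \<xi>)"
      by (rule ext, rule fourier_integral_diff) (rule Lsq_bdd_integrable u h)+
    then have 2: "Lsq_norm (\<lambda>\<xi>. fourier_integral u \<xi> - fourier_integral h \<xi>) \<le> e / 2"
      using fourier_integral_contraction(2)[OF Lsq_bdd_diff[OF u h]] uh by simp
    show "Lsq_norm u \<le> Lsq_norm (fourier_integral u) + e"
      using 1 2 uh Lsq_norm_diff_bound[OF uL hL] Lsq_norm_diff_bound[OF FuL FhL] by linarith
  qed
qed

section \<open>The Fourier transform on square integrable functions\<close>

definition truncation :: "real \<Rightarrow> ('a::euclidean_space \<Rightarrow> complex) \<Rightarrow> 'a \<Rightarrow> complex" where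
  "truncation R u x = indicator (ball 0 R) x * u x"

lemma truncation_Lsq_bdd:
  assumes "u \<in> Lsq"
  shows "truncation R u \<in> Lsq_bdd"
proof -
  have m: "truncation R u \<in> borel_measurable lebesgue"
    unfolding truncation_def[abs_def]
    by (intro borel_measurable_times borel_measurable_indicator Lsq_measurable[OF assms]) simp
  have "truncation R u \<in> Lsq"
    by (rule Lsq_bound[OF assms m]) (auto simp: truncation_def indicator_def)
  moreover have "AE x in lebesgue. R \<le> norm x \<longrightarrow> truncation R u x = 0"
    by (simp add: truncation_def)
  ultimately show ?thesis unfolding Lsq_bdd_def by blast
qed

lemmas truncation_Lsq = Lsq_bdd_Lsq[OF truncation_Lsq_bdd]
lemmas truncation_integrable = Lsq_bdd_integrable[OF truncation_Lsq_bdd]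
lemmas fourier_truncation_Lsq = fourier_integral_contraction(1)[OF truncation_Lsq_bdd]

lemma truncation_tendsto:
  fixes u :: "'a::euclidean_space \<Rightarrow> complex"
  assumes u: "u \<in> Lsq"
  shows "((\<lambda>R. Lsq_norm (\<lambda>x. truncation R u x - u x)) \<longlongrightarrow> 0) at_top"
proof (rule tendsto_at_topI_sequentially)
  fix X :: "nat \<Rightarrow> real" assume X: "filterlim X at_top sequentially"
  show "(\<lambda>n. Lsq_norm (\<lambda>x. truncation (X n) u x - u x)) \<longlonglongrightarrow> 0"
  proof (rule Lsq_norm_dominated_convergence[OF u])
    show "(\<lambda>x. truncation (X n) u x - u x) \<in> borel_measurable lebesgue" for n
      by (rule Lsq_measurable[OF Lsq_diff[OF truncation_Lsq[OF u] u]])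
    show "AE x in lebesgue. (\<lambda>n. truncation (X n) u x - u x) \<longlonglongrightarrow> 0"
    proof (rule AE_I2)
      fix x :: 'a
      have "\<forall>\<^sub>F n in sequentially. norm x < X n" using X by (simp add: filterlim_at_top_dense)
      then have "\<forall>\<^sub>F n in sequentially. truncation (X n) u x - u x = 0"
        by eventually_elim (simp add: truncation_def)
      then show "(\<lambda>n. truncation (X n) u x - u x) \<longlonglongrightarrow> 0" by (rule tendsto_eventually)
    qed
    show "AE x in lebesgue. norm (truncation (X n) u x - u x) \<le> norm (u x)" for n
      by (rule AE_I2) (simp add: truncation_def indicator_def)
  qed
qed

lemma fourier_truncation_diff:
  assumes "u \<in> Lsq"
  shows "Lsq_norm (\<lambda>\<xi>. fourier_integral (truncation R u) \<xi> - fourier_integral (truncation S u) \<xi>)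
    = Lsq_norm (\<lambda>x. truncation R u x - truncation S u x)"
proof -
  have "(\<lambda>\<xi>. fourier_integral (truncation R u) \<xi> - fourier_integral (truncation S u) \<xi>)
      = fourier_integral (\<lambda>x. truncation R u x - truncation S u x)"
    by (rule ext, rule fourier_integral_diff[symmetric]) (rule truncation_integrable[OF assms])+
  then show ?thesis
    using Plancherel_bounded_support[OF Lsq_bdd_diff[OF truncation_Lsq_bdd[OF assms, of R] truncation_Lsq_bdd[OF assms, of S]]]
    by simp
qed

lemma has_fourier_transform_iff:
  "has_fourier_transform u g \<longleftrightarrow> u \<in> Lsq \<and> g \<in> Lsq \<and>
     ((\<lambda>R. Lsq_norm (\<lambda>\<xi>. fourier_integral (truncation R u) \<xi> - g \<xi>)) \<longlongrightarrow> 0) at_top"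
proof (cases "u \<in> Lsq \<and> g \<in> Lsq")
  case True
  define N where "N R = Lsq_norm (\<lambda>\<xi>. fourier_integral (truncation R u) \<xi> - g \<xi>)" for R
  have eq: "(\<integral>\<^sup>+\<xi>. ennreal ((norm (fourier_integral (\<lambda>x. indicator (ball 0 R) x * u x) \<xi> - g \<xi>))\<^sup>2) \<partial>lebesgue)
     = ennreal ((N R)\<^sup>2)" for R
    using nn_integral_Lsq[OF Lsq_diff[OF fourier_truncation_Lsq[of u R] conjunct2[OF True]]] True
    by (simp add: N_def truncation_def[abs_def])
  have "((\<lambda>R. ennreal ((N R)\<^sup>2)) \<longlongrightarrow> 0) at_top \<longleftrightarrow> (N \<longlongrightarrow> 0) at_top"
  proof
    assume "((\<lambda>R. ennreal ((N R)\<^sup>2)) \<longlongrightarrow> 0) at_top"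
    then have "((\<lambda>R. ennreal ((N R)\<^sup>2)) \<longlongrightarrow> ennreal 0) at_top" by simp
    then have "((\<lambda>R. (N R)\<^sup>2) \<longlongrightarrow> 0) at_top" by (rule tendsto_ennrealD) auto
    moreover have "0 \<le> N R" for R by (simp add: N_def)
    ultimately show "(N \<longlongrightarrow> 0) at_top" using tendsto_real_sqrt[of "\<lambda>R. (N R)\<^sup>2" 0 at_top] by simp
  next
    assume "(N \<longlongrightarrow> 0) at_top"
    from tendsto_ennrealI[OF tendsto_power[OF this, of 2]]
    show "((\<lambda>R. ennreal ((N R)\<^sup>2)) \<longlongrightarrow> 0) at_top" by simp
  qed
  then show ?thesis using True unfolding has_fourier_transform_def eq N_def[abs_def] by simp
qed (auto simp: has_fourier_transform_def)

lemma has_fourier_transform_Lsq: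
  assumes "has_fourier_transform u g"
  shows "u \<in> Lsq" "g \<in> Lsq"
  using assms by (auto simp: has_fourier_transform_def)

text \<open>The transforms of the truncations form a Cauchy sequence, by the isometry for bounded
  supports. The limit is taken along integer radii; the distance to it is bounded by the \<open>L\<^sup>2\<close>
  norm of the tail of \<open>u\<close>, which gives convergence along all radii.\<close>

lemma has_fourier_transform_exists:
  fixes u :: "'a::euclidean_space \<Rightarrow> complex"
  assumes u: "u \<in> Lsq"
  shows "\<exists>g. has_fourier_transform u g"
proof -
  define F where "F R = fourier_integral (truncation R u)" for R
  define T where "T R = Lsq_norm (\<lambda>x. truncation R u x - u x)" for R
  have FL: "F R \<in> Lsq" for R unfolding F_def by (rule fourier_truncation_Lsq[OF u])
  have T: "(T \<longlongrightarrow> 0) at_top" unfolding T_def by (rule truncation_tendsto[OF u])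
  have diff: "Lsq_norm (\<lambda>\<xi>. F R \<xi> - F S \<xi>) \<le> T R + T S" for R S
  proof -
    have "Lsq_norm (\<lambda>\<xi>. F R \<xi> - F S \<xi>) = Lsq_norm (\<lambda>x. truncation R u x - truncation S u x)"
      unfolding F_def by (rule fourier_truncation_diff[OF u])
    also have "\<dots> \<le> T R + Lsq_norm (\<lambda>x. u x - truncation S u x)"
      unfolding T_def by (rule Lsq_norm_triangle_diff[OF truncation_Lsq[OF u] u truncation_Lsq[OF u]])
    also have "Lsq_norm (\<lambda>x. u x - truncation S u x) = T S" unfolding T_def by (rule Lsq_norm_minus)
    finally show ?thesis .
  qed
  have T_nat: "(\<lambda>n. T (real n)) \<longlonglongrightarrow> 0"
    by (rule filterlim_compose[OF T filterlim_real_sequentially])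
  have "\<exists>g\<in>Lsq. (\<lambda>n. Lsq_norm (\<lambda>\<xi>. F (real n) \<xi> - g \<xi>)) \<longlonglongrightarrow> 0"
  proof (rule Lsq_complete[OF FL])
    fix e :: real assume "0 < e"
    then obtain N where N: "\<And>n. N \<le> n \<Longrightarrow> norm (T (real n)) < e / 2"
      using LIMSEQ_D[OF T_nat, of "e / 2"] by auto
    have "Lsq_norm (\<lambda>\<xi>. F (real m) \<xi> - F (real n) \<xi>) \<le> e" if "N \<le> m" "N \<le> n" for m n
      using diff[of m n] N[OF that(1)] N[OF that(2)] by (simp add: T_def)
    then show "\<exists>N. \<forall>m\<ge>N. \<forall>n\<ge>N. Lsq_norm (\<lambda>\<xi>. F (real m) \<xi> - F (real n) \<xi>) \<le> e" by blast
  qed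
  then obtain g where g: "g \<in> Lsq" and lim: "(\<lambda>n. Lsq_norm (\<lambda>\<xi>. F (real n) \<xi> - g \<xi>)) \<longlonglongrightarrow> 0" by blast
  have le: "Lsq_norm (\<lambda>\<xi>. F R \<xi> - g \<xi>) \<le> T R" for R
  proof (rule LIMSEQ_le_const)
    have "(\<lambda>n. T R + T (real n) + Lsq_norm (\<lambda>\<xi>. F (real n) \<xi> - g \<xi>)) \<longlonglongrightarrow> T R + 0 + 0"
      by (intro tendsto_intros T_nat lim)
    then show "(\<lambda>n. T R + T (real n) + Lsq_norm (\<lambda>\<xi>. F (real n) \<xi> - g \<xi>)) \<longlonglongrightarrow> T R" by simp
    have "Lsq_norm (\<lambda>\<xi>. F R \<xi> - g \<xi>) \<le> T R + T (real n) + Lsq_norm (\<lambda>\<xi>. F (real n) \<xi> - g \<xi>)" for n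
      using Lsq_norm_triangle_diff[OF FL[of R] FL[of "real n"] g] diff[of R "real n"] by linarith
    then show "\<exists>N. \<forall>n\<ge>N. Lsq_norm (\<lambda>\<xi>. F R \<xi> - g \<xi>) \<le> T R + T (real n) + Lsq_norm (\<lambda>\<xi>. F (real n) \<xi> - g \<xi>)"
      by blast
  qed
  have "((\<lambda>R. Lsq_norm (\<lambda>\<xi>. F R \<xi> - g \<xi>)) \<longlongrightarrow> 0) at_top"
    by (rule tendsto_sandwich[OF _ _ tendsto_const T]) (auto intro: le always_eventually)
  then show ?thesis using u g by (auto simp: has_fourier_transform_iff F_def)
qed

lemma has_fourier_transform_add:
  assumes "has_fourier_transform u g" "has_fourier_transform v k"
  shows "has_fourier_transform (\<lambda>x. u x + v x) (\<lambda>\<xi>. g \<xi> + k \<xi>)"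
proof -
  note L = has_fourier_transform_Lsq[OF assms(1)] has_fourier_transform_Lsq[OF assms(2)]
  let ?N = "\<lambda>u g R. Lsq_norm (\<lambda>\<xi>. fourier_integral (truncation R u) \<xi> - g \<xi>)"
  have eq: "fourier_integral (truncation R (\<lambda>x. u x + v x)) =
      (\<lambda>\<xi>. fourier_integral (truncation R u) \<xi> + fourier_integral (truncation R v) \<xi>)" for R
    using fourier_integral_add[OF truncation_integrable[OF L(1)] truncation_integrable[OF L(3)], of R R]
    by (simp add: truncation_def[abs_def] distrib_left fun_eq_iff)
  have le: "?N (\<lambda>x. u x + v x) (\<lambda>\<xi>. g \<xi> + k \<xi>) R \<le> ?N u g R + ?N v k R" for R
  proof -
    have "?N (\<lambda>x. u x + v x) (\<lambda>\<xi>. g \<xi> + k \<xi>) R = Lsq_norm (\<lambda>\<xi>. (fourier_integral (truncation R u) \<xi> - g \<xi>)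
        + (fourier_integral (truncation R v) \<xi> - k \<xi>))"
      unfolding eq by (rule arg_cong[where f = Lsq_norm]) (simp add: fun_eq_iff)
    also have "\<dots> \<le> ?N u g R + ?N v k R"
      by (intro Lsq_norm_triangle Lsq_diff fourier_truncation_Lsq L)
    finally show ?thesis .
  qed
  have "((\<lambda>R. ?N u g R + ?N v k R) \<longlongrightarrow> 0 + 0) at_top"
    using assms by (intro tendsto_add) (auto simp: has_fourier_transform_iff)
  then have lim: "((\<lambda>R. ?N u g R + ?N v k R) \<longlongrightarrow> 0) at_top" by simp
  have "((\<lambda>R. ?N (\<lambda>x. u x + v x) (\<lambda>\<xi>. g \<xi> + k \<xi>) R) \<longlongrightarrow> 0) at_top"
    by (rule Lim_null_comparison[OF _ lim]) (simp add: le)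
  then show ?thesis using L by (simp add: has_fourier_transform_iff Lsq_add)
qed

lemma has_fourier_transform_scaleR:
  assumes "has_fourier_transform u g"
  shows "has_fourier_transform (\<lambda>x. c *\<^sub>R u x) (\<lambda>\<xi>. c *\<^sub>R g \<xi>)"
proof -
  note L = has_fourier_transform_Lsq[OF assms]
  have "truncation R (\<lambda>x. c *\<^sub>R u x) = (\<lambda>x. c *\<^sub>R truncation R u x)" for R
    by (simp add: truncation_def[abs_def])
  then have "Lsq_norm (\<lambda>\<xi>. fourier_integral (truncation R (\<lambda>x. c *\<^sub>R u x)) \<xi> - c *\<^sub>R g \<xi>)
     = \<bar>c\<bar> * Lsq_norm (\<lambda>\<xi>. fourier_integral (truncation R u) \<xi> - g \<xi>)" for R
    by (simp add: fourier_integral_scaleR Lsq_norm_scaleR flip: scaleR_right_diff_distrib)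
  moreover have "((\<lambda>R. \<bar>c\<bar> * Lsq_norm (\<lambda>\<xi>. fourier_integral (truncation R u) \<xi> - g \<xi>)) \<longlongrightarrow> \<bar>c\<bar> * 0) at_top"
    using assms by (intro tendsto_mult tendsto_const) (auto simp: has_fourier_transform_iff)
  ultimately show ?thesis using L by (simp add: has_fourier_transform_iff Lsq_scaleR)
qed

lemma has_fourier_transform_diff:
  assumes "has_fourier_transform u g" "has_fourier_transform v k"
  shows "has_fourier_transform (\<lambda>x. u x - v x) (\<lambda>\<xi>. g \<xi> - k \<xi>)"
  using has_fourier_transform_add[OF assms(1) has_fourier_transform_scaleR[OF assms(2), of "-1"]] by simp

lemma Lsq_norm_tendsto:
  assumes "\<And>x. f x \<in> Lsq" "g \<in> Lsq" "((\<lambda>x. Lsq_norm (\<lambda>\<xi>. f x \<xi> - g \<xi>)) \<longlongrightarrow> 0) F"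
  shows "((\<lambda>x. Lsq_norm (f x)) \<longlongrightarrow> Lsq_norm g) F"
proof -
  have "((\<lambda>x. Lsq_norm (f x) - Lsq_norm g) \<longlongrightarrow> 0) F"
    by (rule Lim_null_comparison[OF _ assms(3)])
       (auto intro!: always_eventually Lsq_norm_diff_bound assms(1,2))
  then show ?thesis by (rule LIM_zero_cancel)
qed

lemma Lsq_inner_tendsto:
  assumes u: "\<And>x. u x \<in> Lsq" "u' \<in> Lsq" "((\<lambda>x. Lsq_norm (\<lambda>\<xi>. u x \<xi> - u' \<xi>)) \<longlongrightarrow> 0) F"
    and v: "\<And>x. v x \<in> Lsq" "v' \<in> Lsq" "((\<lambda>x. Lsq_norm (\<lambda>\<xi>. v x \<xi> - v' \<xi>)) \<longlongrightarrow> 0) F"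
  shows "((\<lambda>x. Lsq_inner (u x) (v x)) \<longlongrightarrow> Lsq_inner u' v') F"
proof -
  have "((\<lambda>x. Lsq_inner (u x) (v x) - Lsq_inner u' v') \<longlongrightarrow> 0) F"
  proof (rule Lim_null_comparison)
    show "\<forall>\<^sub>F x in F. norm (Lsq_inner (u x) (v x) - Lsq_inner u' v') \<le>
      Lsq_norm (\<lambda>\<xi>. u x \<xi> - u' \<xi>) * Lsq_norm (v x) + Lsq_norm u' * Lsq_norm (\<lambda>\<xi>. v x \<xi> - v' \<xi>)"
    proof (rule always_eventually, rule allI)
      fix x
      have "Lsq_inner (u x) (v x) - Lsq_inner u' v' =
          Lsq_inner (\<lambda>\<xi>. u x \<xi> - u' \<xi>) (v x) + Lsq_inner u' (\<lambda>\<xi>. v x \<xi> - v' \<xi>)"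
        by (simp add: Lsq_inner_diff_left Lsq_inner_diff_right u v)
      also have "\<bar>\<dots>\<bar> \<le> Lsq_norm (\<lambda>\<xi>. u x \<xi> - u' \<xi>) * Lsq_norm (v x) + Lsq_norm u' * Lsq_norm (\<lambda>\<xi>. v x \<xi> - v' \<xi>)"
        using Lsq_Cauchy_Schwarz[OF Lsq_diff[OF u(1)[of x] u(2)] v(1)[of x]]
          Lsq_Cauchy_Schwarz[OF u(2) Lsq_diff[OF v(1)[of x] v(2)]] by linarith
      finally show "norm (Lsq_inner (u x) (v x) - Lsq_inner u' v') \<le>
        Lsq_norm (\<lambda>\<xi>. u x \<xi> - u' \<xi>) * Lsq_norm (v x) + Lsq_norm u' * Lsq_norm (\<lambda>\<xi>. v x \<xi> - v' \<xi>)"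
        by simp
    qed
    have "((\<lambda>x. Lsq_norm (\<lambda>\<xi>. u x \<xi> - u' \<xi>) * Lsq_norm (v x) + Lsq_norm u' * Lsq_norm (\<lambda>\<xi>. v x \<xi> - v' \<xi>))
      \<longlongrightarrow> 0 * Lsq_norm v' + Lsq_norm u' * 0) F"
      by (intro tendsto_intros u(3) v(3) Lsq_norm_tendsto v)
    then show "((\<lambda>x. Lsq_norm (\<lambda>\<xi>. u x \<xi> - u' \<xi>) * Lsq_norm (v x) + Lsq_norm u' * Lsq_norm (\<lambda>\<xi>. v x \<xi> - v' \<xi>))
      \<longlongrightarrow> 0) F" by simp
  qed
  then show ?thesis by (rule LIM_zero_cancel)
qed

theorem Plancherel:
  assumes "has_fourier_transform u g"
  shows "Lsq_norm g = Lsq_norm u"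
proof (rule tendsto_unique)
  note L = has_fourier_transform_Lsq[OF assms]
  show "((\<lambda>R. Lsq_norm (truncation R u)) \<longlongrightarrow> Lsq_norm u) at_top"
    by (intro Lsq_norm_tendsto truncation_Lsq L truncation_tendsto)
  have "((\<lambda>R. Lsq_norm (fourier_integral (truncation R u))) \<longlongrightarrow> Lsq_norm g) at_top"
    using assms by (intro Lsq_norm_tendsto fourier_truncation_Lsq L) (auto simp: has_fourier_transform_iff)
  then show "((\<lambda>R. Lsq_norm (truncation R u)) \<longlongrightarrow> Lsq_norm g) at_top"
    by (simp add: Plancherel_bounded_support[OF truncation_Lsq_bdd[OF L(1)]])
qed simp

lemma Parseval:
  assumes "has_fourier_transform u g" "has_fourier_transform v k"
  shows "Lsq_inner g k = Lsq_inner u v"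
  using Plancherel[OF has_fourier_transform_add[OF assms]] Plancherel[OF assms(1)] Plancherel[OF assms(2)]
    Lsq_norm_add_square[OF has_fourier_transform_Lsq(2)[OF assms(1)] has_fourier_transform_Lsq(2)[OF assms(2)]]
    Lsq_norm_add_square[OF has_fourier_transform_Lsq(1)[OF assms(1)] has_fourier_transform_Lsq(1)[OF assms(2)]]
  by simp

lemma has_fourier_transform_cong_AE:
  assumes ft: "has_fourier_transform u g" and g': "g' \<in> Lsq" and "Lsq_norm (\<lambda>\<xi>. g \<xi> - g' \<xi>) = 0"
  shows "has_fourier_transform u g'"
proof -
  note L = has_fourier_transform_Lsq[OF ft]
  have ae: "AE \<xi> in lebesgue. g \<xi> - g' \<xi> = 0"
    using Lsq_norm_eq_0_iff[OF Lsq_diff[OF L(2) g']] assms(3) by simp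
  have "Lsq_norm (\<lambda>\<xi>. fourier_integral (truncation R u) \<xi> - g' \<xi>)
      = Lsq_norm (\<lambda>\<xi>. fourier_integral (truncation R u) \<xi> - g \<xi>)" for R
    by (intro Lsq_norm_cong_AE Lsq_diff fourier_truncation_Lsq L g', use ae in eventually_elim) simp
  then show ?thesis using ft g' by (simp add: has_fourier_transform_iff)
qed

lemma has_fourier_transform_unique:
  assumes "has_fourier_transform u g" "has_fourier_transform u g'"
  shows "Lsq_norm (\<lambda>\<xi>. g \<xi> - g' \<xi>) = 0"
  using Plancherel[OF has_fourier_transform_diff[OF assms]] by simp

lemma has_fourier_transform_bounded_support:
  assumes u: "u \<in> Lsq_bdd"
  shows "has_fourier_transform u (fourier_integral u)"
proof -
  note uL = Lsq_bdd_Lsq[OF u]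
  have "Lsq_norm (\<lambda>\<xi>. fourier_integral (truncation R u) \<xi> - fourier_integral u \<xi>)
     = Lsq_norm (\<lambda>x. truncation R u x - u x)" for R
  proof -
    have "(\<lambda>\<xi>. fourier_integral (truncation R u) \<xi> - fourier_integral u \<xi>)
      = fourier_integral (\<lambda>x. truncation R u x - u x)"
      by (rule ext, rule fourier_integral_diff[symmetric]) (rule truncation_integrable[OF uL] Lsq_bdd_integrable[OF u])+
    then show ?thesis
      using Plancherel_bounded_support[OF Lsq_bdd_diff[OF truncation_Lsq_bdd[OF uL] u]] by simp
  qed
  then show ?thesis
    using uL fourier_integral_contraction(1)[OF u] truncation_tendsto[OF uL]
    by (simp add: has_fourier_transform_iff)
qed

subsection \<open>Surjectivity\<close>

lemma Lsq_cnj: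
  assumes "u \<in> Lsq"
  shows "(\<lambda>x. cnj (u x)) \<in> Lsq" "Lsq_norm (\<lambda>x. cnj (u x)) = Lsq_norm u"
proof -
  have "(\<lambda>x. cnj (u x)) \<in> borel_measurable lebesgue"
    by (rule measurable_compose[OF Lsq_measurable[OF assms]])
       (intro borel_measurable_continuous_onI continuous_intros)
  then show "(\<lambda>x. cnj (u x)) \<in> Lsq" by (rule Lsq_bound[OF assms]) simp
qed (simp add: Lsq_norm_def)

lemma fourier_integral_multiplication:
  fixes u v :: "'a::euclidean_space \<Rightarrow> complex"
  assumes u: "u \<in> Lsq_bdd" and v: "v \<in> Lsq_bdd"
  shows "Lsq_inner (fourier_integral u) (\<lambda>x. cnj (v x)) = Lsq_inner u (\<lambda>x. cnj (fourier_integral v x))"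
proof -
  have ui: "integrable lebesgue u" and vi: "integrable lebesgue v"
    using u v by (auto intro: Lsq_bdd_integrable)
  have [measurable]: "u \<in> borel_measurable lebesgue" "v \<in> borel_measurable lebesgue" using ui vi by auto
  define Q where "Q p = cis (- (fst p \<bullet> snd p)) * (u (fst p) * v (snd p))" for p :: "'a \<times> 'a"
  have Q: "integrable (lebesgue \<Otimes>\<^sub>M lebesgue) Q"
  proof (rule Bochner_Integration.integrable_bound)
    show "integrable (lebesgue \<Otimes>\<^sub>M lebesgue) (\<lambda>p. u (fst p) * v (snd p))"
      by (rule lebesgue_pair.integral_tensor(1)[OF ui vi])
    show "Q \<in> borel_measurable (lebesgue \<Otimes>\<^sub>M lebesgue)" unfolding Q_def cis_conv_exp by measurable
  qed (simp add: Q_def norm_mult)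
  let ?c = "complex_of_real ((2 * pi) powr (- real DIM('a) / 2))"
  have "(LINT \<xi>|lebesgue. fourier_integral u \<xi> * v \<xi>) = ?c * (LINT \<xi>|lebesgue. LINT x|lebesgue. Q (x, \<xi>))"
    by (simp add: fourier_integral_def Q_def mult.assoc flip: integral_mult_left_zero integral_mult_right_zero)
  also have "(LINT \<xi>|lebesgue. LINT x|lebesgue. Q (x, \<xi>)) = (LINT x|lebesgue. LINT \<xi>|lebesgue. Q (x, \<xi>))"
    using lebesgue_pair.Fubini_integral[of "\<lambda>x \<xi>. Q (x, \<xi>)"] Q by simp
  also have "?c * \<dots> = (LINT x|lebesgue. u x * fourier_integral v x)"
    by (simp add: fourier_integral_def Q_def mult_ac inner_commute flip: integral_mult_left_zero integral_mult_right_zero)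
  finally have eq: "(LINT \<xi>|lebesgue. fourier_integral u \<xi> * v \<xi>) = (LINT x|lebesgue. u x * fourier_integral v x)" .
  have re: "Lsq_inner a (\<lambda>x. cnj (b x)) = Re (LINT x|lebesgue. a x * b x)" if "a \<in> Lsq" "b \<in> Lsq" for a b :: "'a \<Rightarrow> complex"
  proof -
    have [measurable]: "a \<in> borel_measurable lebesgue" "b \<in> borel_measurable lebesgue" using that by (auto intro: Lsq_measurable)
    have "integrable lebesgue (\<lambda>x. a x * b x)"
    proof (rule Bochner_Integration.integrable_bound)
      show "integrable lebesgue (\<lambda>x. norm (a x) \<bullet> norm (b x))"
        by (rule Lsq_inner_integrable) (use that in \<open>auto simp: Lsq_def\<close>)
    qed (auto simp: norm_mult)
    from integral_Re[OF this] show ?thesis by (simp add: Lsq_inner_def inner_complex_def)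
  qed
  show ?thesis
    using eq by (simp add: re fourier_integral_contraction(1) u v Lsq_bdd_Lsq)
qed

text \<open>Fubini's theorem for bounded supports, and continuity of the inner product in general. The
  conjugates turn the real inner product into the real part of the bilinear pairing.\<close>

lemma Fourier_multiplication_formula:
  assumes "has_fourier_transform u g" "has_fourier_transform v k"
  shows "Lsq_inner g (\<lambda>x. cnj (v x)) = Lsq_inner u (\<lambda>x. cnj (k x))"
proof (rule tendsto_unique)
  note L = has_fourier_transform_Lsq[OF assms(1)] has_fourier_transform_Lsq[OF assms(2)]
  have cnj_diff: "Lsq_norm (\<lambda>x. cnj (a x) - cnj (b x)) = Lsq_norm (\<lambda>x. a x - b x)" for a b :: "'a \<Rightarrow> complex"
    by (simp add: Lsq_norm_def flip: complex_cnj_diff)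
  show "((\<lambda>R. Lsq_inner (truncation R u) (\<lambda>x. cnj (fourier_integral (truncation R v) x)))
      \<longlongrightarrow> Lsq_inner u (\<lambda>x. cnj (k x))) at_top"
    using assms(2)
    by (intro Lsq_inner_tendsto truncation_Lsq L truncation_tendsto Lsq_cnj(1) fourier_truncation_Lsq)
       (simp add: cnj_diff has_fourier_transform_iff)
  have "((\<lambda>R. Lsq_inner (fourier_integral (truncation R u)) (\<lambda>x. cnj (truncation R v x)))
      \<longlongrightarrow> Lsq_inner g (\<lambda>x. cnj (v x))) at_top"
    using assms(1)
    by (intro Lsq_inner_tendsto truncation_Lsq L Lsq_cnj(1) fourier_truncation_Lsq)
       (simp_all add: cnj_diff has_fourier_transform_iff truncation_tendsto L)
  then show "((\<lambda>R. Lsq_inner (truncation R u) (\<lambda>x. cnj (fourier_integral (truncation R v) x)))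
      \<longlongrightarrow> Lsq_inner g (\<lambda>x. cnj (v x))) at_top"
    by (simp add: fourier_integral_multiplication truncation_Lsq_bdd L)
qed simp

text \<open>By the multiplication formula, \<open>G v = (F v\<^sup>*)\<^sup>*\<close> is the adjoint of the isometry \<open>F\<close>, and it is
  itself an isometry; hence \<open>\<parallel>F G g - g\<parallel>\<^sup>2 = \<parallel>g\<parallel>\<^sup>2 - 2 \<parallel>G g\<parallel>\<^sup>2 + \<parallel>g\<parallel>\<^sup>2 = 0\<close>.\<close>

theorem has_fourier_transform_surj:
  fixes g :: "'a::euclidean_space \<Rightarrow> complex"
  assumes g: "g \<in> Lsq"
  shows "\<exists>w. has_fourier_transform w g"
proof -
  obtain k where k: "has_fourier_transform (\<lambda>x. cnj (g x)) k"
    using has_fourier_transform_exists[OF Lsq_cnj(1)[OF g]] by blast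
  note kL = has_fourier_transform_Lsq(2)[OF k]
  let ?w = "\<lambda>x. cnj (k x)"
  have wL: "?w \<in> Lsq" by (rule Lsq_cnj(1)[OF kL])
  obtain l where l: "has_fourier_transform ?w l" using has_fourier_transform_exists[OF wL] by blast
  note lL = has_fourier_transform_Lsq(2)[OF l]
  have w: "Lsq_norm ?w = Lsq_norm g"
    using Lsq_cnj(2)[OF kL] Plancherel[OF k] Lsq_cnj(2)[OF g] by simp
  have "Lsq_inner l g = Lsq_inner ?w ?w"
    using Fourier_multiplication_formula[OF l k] by simp
  then have "(Lsq_norm (\<lambda>\<xi>. l \<xi> - g \<xi>))\<^sup>2 = 0"
    using Lsq_norm_diff_square[OF lL g] Plancherel[OF l] w by (simp add: Lsq_norm_square[of ?w, symmetric])
  then have "has_fourier_transform ?w g"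
    using has_fourier_transform_cong_AE[OF l g] by simp
  then show ?thesis by blast
qed

subsection \<open>Real functions\<close>

text \<open>Reflection enters because conjugating a function conjugates and reflects its transform.\<close>

lemma distr_lebesgue_uminus: "distr lebesgue lebesgue (uminus :: 'a::euclidean_space \<Rightarrow> 'a) = lebesgue"
  and lebesgue_measurable_uminus: "(uminus :: 'a \<Rightarrow> 'a) \<in> lebesgue \<rightarrow>\<^sub>M lebesgue"
proof -
  have T: "(\<lambda>x::'a. 0 + (\<Sum>j\<in>Basis. ((-1) * (x \<bullet> j)) *\<^sub>R j)) = uminus"
    by (simp add: fun_eq_iff sum_negf euclidean_representation)
  show "distr lebesgue lebesgue (uminus :: 'a \<Rightarrow> 'a) = lebesgue"
    using lebesgue_affine_euclidean[of "\<lambda>_::'a. -1" 0] unfolding T by (simp add: density_1)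
  show "(uminus :: 'a \<Rightarrow> 'a) \<in> lebesgue \<rightarrow>\<^sub>M lebesgue"
    using lebesgue_affine_measurable[of "\<lambda>_::'a. -1" 0] unfolding T by simp
qed

lemma Lsq_reflect:
  assumes "u \<in> Lsq"
  shows "(\<lambda>x. u (- x)) \<in> Lsq" "Lsq_norm (\<lambda>x. u (- x)) = Lsq_norm u"
proof -
  have um: "u \<in> borel_measurable lebesgue" using assms by (rule Lsq_measurable)
  then have sq: "(\<lambda>x. (norm (u x))\<^sup>2) \<in> borel_measurable lebesgue" by measurable
  have m: "(\<lambda>x. u (- x)) \<in> borel_measurable lebesgue"
    by (rule measurable_compose[OF lebesgue_measurable_uminus um])
  have "integrable (distr lebesgue lebesgue uminus) (\<lambda>x. (norm (u x))\<^sup>2)"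
    unfolding distr_lebesgue_uminus by (rule Lsq_integrable_square[OF assms])
  then have "integrable lebesgue (\<lambda>x. (norm (u (- x)))\<^sup>2)"
    using integrable_distr_eq[OF lebesgue_measurable_uminus sq] by simp
  then show "(\<lambda>x. u (- x)) \<in> Lsq" using m by (simp add: Lsq_def)
  show "Lsq_norm (\<lambda>x. u (- x)) = Lsq_norm u"
    using integral_distr[OF lebesgue_measurable_uminus sq] unfolding distr_lebesgue_uminus
    by (simp add: Lsq_norm_def)
qed

lemma fourier_integral_cnj:
  "fourier_integral (\<lambda>x. cnj (u x)) \<xi> = cnj (fourier_integral u (- \<xi>))"
proof -
  have "(LINT x|lebesgue. cis (- (x \<bullet> \<xi>)) * cnj (u x)) = cnj (LINT x|lebesgue. cis (- (x \<bullet> - \<xi>)) * u x)"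
    by (subst Bochner_Integration.integral_cnj[symmetric]) (simp add: cis_cnj)
  then show ?thesis
    by (simp only: fourier_integral_def complex_cnj_mult complex_cnj_complex_of_real)
qed

lemma has_fourier_transform_cnj:
  assumes "has_fourier_transform u g"
  shows "has_fourier_transform (\<lambda>x. cnj (u x)) (\<lambda>\<xi>. cnj (g (- \<xi>)))"
proof -
  note L = has_fourier_transform_Lsq[OF assms]
  have "Lsq_norm (\<lambda>\<xi>. fourier_integral (truncation R (\<lambda>x. cnj (u x))) \<xi> - cnj (g (- \<xi>)))
    = Lsq_norm (\<lambda>\<xi>. fourier_integral (truncation R u) \<xi> - g \<xi>)" for R
  proof -
    have "truncation R (\<lambda>x. cnj (u x)) = (\<lambda>x. cnj (truncation R u x))"
      by (simp add: truncation_def[abs_def] indicator_def fun_eq_iff)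
    then have "(\<lambda>\<xi>. fourier_integral (truncation R (\<lambda>x. cnj (u x))) \<xi> - cnj (g (- \<xi>)))
       = (\<lambda>\<xi>. cnj (fourier_integral (truncation R u) (- \<xi>) - g (- \<xi>)))"
      by (simp add: fourier_integral_cnj)
    then show ?thesis
      using Lsq_cnj(2)[OF Lsq_reflect(1)[OF Lsq_diff[OF fourier_truncation_Lsq[OF L(1), of R] L(2)]]]
        Lsq_reflect(2)[OF Lsq_diff[OF fourier_truncation_Lsq[OF L(1), of R] L(2)]] by simp
  qed
  then show ?thesis
    using assms Lsq_cnj(1)[OF Lsq_reflect(1)[OF L(2)]] Lsq_cnj(1)[OF L(1)]
    by (simp add: has_fourier_transform_iff)
qed

text \<open>A preimage of \<open>g\<close> and its conjugate have the same transform when \<open>g\<close> is Hermitian, so the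
  real part of the preimage, their mean, is again a preimage.\<close>

lemma has_fourier_transform_surj_real:
  fixes g :: "'a::euclidean_space \<Rightarrow> complex"
  assumes g: "g \<in> Lsq" and herm: "\<And>\<xi>. g (- \<xi>) = cnj (g \<xi>)"
  shows "\<exists>w\<in>Lsq. has_fourier_transform (\<lambda>x. complex_of_real (w x)) g"
proof -
  obtain w where w: "has_fourier_transform w g" using has_fourier_transform_surj[OF g] by blast
  have "has_fourier_transform (\<lambda>x. (1/2) *\<^sub>R (w x + cnj (w x))) (\<lambda>\<xi>. (1/2) *\<^sub>R (g \<xi> + g \<xi>))"
    using has_fourier_transform_cnj[OF w]
    by (intro has_fourier_transform_scaleR has_fourier_transform_add w) (simp add: herm)
  moreover have "(\<lambda>x. (1/2) *\<^sub>R (w x + cnj (w x))) = (\<lambda>x. complex_of_real (Re (w x)))"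
    by (simp add: complex_add_cnj scaleR_conv_of_real)
  moreover have "(\<lambda>\<xi>. (1/2) *\<^sub>R (g \<xi> + g \<xi>)) = g" by (simp add: scaleR_conv_of_real fun_eq_iff)
  ultimately have ft: "has_fourier_transform (\<lambda>x. complex_of_real (Re (w x))) g" by simp
  have "(\<lambda>x. Re (w x)) \<in> Lsq"
  proof (rule Lsq_bound[OF has_fourier_transform_Lsq(1)[OF w]])
    show "(\<lambda>x. Re (w x)) \<in> borel_measurable lebesgue"
      using Lsq_measurable[OF has_fourier_transform_Lsq(1)[OF w]] by measurable
  qed (simp add: abs_Re_le_cmod)
  then show ?thesis using ft by (intro bexI[of _ "\<lambda>x. Re (w x)"])
qed

section \<open>The fractional Laplacian on functions with bounded support\<close>

text \<open>A concrete representative of the Fourier transform of \<open>(-\<Delta>)\<^sup>s\<^sup>/\<^sup>2 u\<close>. It is linear in \<open>u\<close> pointwise and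
  not only up to null sets.\<close>

definition frac_symbol :: "real \<Rightarrow> ('a::euclidean_space \<Rightarrow> real) \<Rightarrow> 'a \<Rightarrow> complex" where
  "frac_symbol s u \<xi> = of_real (norm \<xi> powr s) * fourier_integral (\<lambda>x. of_real (u x)) \<xi>"

lemma Lsq_of_real:
  assumes "u \<in> Lsq"
  shows "(\<lambda>x. complex_of_real (u x)) \<in> Lsq"
proof -
  have "(\<lambda>x. complex_of_real (u x)) \<in> borel_measurable lebesgue"
    using Lsq_measurable[OF assms] by measurable
  then show ?thesis by (rule Lsq_bound[OF assms]) simp
qed

lemma Lsq_norm_of_real: "Lsq_norm (\<lambda>x. complex_of_real (u x)) = Lsq_norm u"
  by (simp add: Lsq_norm_def)

lemma Lsq_bdd_of_real: "u \<in> Lsq_bdd \<Longrightarrow> (\<lambda>x. complex_of_real (u x)) \<in> Lsq_bdd"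
  by (simp add: Lsq_bdd_def Lsq_of_real)

lemma frac_symbol_measurable:
  fixes u :: "'a::euclidean_space \<Rightarrow> real"
  assumes "u \<in> Lsq"
  shows "frac_symbol s u \<in> borel_measurable lebesgue"
proof -
  have [measurable]: "fourier_integral (\<lambda>x. complex_of_real (u x)) \<in> borel_measurable lebesgue"
    by (rule fourier_integral_measurable[OF Lsq_measurable[OF Lsq_of_real[OF assms]]])
  have "(\<lambda>\<xi>::'a. norm \<xi>) \<in> borel_measurable lebesgue"
    by (rule measurable_compose[OF ident_borel_measurable_lebesgue]) measurable
  then have [measurable]: "(\<lambda>\<xi>::'a. complex_of_real (norm \<xi> powr s)) \<in> borel_measurable lebesgue"
    by measurable
  show ?thesis unfolding frac_symbol_def[abs_def] by measurable
qed

lemma frac_symbol_add: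
  assumes "u \<in> Lsq_bdd" "v \<in> Lsq_bdd"
  shows "frac_symbol s (\<lambda>x. u x + v x) = (\<lambda>\<xi>. frac_symbol s u \<xi> + frac_symbol s v \<xi>)"
  using fourier_integral_add[OF Lsq_bdd_integrable[OF Lsq_bdd_of_real[OF assms(1)]]
      Lsq_bdd_integrable[OF Lsq_bdd_of_real[OF assms(2)]]]
  by (simp add: frac_symbol_def fun_eq_iff distrib_left)

lemma frac_symbol_diff:
  assumes "u \<in> Lsq_bdd" "v \<in> Lsq_bdd"
  shows "frac_symbol s (\<lambda>x. u x - v x) = (\<lambda>\<xi>. frac_symbol s u \<xi> - frac_symbol s v \<xi>)"
  using fourier_integral_diff[OF Lsq_bdd_integrable[OF Lsq_bdd_of_real[OF assms(1)]]
      Lsq_bdd_integrable[OF Lsq_bdd_of_real[OF assms(2)]]]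
  by (simp add: frac_symbol_def fun_eq_iff right_diff_distrib)

lemma frac_symbol_scale: "frac_symbol s (\<lambda>x. c * u x) = (\<lambda>\<xi>. c *\<^sub>R frac_symbol s u \<xi>)"
  using fourier_integral_scaleR[of c "\<lambda>x. complex_of_real (u x)"]
  by (simp add: frac_symbol_def fun_eq_iff scaleR_conv_of_real)

lemma frac_symbol_hermitian: "frac_symbol s u (- \<xi>) = cnj (frac_symbol s u \<xi>)"
  using fourier_integral_cnj[of "\<lambda>x. complex_of_real (u x)" "- \<xi>"]
  by (simp add: frac_symbol_def)

lemma Lsq_cong_AE:
  assumes "u \<in> Lsq" "v \<in> borel_measurable lebesgue" "AE x in lebesgue. u x = v x"
  shows "v \<in> Lsq"
proof -
  have "(\<integral>\<^sup>+x. ennreal ((norm (v x))\<^sup>2) \<partial>lebesgue) = (\<integral>\<^sup>+x. ennreal ((norm (u x))\<^sup>2) \<partial>lebesgue)"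
    by (rule nn_integral_cong_AE) (use assms(3) in \<open>eventually_elim, simp\<close>)
  then show ?thesis using assms(1,2) by (simp add: Lsq_iff_nn_integral)
qed

text \<open>The Fourier transform of \<open>u\<close> is determined up to null sets, so it can be taken to be the Fourier
  integral, which exists everywhere because of the bounded support.\<close>

lemma has_frac_laplacian_iff:
  fixes u w :: "'a::euclidean_space \<Rightarrow> real"
  assumes u: "u \<in> Lsq_bdd"
  shows "has_frac_laplacian (s / 2) u w \<longleftrightarrow>
    w \<in> Lsq \<and> has_fourier_transform (\<lambda>x. of_real (w x)) (frac_symbol s u)"
proof
  note uL = Lsq_bdd_Lsq[OF u]
  note ft = has_fourier_transform_bounded_support[OF Lsq_bdd_of_real[OF u]]
  {
    assume "has_frac_laplacian (s / 2) u w"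
    then obtain g where w: "w \<in> Lsq" and g: "has_fourier_transform (\<lambda>x. complex_of_real (u x)) g"
      and gw: "has_fourier_transform (\<lambda>x. complex_of_real (w x)) (\<lambda>\<xi>. of_real (norm \<xi> powr s) * g \<xi>)"
      by (auto simp: has_frac_laplacian_def)
    have gL: "g \<in> Lsq" "(\<lambda>\<xi>. of_real (norm \<xi> powr s) * g \<xi>) \<in> Lsq"
      using has_fourier_transform_Lsq(2)[OF g] has_fourier_transform_Lsq(2)[OF gw] by auto
    have "AE \<xi> in lebesgue. g \<xi> - fourier_integral (\<lambda>x. of_real (u x)) \<xi> = 0"
      using has_fourier_transform_unique[OF g ft]
        Lsq_norm_eq_0_iff[OF Lsq_diff[OF gL(1) has_fourier_transform_Lsq(2)[OF ft]]] by simp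
    then have ae: "AE \<xi> in lebesgue. of_real (norm \<xi> powr s) * g \<xi> = frac_symbol s u \<xi>"
      by eventually_elim (simp add: frac_symbol_def)
    have sL: "frac_symbol s u \<in> Lsq"
      by (rule Lsq_cong_AE[OF gL(2) frac_symbol_measurable[OF uL] ae])
    have "Lsq_norm (\<lambda>\<xi>. of_real (norm \<xi> powr s) * g \<xi> - frac_symbol s u \<xi>) = 0"
      using Lsq_norm_eq_0_iff[OF Lsq_diff[OF gL(2) sL]] ae by simp
    then show "w \<in> Lsq \<and> has_fourier_transform (\<lambda>x. of_real (w x)) (frac_symbol s u)"
      using w has_fourier_transform_cong_AE[OF gw sL] by simp
  next
    assume "w \<in> Lsq \<and> has_fourier_transform (\<lambda>x. of_real (w x)) (frac_symbol s u)"
    then show "has_frac_laplacian (s / 2) u w"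
      unfolding has_frac_laplacian_def frac_symbol_def[abs_def]
      by (intro conjI uL exI[of _ "fourier_integral (\<lambda>x. of_real (u x))"] ft) simp_all
  }
qed

lemma has_frac_laplacian_exists:
  assumes u: "u \<in> Lsq_bdd" and "frac_symbol s u \<in> Lsq"
  shows "\<exists>w\<in>Lsq. has_frac_laplacian (s / 2) u w"
  using has_fourier_transform_surj_real[OF assms(2) frac_symbol_hermitian]
  by (auto simp: has_frac_laplacian_iff[OF u])

lemma Htilde_Lsq_bdd:
  fixes \<Omega> :: "'a::euclidean_space set"
  assumes "bounded \<Omega>" "u \<in> Htilde s \<Omega>"
  shows "u \<in> Lsq_bdd"
proof -
  obtain R where R: "closure \<Omega> \<subseteq> ball 0 R"
    using bounded_closure[OF assms(1)] bounded_subset_ballD by blast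
  have uL: "u \<in> Lsq" and "AE x in lebesgue. x \<in> - closure \<Omega> \<longrightarrow> u x = 0"
    using assms(2) by (auto simp: Htilde_def Hs_def)
  from this(2) have "AE x in lebesgue. R \<le> norm x \<longrightarrow> u x = 0"
  proof eventually_elim
    case (elim x)
    then show ?case using R by (auto simp: subset_iff not_less[symmetric])
  qed
  then show ?thesis using uL by (auto simp: Lsq_bdd_def)
qed

text \<open>By surjectivity of the Fourier transform, square integrability of the symbol suffices for the
  existence of the fractional Laplacian; this is how membership is shown for truncated functions.\<close>

lemma Htilde_iff:
  fixes \<Omega> :: "'a::euclidean_space set"
  assumes "bounded \<Omega>"
  shows "u \<in> Htilde s \<Omega> \<longleftrightarrow> u \<in> Lsq_bdd \<and> (AE x in lebesgue. x \<in> - closure \<Omega> \<longrightarrow> u x = 0)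
    \<and> frac_symbol s u \<in> Lsq"
proof
  assume u: "u \<in> Htilde s \<Omega>"
  have b: "u \<in> Lsq_bdd" by (rule Htilde_Lsq_bdd[OF assms u])
  obtain w where "has_frac_laplacian (s / 2) u w" using u by (auto simp: Htilde_def Hs_def)
  then have "frac_symbol s u \<in> Lsq" using has_frac_laplacian_iff[OF b] has_fourier_transform_Lsq(2) by blast
  then show "u \<in> Lsq_bdd \<and> (AE x in lebesgue. x \<in> - closure \<Omega> \<longrightarrow> u x = 0) \<and> frac_symbol s u \<in> Lsq"
    using b u by (simp add: Htilde_def)
next
  assume "u \<in> Lsq_bdd \<and> (AE x in lebesgue. x \<in> - closure \<Omega> \<longrightarrow> u x = 0) \<and> frac_symbol s u \<in> Lsq"
  then show "u \<in> Htilde s \<Omega>"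
    using has_frac_laplacian_exists[of u s] Lsq_bdd_Lsq[of u] by (auto simp: Htilde_def Hs_def)
qed

lemma frac_laplacian_fourier:
  fixes \<Omega> :: "'a::euclidean_space set"
  assumes "bounded \<Omega>" "u \<in> Htilde s \<Omega>"
  shows "has_fourier_transform (\<lambda>x. of_real (frac_laplacian (s / 2) u x)) (frac_symbol s u)"
proof -
  have "\<exists>w. has_frac_laplacian (s / 2) u w" using assms(2) by (auto simp: Htilde_def Hs_def)
  then have "has_frac_laplacian (s / 2) u (frac_laplacian (s / 2) u)"
    unfolding frac_laplacian_def by (rule someI_ex)
  then show ?thesis using has_frac_laplacian_iff[OF Htilde_Lsq_bdd[OF assms]] by simp
qed

lemma Htilde_norm_eq:
  fixes \<Omega> :: "'a::euclidean_space set"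
  assumes "bounded \<Omega>" "u \<in> Htilde s \<Omega>"
  shows "Htilde_norm s u = Lsq_norm (frac_symbol s u)"
  using Plancherel[OF frac_laplacian_fourier[OF assms]] by (simp add: Htilde_norm_def Lsq_norm_of_real)

text \<open>Parseval's identity moves the bilinear form to the Fourier side, where it no longer involves the
  choice made in the definition of the fractional Laplacian.\<close>

lemma frac_laplacian_dual_eq:
  fixes \<Omega> :: "'a::euclidean_space set"
  assumes "bounded \<Omega>" "u \<in> Htilde s \<Omega>" "v \<in> Htilde s \<Omega>"
  shows "frac_laplacian_dual s u v = Lsq_inner (frac_symbol s u) (frac_symbol s v)"
proof -
  have "frac_laplacian_dual s u v = Lsq_inner (\<lambda>x. complex_of_real (frac_laplacian (s / 2) u x))
      (\<lambda>x. complex_of_real (frac_laplacian (s / 2) v x))"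
    by (simp add: frac_laplacian_dual_def Lsq_inner_def inner_complex_def)
  also have "\<dots> = Lsq_inner (frac_symbol s u) (frac_symbol s v)"
    by (rule Parseval[OF frac_laplacian_fourier[OF assms(1,2)] frac_laplacian_fourier[OF assms(1,3)], symmetric])
  finally show ?thesis .
qed

lemma Htilde_add:
  fixes \<Omega> :: "'a::euclidean_space set"
  assumes "bounded \<Omega>" "u \<in> Htilde s \<Omega>" "v \<in> Htilde s \<Omega>"
  shows "(\<lambda>x. u x + v x) \<in> Htilde s \<Omega>"
proof -
  have "AE x in lebesgue. x \<in> - closure \<Omega> \<longrightarrow> u x = 0" "AE x in lebesgue. x \<in> - closure \<Omega> \<longrightarrow> v x = 0"
    using assms by (auto simp: Htilde_def)
  then have "AE x in lebesgue. x \<in> - closure \<Omega> \<longrightarrow> u x + v x = 0" by eventually_elim simp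
  then show ?thesis
    using assms by (auto simp: Htilde_iff frac_symbol_add Lsq_bdd_add intro: Lsq_add)
qed

lemma Htilde_scale:
  fixes \<Omega> :: "'a::euclidean_space set"
  assumes "bounded \<Omega>" "u \<in> Htilde s \<Omega>"
  shows "(\<lambda>x. c * u x) \<in> Htilde s \<Omega>"
proof -
  have "AE x in lebesgue. x \<in> - closure \<Omega> \<longrightarrow> u x = 0"
    using assms by (auto simp: Htilde_def)
  then have "AE x in lebesgue. x \<in> - closure \<Omega> \<longrightarrow> c * u x = 0" by eventually_elim simp
  then show ?thesis
    using assms Lsq_bdd_scaleR[of u c] by (auto simp: Htilde_iff frac_symbol_scale intro: Lsq_scaleR)
qed

lemma Htilde_diff:
  fixes \<Omega> :: "'a::euclidean_space set"
  assumes "bounded \<Omega>" "u \<in> Htilde s \<Omega>" "v \<in> Htilde s \<Omega>"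
  shows "(\<lambda>x. u x - v x) \<in> Htilde s \<Omega>"
  using Htilde_add[OF assms(1,2) Htilde_scale[OF assms(1,3), of "-1"]] by simp

section \<open>Truncations decrease the energy\<close>

definition heat_weight :: "real \<Rightarrow> real \<Rightarrow> real" where
  "heat_weight s t = indicator {0<..} t * t powr (- 1 - s)"

lemma heat_weight_nonneg: "0 \<le> heat_weight s t"
  by (simp add: heat_weight_def)

lemma heat_weight_measurable [measurable]: "heat_weight s \<in> borel_measurable borel"
  unfolding heat_weight_def[abs_def] by measurable

text \<open>The value of \<open>\<integral>\<^sub>0\<^sup>\<infinity> (1 - e\<^sup>-\<^sup>t) t\<^sup>-\<^sup>1\<^sup>-\<^sup>s dt\<close>, which is \<open>\<Gamma>(1 - s) / s\<close>. It is positive and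
  finite for \<open>0 < s < 1\<close>, and can then be cancelled.\<close>

definition subordination_const :: "real \<Rightarrow> ennreal" where
  "subordination_const s = (\<integral>\<^sup>+t. ennreal (heat_weight s t * (1 - exp (- t))) \<partial>lborel)"

text \<open>Near 0 the integrand is at most \<open>t\<^sup>-\<^sup>s\<close>, and near infinity at most \<open>t\<^sup>-\<^sup>1\<^sup>-\<^sup>s\<close>.\<close>

lemma subordination_const_finite:
  assumes "0 < s" "s < 1"
  shows "subordination_const s < \<infinity>"
proof -
  have "subordination_const s \<le> (\<integral>\<^sup>+t. ennreal (indicator {0..1} t * t powr (- s)) + ennreal (indicator {1..} t * t powr (- 1 - s)) \<partial>lborel)"
    unfolding subordination_const_def
  proof (rule nn_integral_mono)
    fix t :: real
    have "heat_weight s t * (1 - exp (- t)) \<le> indicator {0..1} t * t powr (- s) + indicator {1..} t * t powr (- 1 - s)"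
    proof (cases "0 < t")
      case True
      have *: "1 - exp (- t) \<le> t" using exp_ge_add_one_self[of "- t"] by simp
      have eq: "t powr (- 1 - s) * t = t powr (- s)"
        using True powr_add[of t "- 1 - s" 1] by simp
      show ?thesis
      proof (cases "t \<le> 1")
        case True
        have "t powr (- 1 - s) * (1 - exp (- t)) \<le> t powr (- 1 - s) * t" by (rule mult_left_mono[OF *]) simp
        then have "t powr (- 1 - s) * (1 - exp (- t)) \<le> t powr (- s)" unfolding eq .
        moreover have "0 \<le> indicator {1..} t * t powr (- 1 - s)" by simp
        ultimately have "t powr (- 1 - s) * (1 - exp (- t)) \<le> t powr (- s) + indicator {1..} t * t powr (- 1 - s)"
          by (rule add_increasing2[rotated])
        then show ?thesis using True \<open>0 < t\<close> by (simp add: heat_weight_def)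
      next
        case False
        have "t powr (- 1 - s) * (1 - exp (- t)) \<le> t powr (- 1 - s) * 1" by (rule mult_left_mono) auto
        then show ?thesis using False by (simp add: heat_weight_def)
      qed
    qed (simp add: heat_weight_def)
    from ennreal_leI[OF this]
    show "ennreal (heat_weight s t * (1 - exp (- t))) \<le>
        ennreal (indicator {0..1} t * t powr (- s)) + ennreal (indicator {1..} t * t powr (- 1 - s))"
      by (subst (asm) ennreal_plus) simp_all
  qed
  also have "\<dots> = (\<integral>\<^sup>+t. ennreal (indicator {0..1} t * t powr (- s)) \<partial>lborel)
      + (\<integral>\<^sup>+t. ennreal (indicator {1..} t * t powr (- 1 - s)) \<partial>lborel)"
    by (rule nn_integral_add) measurable
  also have "(\<integral>\<^sup>+t. ennreal (indicator {0..1} t * t powr (- s)) \<partial>lborel) = ennreal (1 powr (- s + 1) / (- s + 1))"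
    by (rule nn_integral_has_integral_lebesgue) (use has_integral_powr_from_0[of "- s" 1] assms in auto)
  also have "(\<integral>\<^sup>+t. ennreal (indicator {1..} t * t powr (- 1 - s)) \<partial>lborel) = ennreal (- (1 powr (- 1 - s + 1)) / (- 1 - s + 1))"
    by (rule nn_integral_has_integral_lebesgue, simp, rule has_integral_powr_to_inf) (use assms in auto)
  finally show ?thesis by (simp add: le_less_trans ennreal_add_less_top)
qed

lemma subordination_const_pos:
  shows "0 < subordination_const s"
proof (rule ccontr)
  assume "\<not> 0 < subordination_const s"
  then have "subordination_const s = 0" by simp
  then have "AE t in lborel. ennreal (heat_weight s t * (1 - exp (- t))) = 0"
    unfolding subordination_const_def by (subst (asm) nn_integral_0_iff_AE) auto
  then have "AE t in lborel. t \<notin> {0<..<1::real}"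
  proof eventually_elim
    case (elim t)
    show ?case
    proof
      assume t: "t \<in> {0<..<1}"
      then have "0 < heat_weight s t * (1 - exp (- t))" by (simp add: heat_weight_def)
      with elim show False by (simp add: ennreal_eq_0_iff)
    qed
  qed
  then have "emeasure lborel {0<..<1::real} = 0"
    by (subst (asm) AE_iff_measurable[of "{0<..<1}"]) auto
  then show False by simp
qed

text \<open>The substitution of \<open>r t\<close> for \<open>t\<close> in the defining integral of the constant. For \<open>r = |\<xi>|\<^sup>2\<close> it
  writes the symbol of the fractional Laplacian as a positive mixture of the functions
  \<open>1 - exp (-t |\<xi>|\<^sup>2)\<close>, the symbols of \<open>1 - P\<^sub>t\<close>.\<close>

lemma subordination:
  assumes "0 \<le> r"
  shows "(\<integral>\<^sup>+t. ennreal (heat_weight s t * (1 - exp (- t * r))) \<partial>lborel)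
    = ennreal (r powr s) * subordination_const s"
proof (cases "r = 0")
  case False
  then have r: "0 < r" using assms by simp
  have "subordination_const s = ennreal \<bar>r\<bar> * (\<integral>\<^sup>+t. ennreal (heat_weight s (0 + r * t) * (1 - exp (- (0 + r * t)))) \<partial>lborel)"
    unfolding subordination_const_def
    by (rule nn_integral_real_affine) (use r in auto)
  also have "(\<integral>\<^sup>+t. ennreal (heat_weight s (0 + r * t) * (1 - exp (- (0 + r * t)))) \<partial>lborel)
      = (\<integral>\<^sup>+t. ennreal (r powr (- 1 - s)) * ennreal (heat_weight s t * (1 - exp (- t * r))) \<partial>lborel)"
  proof (rule nn_integral_cong)
    fix t
    have "heat_weight s (0 + r * t) = r powr (- 1 - s) * heat_weight s t"
      using r by (auto simp: heat_weight_def indicator_def powr_mult zero_less_mult_iff)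
    then show "ennreal (heat_weight s (0 + r * t) * (1 - exp (- (0 + r * t))))
        = ennreal (r powr (- 1 - s)) * ennreal (heat_weight s t * (1 - exp (- t * r)))"
      by (simp add: mult_ac flip: ennreal_mult')
  qed
  also have "\<dots> = ennreal (r powr (- 1 - s)) * (\<integral>\<^sup>+t. ennreal (heat_weight s t * (1 - exp (- t * r))) \<partial>lborel)"
    by (rule nn_integral_cmult) measurable
  finally have "ennreal (r powr s) * subordination_const s =
      ennreal (r powr s * \<bar>r\<bar> * r powr (- 1 - s)) * (\<integral>\<^sup>+t. ennreal (heat_weight s t * (1 - exp (- t * r))) \<partial>lborel)"
    by (simp add: ennreal_mult mult.assoc)
  moreover have "r powr s * \<bar>r\<bar> * r powr (- 1 - s) = 1"
  proof -
    have "r powr s * r powr 1 * r powr (- 1 - s) = 1" using r by (simp only: powr_add[symmetric]) simp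
    then show ?thesis using r by simp
  qed
  ultimately show ?thesis by simp
qed simp

text \<open>The quadratic form of \<open>1 - P\<^sub>t\<close>, on the Fourier side. It is half the heat energy, but in this form
  its measurability in \<open>t\<close> is immediate from Fubini's theorem.\<close>

definition heat_loss :: "real \<Rightarrow> ('a::euclidean_space \<Rightarrow> complex) \<Rightarrow> ennreal" where
  "heat_loss t u = (\<integral>\<^sup>+\<xi>. ennreal ((1 - exp (- t * (norm \<xi>)\<^sup>2)) * (norm (fourier_integral u \<xi>))\<^sup>2) \<partial>lebesgue)"

lemma heat_loss_eq:
  assumes u: "u \<in> Lsq_bdd" and t: "0 < t"
  shows "heat_loss t u = ennreal (heat_energy t u / 2)"
proof -
  let ?F = "fourier_integral u"
  note FL = fourier_integral_contraction(1)[OF u]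
  note I = fourier_integral_gaussian_weight(1)[OF Lsq_bdd_integrable[OF u] t]
  have eq: "(1 - exp (- t * (norm \<xi>)\<^sup>2)) * (norm (?F \<xi>))\<^sup>2
      = (norm (?F \<xi>))\<^sup>2 - exp (- t * (norm \<xi>)\<^sup>2) * (norm (?F \<xi>))\<^sup>2" for \<xi>
    by (simp add: algebra_simps)
  have "heat_loss t u = ennreal (LINT \<xi>|lebesgue. (norm (?F \<xi>))\<^sup>2 - exp (- t * (norm \<xi>)\<^sup>2) * (norm (?F \<xi>))\<^sup>2)"
    unfolding heat_loss_def eq
  proof (rule nn_integral_eq_integral)
    show "integrable lebesgue (\<lambda>\<xi>. (norm (?F \<xi>))\<^sup>2 - exp (- t * (norm \<xi>)\<^sup>2) * (norm (?F \<xi>))\<^sup>2)"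
      by (rule Bochner_Integration.integrable_diff[OF Lsq_integrable_square[OF FL] I])
    show "AE \<xi> in lebesgue. 0 \<le> (norm (?F \<xi>))\<^sup>2 - exp (- t * (norm \<xi>)\<^sup>2) * (norm (?F \<xi>))\<^sup>2"
      using t by (auto intro!: AE_I2 mult_left_le_one_le)
  qed
  also have "(LINT \<xi>|lebesgue. (norm (?F \<xi>))\<^sup>2 - exp (- t * (norm \<xi>)\<^sup>2) * (norm (?F \<xi>))\<^sup>2)
      = (Lsq_norm ?F)\<^sup>2 - ((Lsq_norm u)\<^sup>2 - heat_energy t u / 2)"
    unfolding Bochner_Integration.integral_diff[OF Lsq_integrable_square[OF FL] I]
      gaussian_weight_energy[OF Lsq_bdd_integrable[OF u] Lsq_bdd_Lsq[OF u] t]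
    by (simp add: Lsq_norm_def)
  also have "\<dots> = heat_energy t u / 2" by (simp add: Plancherel_bounded_support[OF u])
  finally show ?thesis .
qed

lemma heat_loss_measurable_pair:
  fixes u :: "'a::euclidean_space \<Rightarrow> complex"
  assumes "u \<in> Lsq_bdd"
  shows "(\<lambda>p. ennreal ((1 - exp (- fst p * (norm (snd p))\<^sup>2)) * (norm (fourier_integral u (snd p)))\<^sup>2))
    \<in> borel_measurable (lborel \<Otimes>\<^sub>M (lebesgue :: 'a measure))"
proof -
  have [measurable]: "fourier_integral u \<in> borel_measurable lebesgue"
    by (rule Lsq_measurable[OF fourier_integral_contraction(1)[OF assms]])
  have [measurable]: "(\<lambda>p. fourier_integral u (snd p)) \<in> borel_measurable (lborel \<Otimes>\<^sub>M (lebesgue :: 'a measure))"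
    by (rule measurable_compose[OF measurable_snd]) measurable
  have [measurable]: "fst \<in> borel_measurable ((lborel :: real measure) \<Otimes>\<^sub>M (lebesgue :: 'a measure))"
    by (rule measurable_compose[OF measurable_fst]) simp
  show ?thesis by measurable
qed

lemma heat_loss_measurable:
  assumes "u \<in> Lsq_bdd"
  shows "(\<lambda>t. heat_loss t u) \<in> borel_measurable lborel"
  using lebesgue.borel_measurable_nn_integral_fst[OF heat_loss_measurable_pair[OF assms]]
  by (simp add: heat_loss_def[abs_def])

text \<open>Integrating subordination over \<open>\<xi>\<close> and exchanging the integrals, the energy becomes an integral
  over \<open>t\<close> of heat energies with positive weight.\<close>

lemma frac_energy_subordination:
  fixes u :: "'a::euclidean_space \<Rightarrow> real"
  assumes "u \<in> Lsq_bdd"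
  shows "(\<integral>\<^sup>+\<xi>. ennreal ((norm (frac_symbol s u \<xi>))\<^sup>2) \<partial>lebesgue) * subordination_const s
     = (\<integral>\<^sup>+t. ennreal (heat_weight s t) * heat_loss t (\<lambda>x. of_real (u x)) \<partial>lborel)"
proof -
  define v where "v x = complex_of_real (u x)" for x
  have v: "v \<in> Lsq_bdd" unfolding v_def[abs_def] by (rule Lsq_bdd_of_real[OF assms])
  let ?F = "fourier_integral v"
  have Fm: "?F \<in> borel_measurable lebesgue"
    by (rule Lsq_measurable[OF fourier_integral_contraction(1)[OF v]])
  interpret Q: pair_sigma_finite "lborel :: real measure" "lebesgue :: 'a measure"
    by (intro pair_sigma_finite.intro sigma_finite_lborel sigma_finite_lebesgue)
  have sq: "(norm (frac_symbol s u \<xi>))\<^sup>2 = ((norm \<xi>)\<^sup>2) powr s * (norm (?F \<xi>))\<^sup>2" for \<xi>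
  proof -
    have "(norm \<xi> powr s)\<^sup>2 = ((norm \<xi>)\<^sup>2) powr s"
      by (simp add: power2_eq_square powr_mult)
    then show ?thesis by (simp add: frac_symbol_def v_def[abs_def] norm_mult power_mult_distrib)
  qed
  have m: "(\<lambda>\<xi>. ennreal ((norm (frac_symbol s u \<xi>))\<^sup>2)) \<in> borel_measurable lebesgue"
    using frac_symbol_measurable[OF Lsq_bdd_Lsq[OF assms], of s] by measurable
  have "(\<integral>\<^sup>+\<xi>. ennreal ((norm (frac_symbol s u \<xi>))\<^sup>2) \<partial>lebesgue) * subordination_const s
     = (\<integral>\<^sup>+\<xi>. ennreal ((norm (frac_symbol s u \<xi>))\<^sup>2) * subordination_const s \<partial>lebesgue)"
    by (rule nn_integral_multc[OF m, symmetric])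
  also have "\<dots> = (\<integral>\<^sup>+\<xi>. \<integral>\<^sup>+t. ennreal (heat_weight s t) *
      ennreal ((1 - exp (- t * (norm \<xi>)\<^sup>2)) * (norm (?F \<xi>))\<^sup>2) \<partial>lborel \<partial>lebesgue)"
  proof (rule nn_integral_cong)
    fix \<xi> :: 'a
    have "(\<integral>\<^sup>+t. ennreal (heat_weight s t) * ennreal ((1 - exp (- t * (norm \<xi>)\<^sup>2)) * (norm (?F \<xi>))\<^sup>2) \<partial>lborel)
       = (\<integral>\<^sup>+t. ennreal (heat_weight s t * (1 - exp (- t * (norm \<xi>)\<^sup>2))) * ennreal ((norm (?F \<xi>))\<^sup>2) \<partial>lborel)"
    proof (rule nn_integral_cong)
      fix t
      show "ennreal (heat_weight s t) * ennreal ((1 - exp (- t * (norm \<xi>)\<^sup>2)) * (norm (?F \<xi>))\<^sup>2)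
         = ennreal (heat_weight s t * (1 - exp (- t * (norm \<xi>)\<^sup>2))) * ennreal ((norm (?F \<xi>))\<^sup>2)"
        by (simp add: heat_weight_nonneg mult_ac flip: ennreal_mult' ennreal_mult'')
    qed
    also have "\<dots> = (\<integral>\<^sup>+t. ennreal (heat_weight s t * (1 - exp (- t * (norm \<xi>)\<^sup>2))) \<partial>lborel) * ennreal ((norm (?F \<xi>))\<^sup>2)"
      by (rule nn_integral_multc) measurable
    also have "\<dots> = ennreal ((norm (frac_symbol s u \<xi>))\<^sup>2) * subordination_const s"
      unfolding subordination[OF zero_le_power2] sq by (simp add: ennreal_mult mult_ac)
    finally show "ennreal ((norm (frac_symbol s u \<xi>))\<^sup>2) * subordination_const s
      = (\<integral>\<^sup>+t. ennreal (heat_weight s t) * ennreal ((1 - exp (- t * (norm \<xi>)\<^sup>2)) * (norm (?F \<xi>))\<^sup>2) \<partial>lborel)" ..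
  qed
  also have "\<dots> = (\<integral>\<^sup>+t. \<integral>\<^sup>+\<xi>. ennreal (heat_weight s t) *
      ennreal ((1 - exp (- t * (norm \<xi>)\<^sup>2)) * (norm (?F \<xi>))\<^sup>2) \<partial>lebesgue \<partial>lborel)"
  proof (rule Q.Fubini')
    have "(\<lambda>p. ennreal (heat_weight s (fst p))) \<in> borel_measurable ((lborel :: real measure) \<Otimes>\<^sub>M (lebesgue :: 'a measure))"
      by (rule measurable_compose[OF measurable_fst]) measurable
    from borel_measurable_times_ennreal[OF this heat_loss_measurable_pair[OF v]]
    show "(\<lambda>(t, \<xi>). ennreal (heat_weight s t) * ennreal ((1 - exp (- t * (norm \<xi>)\<^sup>2)) * (norm (?F \<xi>))\<^sup>2))
        \<in> borel_measurable (lborel \<Otimes>\<^sub>M (lebesgue :: 'a measure))"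
      by (simp add: case_prod_beta)
  qed
  also have "\<dots> = (\<integral>\<^sup>+t. ennreal (heat_weight s t) * heat_loss t v \<partial>lborel)"
    unfolding heat_loss_def
  proof (intro nn_integral_cong nn_integral_cmult)
    fix t :: real
    have "(\<lambda>\<xi>::'a. norm \<xi>) \<in> borel_measurable lebesgue"
      by (rule measurable_compose[OF ident_borel_measurable_lebesgue]) measurable
    then show "(\<lambda>\<xi>. ennreal ((1 - exp (- t * (norm \<xi>)\<^sup>2)) * (norm (?F \<xi>))\<^sup>2)) \<in> borel_measurable lebesgue"
      using Fm by measurable
  qed
  finally show ?thesis by (simp add: v_def[abs_def])
qed

text \<open>Both \<open>T\<close> and \<open>id - T\<close> are nondecreasing, so their increments between two values have the same sign
  and the sum of the squares of the increments is at most the square of the sum.\<close>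

lemma heat_energy_contraction:
  fixes u :: "'a::euclidean_space \<Rightarrow> real"
  assumes u: "u \<in> Lsq" and Tu: "(\<lambda>x. T (u x)) \<in> Lsq" and t: "0 < t"
    and mono: "mono T" and Lip: "\<And>a b. a \<le> b \<Longrightarrow> T b - T a \<le> b - a"
  shows "heat_energy t (\<lambda>x. T (u x)) + heat_energy t (\<lambda>x. u x - T (u x)) \<le> heat_energy t u"
proof -
  have pw: "(T a - T b)\<^sup>2 + ((a - T a) - (b - T b))\<^sup>2 \<le> (a - b)\<^sup>2" for a b
  proof -
    have "0 \<le> (T a - T b) * ((a - T a) - (b - T b))"
    proof (cases "a \<le> b")
      case True
      have "T a - T b \<le> 0" "(a - T a) - (b - T b) \<le> 0"
        using monoD[OF mono True] Lip[OF True] by auto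
      then show ?thesis by (rule mult_nonpos_nonpos)
    next
      case False
      then have "b \<le> a" by simp
      have "0 \<le> T a - T b" "0 \<le> (a - T a) - (b - T b)"
        using monoD[OF mono \<open>b \<le> a\<close>] Lip[OF \<open>b \<le> a\<close>] by auto
      then show ?thesis by (rule mult_nonneg_nonneg)
    qed
    moreover have "(a - b)\<^sup>2 = (T a - T b)\<^sup>2 + ((a - T a) - (b - T b))\<^sup>2 + 2 * ((T a - T b) * ((a - T a) - (b - T b)))"
      by (simp add: power2_eq_square algebra_simps)
    ultimately show ?thesis by linarith
  qed
  note I = heat_energy_integrable[OF Tu t] heat_energy_integrable[OF Lsq_diff[OF u Tu] t]
  show ?thesis
    unfolding heat_energy_def Bochner_Integration.integral_add[OF I, symmetric]
  proof (rule integral_mono[OF Bochner_Integration.integrable_add[OF I] heat_energy_integrable[OF u t]])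
    fix z :: "'a \<times> 'a"
    show "heat_kernel t (fst z - snd z) * (norm (T (u (fst z)) - T (u (snd z))))\<^sup>2 +
        heat_kernel t (fst z - snd z) * (norm (u (fst z) - T (u (fst z)) - (u (snd z) - T (u (snd z)))))\<^sup>2
      \<le> heat_kernel t (fst z - snd z) * (norm (u (fst z) - u (snd z)))\<^sup>2"
      unfolding distrib_left[symmetric] real_norm_def power2_abs
      by (rule mult_left_mono[OF pw heat_kernel_nonneg])
  qed
qed

lemma heat_energy_of_real: "heat_energy t (\<lambda>x. complex_of_real (u x)) = heat_energy t u"
  by (simp add: heat_energy_def flip: of_real_diff)

text \<open>The Markov property of the fractional Laplacian, inherited from the heat energies through
  subordination. The second summand is what later turns weak into strong convergence.\<close>

theorem frac_energy_contraction:
  fixes u :: "'a::euclidean_space \<Rightarrow> real"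
  assumes s: "0 < s" "s < 1" and u: "u \<in> Lsq_bdd" and symb: "frac_symbol s u \<in> Lsq"
    and mono: "mono T" and Lip: "\<And>a b. a \<le> b \<Longrightarrow> T b - T a \<le> b - a" and T0: "T 0 = 0"
  shows "(\<lambda>x. T (u x)) \<in> Lsq_bdd" and "frac_symbol s (\<lambda>x. T (u x)) \<in> Lsq"
    and "(Lsq_norm (frac_symbol s (\<lambda>x. T (u x))))\<^sup>2 +
      (Lsq_norm (\<lambda>\<xi>. frac_symbol s u \<xi> - frac_symbol s (\<lambda>x. T (u x)) \<xi>))\<^sup>2
      \<le> (Lsq_norm (frac_symbol s u))\<^sup>2"
proof -
  let ?Tu = "\<lambda>x. T (u x)" and ?d = "\<lambda>x. u x - T (u x)"
  have T_le: "\<bar>T a\<bar> \<le> \<bar>a\<bar>" for a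
    using Lip[of 0 a] Lip[of a 0] monoD[OF mono, of 0 a] monoD[OF mono, of a 0] T0 by (cases "0 \<le> a") auto
  have Tm: "?Tu \<in> borel_measurable lebesgue"
    by (rule measurable_compose[OF Lsq_measurable[OF Lsq_bdd_Lsq[OF u]] borel_measurable_mono[OF mono]])
  have TL: "?Tu \<in> Lsq"
    by (rule Lsq_bound[OF Lsq_bdd_Lsq[OF u] Tm]) (simp add: T_le)
  obtain R where "AE x in lebesgue. R \<le> norm x \<longrightarrow> u x = 0" using u by (auto simp: Lsq_bdd_def)
  then have "AE x in lebesgue. R \<le> norm x \<longrightarrow> T (u x) = 0" by eventually_elim (simp add: T0)
  then show Tu: "?Tu \<in> Lsq_bdd" using TL unfolding Lsq_bdd_def by blast
  have d: "?d \<in> Lsq_bdd" by (rule Lsq_bdd_diff[OF u Tu])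
  define E where "E v = (\<integral>\<^sup>+\<xi>. ennreal ((norm (frac_symbol s v \<xi>))\<^sup>2) \<partial>lebesgue)" for v :: "'a \<Rightarrow> real"
  define W where "W t v = ennreal (heat_weight s t) * heat_loss t (\<lambda>x. complex_of_real (v x))" for t and v :: "'a \<Rightarrow> real"
  define C where "C = subordination_const s"
  have EW: "E v * C = (\<integral>\<^sup>+t. W t v \<partial>lborel)" if "v \<in> Lsq_bdd" for v
    unfolding E_def W_def C_def by (rule frac_energy_subordination[OF that])
  have Wm [measurable]: "(\<lambda>t. W t v) \<in> borel_measurable lborel" if "v \<in> Lsq_bdd" for v
  proof -
    have "(\<lambda>t. ennreal (heat_weight s t)) \<in> borel_measurable lborel" by measurable
    from borel_measurable_times_ennreal[OF this heat_loss_measurable[OF Lsq_bdd_of_real[OF that]]]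
    show ?thesis by (simp add: W_def)
  qed
  have "(E ?Tu + E ?d) * C = (\<integral>\<^sup>+t. W t ?Tu + W t ?d \<partial>lborel)"
    unfolding distrib_right EW[OF Tu] EW[OF d] by (rule nn_integral_add[OF Wm[OF Tu] Wm[OF d], symmetric])
  also have "\<dots> \<le> (\<integral>\<^sup>+t. W t u \<partial>lborel)"
  proof (rule nn_integral_mono)
    fix t :: real
    show "W t ?Tu + W t ?d \<le> W t u"
    proof (cases "0 < t")
      case True
      have "heat_energy t ?Tu / 2 + heat_energy t ?d / 2 \<le> heat_energy t u / 2"
        using heat_energy_contraction[OF Lsq_bdd_Lsq[OF u] TL True mono Lip] by simp
      from ennreal_leI[OF this]
      have "ennreal (heat_energy t ?Tu / 2) + ennreal (heat_energy t ?d / 2) \<le> ennreal (heat_energy t u / 2)"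
        by (subst (asm) ennreal_plus) (simp_all add: heat_energy_nonneg)
      then show ?thesis
        unfolding W_def distrib_left[symmetric] heat_loss_eq[OF Lsq_bdd_of_real[OF u] True]
          heat_loss_eq[OF Lsq_bdd_of_real[OF Tu] True] heat_loss_eq[OF Lsq_bdd_of_real[OF d] True] heat_energy_of_real
        by (rule mult_left_mono) simp
    qed (simp add: W_def heat_weight_def)
  qed
  also have "\<dots> = E u * C" by (rule EW[OF u, symmetric])
  finally have "C * (E ?Tu + E ?d) \<le> C * E u" by (simp add: mult.commute)
  moreover have "C \<noteq> 0" "C \<noteq> \<infinity>"
    using subordination_const_pos[of s] subordination_const_finite[OF s] by (auto simp: C_def)
  ultimately have le: "E ?Tu + E ?d \<le> E u" by (simp add: ennreal_mult_le_mult_iff)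
  have Eu: "E u = ennreal ((Lsq_norm (frac_symbol s u))\<^sup>2)"
    unfolding E_def by (rule nn_integral_Lsq[OF symb])
  have "E ?Tu < \<infinity>" "E ?d < \<infinity>"
    using le Eu by (auto simp: less_top[symmetric] top_unique)
  then show symbT: "frac_symbol s ?Tu \<in> Lsq"
    using frac_symbol_measurable[OF TL] by (simp add: Lsq_iff_nn_integral E_def)
  have symbd: "frac_symbol s ?d = (\<lambda>\<xi>. frac_symbol s u \<xi> - frac_symbol s ?Tu \<xi>)"
    by (rule frac_symbol_diff[OF u Tu])
  have "E ?Tu = ennreal ((Lsq_norm (frac_symbol s ?Tu))\<^sup>2)"
    unfolding E_def by (rule nn_integral_Lsq[OF symbT])
  moreover have "E ?d = ennreal ((Lsq_norm (\<lambda>\<xi>. frac_symbol s u \<xi> - frac_symbol s ?Tu \<xi>))\<^sup>2)"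
    unfolding E_def symbd by (rule nn_integral_Lsq[OF Lsq_diff[OF symb symbT]])
  ultimately show "(Lsq_norm (frac_symbol s ?Tu))\<^sup>2 +
      (Lsq_norm (\<lambda>\<xi>. frac_symbol s u \<xi> - frac_symbol s ?Tu \<xi>))\<^sup>2 \<le> (Lsq_norm (frac_symbol s u))\<^sup>2"
    using le Eu by (simp flip: ennreal_plus)
qed

section \<open>Weak convergence\<close>

text \<open>At frequencies below \<open>R\<close> the factor \<open>|\<xi>|\<^sup>s\<close> is bounded, so that the convergence in \<open>L\<^sup>2\<close> suffices; at
  higher frequencies the tail of \<open>Z\<close> is small, and the functions \<open>d n\<close> are bounded in energy.\<close>

lemma frac_symbol_weakly_null:
  fixes d :: "nat \<Rightarrow> 'a::euclidean_space \<Rightarrow> real"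
  assumes Z: "Z \<in> Lsq" and s: "0 < s"
    and d: "\<And>n. d n \<in> Lsq_bdd" "\<And>n. frac_symbol s (d n) \<in> Lsq"
    and M: "\<And>n. Lsq_norm (frac_symbol s (d n)) \<le> M"
    and d0: "(\<lambda>n. Lsq_norm (d n)) \<longlonglongrightarrow> 0"
  shows "(\<lambda>n. Lsq_inner Z (frac_symbol s (d n))) \<longlonglongrightarrow> 0"
proof (rule LIMSEQ_I)
  fix e :: real assume e: "0 < e"
  have M0: "0 \<le> M" using M[of 0] Lsq_norm_nonneg[of "frac_symbol s (d 0)"] by linarith
  define K where "K = M + 1"
  have K: "0 < K" "M \<le> K" using M0 by (auto simp: K_def)
  define D where "D n = frac_symbol s (d n)" for n
  have D: "D n \<in> Lsq" for n unfolding D_def by (rule d(2))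
  have "\<forall>\<^sub>F R in at_top. Lsq_norm (\<lambda>x. truncation R Z x - Z x) < e / (2 * K)"
    using order_tendstoD(2)[OF truncation_tendsto[OF Z]] e K by simp
  then have "\<forall>\<^sub>F R in at_top. 0 \<le> R \<and> Lsq_norm (\<lambda>x. truncation R Z x - Z x) < e / (2 * K)"
    using eventually_ge_at_top[of 0] by eventually_elim simp
  then obtain R where R: "0 \<le> R" and tail: "Lsq_norm (\<lambda>x. truncation R Z x - Z x) < e / (2 * K)"
    by (metis (mono_tags, lifting) eventually_happens trivial_limit_at_top_linorder)
  define Y where "Y \<xi> = norm \<xi> powr s *\<^sub>R truncation R Z \<xi>" for \<xi>
  have TL: "truncation R Z \<in> Lsq" by (rule truncation_Lsq[OF Z])
  have Y: "Y \<in> Lsq"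
  proof (rule Lsq_bound[OF Lsq_scaleR[OF TL, of "R powr s"]])
    have "(\<lambda>\<xi>::'a. norm \<xi>) \<in> borel_measurable lebesgue"
      by (rule measurable_compose[OF ident_borel_measurable_lebesgue]) measurable
    then show "Y \<in> borel_measurable lebesgue"
      unfolding Y_def[abs_def] using Lsq_measurable[OF TL] by measurable
    show "norm (Y \<xi>) \<le> norm (R powr s *\<^sub>R truncation R Z \<xi>)" for \<xi>
    proof (cases "norm \<xi> < R")
      case True
      then have "norm \<xi> powr s \<le> R powr s" using s by (intro powr_mono2) auto
      then show ?thesis by (simp add: Y_def mult_right_mono)
    qed (simp add: Y_def truncation_def)
  qed
  define F where "F n = fourier_integral (\<lambda>x. complex_of_real (d n x))" for n
  have F: "F n \<in> Lsq" "Lsq_norm (F n) = Lsq_norm (d n)" for n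
    unfolding F_def using fourier_integral_contraction(1)[OF Lsq_bdd_of_real[OF d(1)]]
      Plancherel_bounded_support[OF Lsq_bdd_of_real[OF d(1)]] by (simp_all add: Lsq_norm_of_real)
  have shift: "Lsq_inner (truncation R Z) (D n) = Lsq_inner Y (F n)" for n
    unfolding Lsq_inner_def
    by (rule Bochner_Integration.integral_cong)
       (simp_all add: Y_def D_def F_def frac_symbol_def scaleR_conv_of_real[symmetric])
  have "(\<lambda>n. Lsq_norm Y * Lsq_norm (d n)) \<longlonglongrightarrow> Lsq_norm Y * 0"
    by (intro tendsto_intros d0)
  then have "\<forall>\<^sub>F n in sequentially. Lsq_norm Y * Lsq_norm (d n) < e / 2"
    by (rule order_tendstoD(2)) (use e in simp)
  then obtain N where N: "\<And>n. N \<le> n \<Longrightarrow> Lsq_norm Y * Lsq_norm (d n) < e / 2"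
    by (auto simp: eventually_sequentially)
  have "norm (Lsq_inner Z (D n) - 0) < e" if "N \<le> n" for n
  proof -
    have "Lsq_inner Z (D n) = Lsq_inner Y (F n) - Lsq_inner (\<lambda>x. truncation R Z x - Z x) (D n)"
      by (simp add: Lsq_inner_diff_left TL Z D shift)
    moreover have "\<bar>Lsq_inner Y (F n)\<bar> < e / 2"
      using Lsq_Cauchy_Schwarz[OF Y F(1)[of n]] N[OF that] F(2)[of n] by simp
    moreover have "\<bar>Lsq_inner (\<lambda>x. truncation R Z x - Z x) (D n)\<bar> \<le> e / 2"
    proof -
      have "\<bar>Lsq_inner (\<lambda>x. truncation R Z x - Z x) (D n)\<bar>
          \<le> Lsq_norm (\<lambda>x. truncation R Z x - Z x) * Lsq_norm (D n)"
        by (rule Lsq_Cauchy_Schwarz[OF Lsq_diff[OF TL Z] D])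
      also have "\<dots> \<le> e / (2 * K) * K"
        using tail order_trans[OF M[of n] K(2)] e K by (intro mult_mono) (auto simp: D_def)
      also have "\<dots> = e / 2" using K by simp
      finally show ?thesis .
    qed
    ultimately show ?thesis by simp
  qed
  then show "\<exists>N. \<forall>n\<ge>N. norm (Lsq_inner Z (frac_symbol s (d n)) - 0) < e"
    unfolding D_def by blast
qed

lemma Htilde_dual_bound:
  fixes \<Omega> :: "'a::euclidean_space set"
  assumes "bounded \<Omega>" "f \<in> Htilde_dual s \<Omega>"
  obtains C where "0 \<le> C" "\<And>v. v \<in> Htilde s \<Omega> \<Longrightarrow> \<bar>f v\<bar> \<le> C * Lsq_norm (frac_symbol s v)"
proof -
  from assms(2) obtain C where C: "\<forall>v\<in>Htilde s \<Omega>. \<bar>f v\<bar> \<le> C * Htilde_norm s v"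
    unfolding Htilde_dual_def by blast
  have "\<bar>f v\<bar> \<le> \<bar>C\<bar> * Lsq_norm (frac_symbol s v)" if "v \<in> Htilde s \<Omega>" for v
    using bspec[OF C that] mult_right_mono[OF abs_ge_self[of C] Lsq_norm_nonneg[of "frac_symbol s v"]]
    by (simp add: Htilde_norm_eq[OF assms(1) that])
  then show ?thesis by (intro that[of "\<bar>C\<bar>"]) auto
qed

lemma Htilde_dual_linear:
  assumes "f \<in> Htilde_dual s \<Omega>" "v \<in> Htilde s \<Omega>"
  shows "w \<in> Htilde s \<Omega> \<Longrightarrow> f (\<lambda>x. v x + w x) = f v + f w" and "f (\<lambda>x. c * v x) = c * f v"
  using assms by (auto simp: Htilde_dual_def)

lemma Htilde_frac_symbol:
  fixes \<Omega> :: "'a::euclidean_space set"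
  assumes "bounded \<Omega>" "v \<in> Htilde s \<Omega>"
  shows "frac_symbol s v \<in> Lsq"
  using assms by (simp add: Htilde_iff)

lemma Htilde_zero: "bounded \<Omega> \<Longrightarrow> v \<in> Htilde s \<Omega> \<Longrightarrow> (\<lambda>x. 0) \<in> Htilde s (\<Omega> :: 'a::euclidean_space set)"
  using Htilde_scale[of \<Omega> v s 0] by simp

text \<open>An approximate form of the Riesz representation theorem. If \<open>z\<close> in the unit ball almost attains
  the norm \<open>l\<close> of \<open>f\<close>, then \<open>f (z + t v) \<le> l \<parallel>z + t v\<parallel>\<close> for a small \<open>t\<close> shows that \<open>f v\<close> exceeds
  \<open>l \<langle>z, v\<rangle>\<close> by little; applying this to \<open>- v\<close> gives the other bound.\<close>

lemma Htilde_dual_approx_Riesz: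
  fixes \<Omega> :: "'a::euclidean_space set"
  assumes b: "bounded \<Omega>" and f: "f \<in> Htilde_dual s \<Omega>" and ne: "v0 \<in> Htilde s \<Omega>" and e: "0 < e"
  shows "\<exists>z\<in>Htilde s \<Omega>. \<exists>l. \<forall>v\<in>Htilde s \<Omega>.
    \<bar>f v - l * Lsq_inner (frac_symbol s z) (frac_symbol s v)\<bar> \<le> e * Lsq_norm (frac_symbol s v)"
proof -
  let ?H = "Htilde s \<Omega>"
  define N where "N v = Lsq_norm (frac_symbol s v)" for v :: "'a \<Rightarrow> real"
  define a where "a v w = Lsq_inner (frac_symbol s v) (frac_symbol s w)" for v w :: "'a \<Rightarrow> real"
  have N0: "0 \<le> N v" for v by (simp add: N_def)
  have N_scale: "N (\<lambda>x. c * v x) = \<bar>c\<bar> * N v" for c v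
    by (simp add: N_def frac_symbol_scale Lsq_norm_scaleR)
  have a_scale: "a z (\<lambda>x. c * v x) = c * a z v" for c v z
    by (simp add: a_def frac_symbol_scale Lsq_inner_scaleR_right)
  have f_scale: "f (\<lambda>x. c * v x) = c * f v" if "v \<in> ?H" for c v
    by (rule Htilde_dual_linear(2)[OF f that])
  obtain C where C: "0 \<le> C" "\<And>v. v \<in> ?H \<Longrightarrow> \<bar>f v\<bar> \<le> C * N v"
    using Htilde_dual_bound[OF b f] unfolding N_def by blast
  define B where "B = f ` {v \<in> ?H. N v \<le> 1}"
  define l where "l = Sup B"
  have bdd: "bdd_above B"
  proof (rule bdd_aboveI)
    fix y assume "y \<in> B"
    then obtain v where v: "v \<in> ?H" "N v \<le> 1" "y = f v" by (auto simp: B_def)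
    then show "y \<le> C" using C(2)[OF v(1)] mult_left_mono[OF v(2) C(1)] by simp
  qed
  have zero: "(\<lambda>x. 0) \<in> ?H" "f (\<lambda>x. 0) = 0" "N (\<lambda>x. 0) = 0"
    using Htilde_zero[OF b ne] f_scale[OF ne, of 0] N_scale[of 0 v0] by auto
  then have "0 \<in> B" unfolding B_def by (intro image_eqI[of _ _ "\<lambda>x. 0"]) auto
  then have l0: "0 \<le> l" unfolding l_def by (rule cSup_upper[OF _ bdd])
  have f_le: "f v \<le> l * N v" if v: "v \<in> ?H" for v
  proof (cases "N v = 0")
    case False
    then have pos: "0 < N v" using N0[of v] by simp
    have "f (\<lambda>x. (1 / N v) * v x) \<in> B"
      unfolding B_def
      by (intro imageI CollectI conjI Htilde_scale[OF b v]) (simp only: N_scale, use pos in simp)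
    then have "f (\<lambda>x. (1 / N v) * v x) \<le> l" unfolding l_def by (rule cSup_upper[OF _ bdd])
    then have "(1 / N v) * f v \<le> l" unfolding f_scale[OF v] .
    then show ?thesis using pos by (simp add: field_simps)
  qed (use C(2)[OF v] in simp)
  \<comment> \<open>With an error \<open>t\<^sup>2\<close> in the choice of \<open>z\<close>, the total error is \<open>t + l t / 2\<close>.\<close>
  define t where "t = e / (1 + l / 2)"
  have t: "0 < t" using e l0 by (simp add: t_def)
  have te: "t * (1 + l / 2) = e" using l0 by (simp add: t_def)
  have "l - t\<^sup>2 < Sup B" using t by (simp add: l_def)
  then obtain y where "y \<in> B" "l - t\<^sup>2 < y" using less_cSup_iff[OF _ bdd] \<open>0 \<in> B\<close> by blast
  then obtain z where z: "z \<in> ?H" "N z \<le> 1" "l - t\<^sup>2 < f z" by (auto simp: B_def)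
  have upper: "f v - l * a z v \<le> e" if v: "v \<in> ?H" "N v \<le> 1" for v
  proof -
    have tv: "(\<lambda>x. t * v x) \<in> ?H" by (rule Htilde_scale[OF b v(1)])
    have ztv: "(\<lambda>x. z x + t * v x) \<in> ?H" by (rule Htilde_add[OF b z(1) tv])
    have "(N (\<lambda>x. z x + t * v x))\<^sup>2 = (N z)\<^sup>2 + 2 * (t * a z v) + (t * N v)\<^sup>2"
      unfolding N_def frac_symbol_add[OF Htilde_Lsq_bdd[OF b z(1)] Htilde_Lsq_bdd[OF b tv]]
        Lsq_norm_add_square[OF Htilde_frac_symbol[OF b z(1)] Htilde_frac_symbol[OF b tv]]
      using t by (simp add: frac_symbol_scale Lsq_inner_scaleR_right Lsq_norm_scaleR a_def)
    also have "\<dots> \<le> 1 + 2 * (t * a z v) + t\<^sup>2"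
    proof -
      have "(N z)\<^sup>2 \<le> 1" using z(2) N0[of z] by (simp add: power_le_one)
      moreover have "(t * N v)\<^sup>2 \<le> t\<^sup>2"
        using t v(2) N0[of v] by (intro power_mono) (auto simp: mult_left_le)
      ultimately show ?thesis by simp
    qed
    \<comment> \<open>The norm is estimated through its square by \<open>2 N \<le> 1 + N\<^sup>2\<close>, with equality for \<open>N = 1\<close>.\<close>
    finally have "2 * N (\<lambda>x. z x + t * v x) \<le> 2 + 2 * (t * a z v) + t\<^sup>2"
      using sum_squares_bound[of 1 "N (\<lambda>x. z x + t * v x)"] by simp
    then have "l * N (\<lambda>x. z x + t * v x) \<le> l * (1 + t * a z v + t\<^sup>2 / 2)"
      using l0 by (intro mult_left_mono) auto
    moreover have "f z + t * f v \<le> l * N (\<lambda>x. z x + t * v x)"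
      using f_le[OF ztv] Htilde_dual_linear(1)[OF f z(1) tv] f_scale[OF v(1)] by simp
    ultimately have "f z + t * f v \<le> l * (1 + t * a z v + t\<^sup>2 / 2)" by linarith
    then have "l - t\<^sup>2 + t * f v \<le> l * (1 + t * a z v + t\<^sup>2 / 2)" using z(3) by linarith
    then have "t * (f v - l * a z v) \<le> t * (t * (1 + l / 2))"
      by (simp add: algebra_simps power2_eq_square)
    then show ?thesis unfolding te using t by simp
  qed
  have unit: "\<bar>f v - l * a z v\<bar> \<le> e" if v: "v \<in> ?H" "N v \<le> 1" for v
  proof -
    have "N (\<lambda>x. (-1) * v x) \<le> 1" unfolding N_scale using v(2) by simp
    from upper[OF Htilde_scale[OF b v(1)] this]
    have "- (f v - l * a z v) \<le> e" using f_scale[OF v(1), of "-1"] a_scale[of z "-1" v] by simp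
    with upper[OF v] show ?thesis by linarith
  qed
  have "\<bar>f v - l * a z v\<bar> \<le> e * N v" if v: "v \<in> ?H" for v
  proof (cases "N v = 0")
    case True
    have "\<bar>a z v\<bar> \<le> N z * N v"
      unfolding a_def N_def by (rule Lsq_Cauchy_Schwarz[OF Htilde_frac_symbol[OF b z(1)] Htilde_frac_symbol[OF b v]])
    then show ?thesis using True C(2)[OF v] by simp
  next
    case False
    then have pos: "0 < N v" using N0[of v] by simp
    have "N (\<lambda>x. (1 / N v) * v x) \<le> 1" unfolding N_scale using pos by simp
    from unit[OF Htilde_scale[OF b v] this] have "\<bar>(1 / N v) * (f v - l * a z v)\<bar> \<le> e"
      unfolding f_scale[OF v] a_scale by (simp add: algebra_simps)
    then show ?thesis using pos by (simp add: abs_mult field_simps)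
  qed
  then show ?thesis using z(1) unfolding N_def a_def by blast
qed

text \<open>Testing against the elements of the space suffices, since these represent \<open>f\<close> up to a small
  multiple of the norm.\<close>

lemma Htilde_dual_weakly_null:
  fixes \<Omega> :: "'a::euclidean_space set" and d :: "nat \<Rightarrow> 'a \<Rightarrow> real"
  assumes b: "bounded \<Omega>" and s: "0 < s" and f: "f \<in> Htilde_dual s \<Omega>" and d: "\<And>n. d n \<in> Htilde s \<Omega>"
    and M: "\<And>n. Lsq_norm (frac_symbol s (d n)) \<le> M"
    and d0: "(\<lambda>n. Lsq_norm (d n)) \<longlonglongrightarrow> 0"
  shows "(\<lambda>n. f (d n)) \<longlonglongrightarrow> 0"
proof (rule LIMSEQ_I)
  fix e :: real assume e: "0 < e"
  have M0: "0 \<le> M" using M[of 0] Lsq_norm_nonneg[of "frac_symbol s (d 0)"] by linarith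
  define K where "K = M + 1"
  have K: "0 < K" "M \<le> K" using M0 by (auto simp: K_def)
  define e' where "e' = e / (2 * K)"
  have e': "0 < e'" using e K by (simp add: e'_def)
  obtain z l where z: "z \<in> Htilde s \<Omega>" and approx: "\<And>v. v \<in> Htilde s \<Omega> \<Longrightarrow>
      \<bar>f v - l * Lsq_inner (frac_symbol s z) (frac_symbol s v)\<bar> \<le> e' * Lsq_norm (frac_symbol s v)"
    using Htilde_dual_approx_Riesz[OF b f d[of 0] e'] by blast
  have "(\<lambda>n. l * Lsq_inner (frac_symbol s z) (frac_symbol s (d n))) \<longlonglongrightarrow> l * 0"
    by (intro tendsto_intros frac_symbol_weakly_null[OF Htilde_frac_symbol[OF b z] s Htilde_Lsq_bdd[OF b d]
        Htilde_frac_symbol[OF b d] M d0])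
  then have "(\<lambda>n. l * Lsq_inner (frac_symbol s z) (frac_symbol s (d n))) \<longlonglongrightarrow> 0" by simp
  from LIMSEQ_D[OF this, of "e / 2"] e obtain n0 where
    n0: "\<And>n. n0 \<le> n \<Longrightarrow> \<bar>l * Lsq_inner (frac_symbol s z) (frac_symbol s (d n))\<bar> < e / 2" by auto
  have "norm (f (d n) - 0) < e" if "n0 \<le> n" for n
  proof -
    have "e' * Lsq_norm (frac_symbol s (d n)) \<le> e' * K"
      using M[of n] K e' by (intro mult_left_mono) auto
    also have "\<dots> = e / 2" using K by (simp add: e'_def)
    finally show ?thesis using approx[OF d[of n]] n0[OF that] by simp
  qed
  then show "\<exists>N. \<forall>n\<ge>N. norm (f (d n) - 0) < e" by blast
qed

section \<open>Stability of the obstacle problem\<close>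

definition cap :: "real \<Rightarrow> real \<Rightarrow> real" where
  "cap e a = min (max a 0) e"

text \<open>With \<open>T = cap e\<close>, the contraction property reads \<open>\<parallel>Tw\<parallel>\<^sup>2 + \<parallel>w - Tw\<parallel>\<^sup>2 \<le> \<parallel>w\<parallel>\<^sup>2\<close>; expanding the second
  square gives \<open>\<parallel>Tw\<parallel>\<^sup>2 \<le> \<langle>w, Tw\<rangle>\<close>.\<close>

lemma Htilde_cap:
  fixes \<Omega> :: "'a::euclidean_space set"
  assumes b: "bounded \<Omega>" and s: "0 < s" "s < 1" and w: "w \<in> Htilde s \<Omega>" and e: "0 \<le> e"
  shows "(\<lambda>x. cap e (w x)) \<in> Htilde s \<Omega>"
    and "(Lsq_norm (frac_symbol s (\<lambda>x. cap e (w x))))\<^sup>2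
      \<le> Lsq_inner (frac_symbol s w) (frac_symbol s (\<lambda>x. cap e (w x)))"
    and "Lsq_norm (frac_symbol s (\<lambda>x. cap e (w x))) \<le> Lsq_norm (frac_symbol s w)"
proof -
  have mono: "mono (cap e)" by (rule monoI) (auto simp: cap_def)
  have Lip: "cap e y - cap e x \<le> y - x" if "x \<le> y" for x y using that by (auto simp: cap_def)
  have cap0: "cap e 0 = 0" using e by (simp add: cap_def)
  note wb = Htilde_Lsq_bdd[OF b w] and ws = Htilde_frac_symbol[OF b w]
  note c = frac_energy_contraction[OF s wb ws mono Lip cap0]
  have "AE x in lebesgue. x \<in> - closure \<Omega> \<longrightarrow> w x = 0" using w by (simp add: Htilde_def)
  then have "AE x in lebesgue. x \<in> - closure \<Omega> \<longrightarrow> cap e (w x) = 0" by eventually_elim (simp add: cap0)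
  then show "(\<lambda>x. cap e (w x)) \<in> Htilde s \<Omega>" using c(1,2) by (simp add: Htilde_iff[OF b])
  show "(Lsq_norm (frac_symbol s (\<lambda>x. cap e (w x))))\<^sup>2
      \<le> Lsq_inner (frac_symbol s w) (frac_symbol s (\<lambda>x. cap e (w x)))"
    using c(3) Lsq_norm_diff_square[OF ws c(2)] by linarith
  have "(Lsq_norm (frac_symbol s (\<lambda>x. cap e (w x))))\<^sup>2 \<le> (Lsq_norm (frac_symbol s w))\<^sup>2"
    using c(3) zero_le_power2 by (smt (verit))
  then show "Lsq_norm (frac_symbol s (\<lambda>x. cap e (w x))) \<le> Lsq_norm (frac_symbol s w)"
    by (rule power2_le_imp_le) simp
qed

lemma Lsq_norm_cap_le:
  fixes \<Omega> :: "'a::euclidean_space set"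
  assumes b: "bounded \<Omega>" and w: "(\<lambda>x. cap e (w x)) \<in> Htilde s \<Omega>" and e: "0 \<le> e"
  shows "Lsq_norm (\<lambda>x. cap e (w x)) \<le> e * Lsq_norm (indicator (closure \<Omega>) :: 'a \<Rightarrow> real)"
proof -
  have "emeasure lborel (closure \<Omega>) < \<infinity>" by (rule emeasure_bounded_finite[OF bounded_closure[OF b]])
  then have ind: "integrable lebesgue (indicator (closure \<Omega>) :: 'a \<Rightarrow> real)"
    by (intro integrable_real_indicator) auto
  have "(LINT x|lebesgue. (norm (cap e (w x)))\<^sup>2) \<le> (LINT x|lebesgue. e\<^sup>2 * indicator (closure \<Omega>) x)"
  proof (rule integral_mono_AE)
    show "integrable lebesgue (\<lambda>x. (norm (cap e (w x)))\<^sup>2)"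
      by (rule Lsq_integrable_square[OF Lsq_bdd_Lsq[OF Htilde_Lsq_bdd[OF b w]]])
    have "AE x in lebesgue. x \<in> - closure \<Omega> \<longrightarrow> cap e (w x) = 0" using w by (simp add: Htilde_def)
    then show "AE x in lebesgue. (norm (cap e (w x)))\<^sup>2 \<le> e\<^sup>2 * indicator (closure \<Omega>) x"
    proof eventually_elim
      case (elim x)
      have "norm (cap e (w x)) \<le> e" using e by (auto simp: cap_def)
      then have "(norm (cap e (w x)))\<^sup>2 \<le> e\<^sup>2" by (rule power_mono) simp
      then show ?case using elim by (auto simp: indicator_def)
    qed
  qed (use ind in simp)
  also have "\<dots> = e\<^sup>2 * (LINT x|lebesgue. (norm (indicator (closure \<Omega>) x :: real))\<^sup>2)"
  proof -
    have "(norm (indicator (closure \<Omega>) x :: real))\<^sup>2 = indicator (closure \<Omega>) x" for x by (simp add: indicator_def)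
    then show ?thesis by simp
  qed
  finally show ?thesis
    unfolding Lsq_norm_def using e by (metis abs_of_nonneg real_sqrt_abs real_sqrt_le_iff real_sqrt_mult)
qed

theorem theorem4p3:
  fixes s :: real
    and \<Omega> :: "(real ^ 'n) set"
    and \<psi>h :: "nat \<Rightarrow> real ^ 'n \<Rightarrow> real"
    and \<psi> :: "real ^ 'n \<Rightarrow> real"
    and f :: "(real ^ 'n \<Rightarrow> real) \<Rightarrow> real"
    and v0 :: "real ^ 'n \<Rightarrow> real"
    and uh :: "nat \<Rightarrow> real ^ 'n \<Rightarrow> real"
    and u :: "real ^ 'n \<Rightarrow> real"
  assumes "0 < s" and "s < 1"
    and "open \<Omega>" and "connected \<Omega>" and "\<Omega> \<noteq> {}" and "bounded \<Omega>"
    and "\<And>h. \<psi>h h \<in> Linfty \<Omega>"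
    and "f \<in> Htilde_dual s \<Omega>"
    and "v0 \<in> Htilde s \<Omega>"
    and "\<And>h. AE x in lebesgue_on \<Omega>. v0 x \<ge> \<psi>h h x"
    and "\<And>h. solves_obstacle_problem s \<Omega> (\<psi>h h) f (uh h)"
    and "Linfty_tendsto \<Omega> \<psi>h \<psi>"
    and "solves_obstacle_problem s \<Omega> \<psi> f u"
  shows "(\<lambda>h. Htilde_norm s (\<lambda>x. uh h x - u x)) \<longlonglongrightarrow> 0"
proof -
  note s = assms(1,2) and b = assms(6) and f = assms(8) and v0 = assms(9)
  let ?H = "Htilde s \<Omega>" and ?S = "frac_symbol s :: (real ^ 'n \<Rightarrow> real) \<Rightarrow> _"
  define S where "S h = esssup (lebesgue_on \<Omega>) (\<lambda>x. ereal \<bar>\<psi>h h x - \<psi> x\<bar>)" for h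
  define \<epsilon> where "\<epsilon> h = max 0 (real_of_ereal (S h))" for h
  have S0: "S \<longlonglongrightarrow> 0" using assms(12) by (simp add: Linfty_tendsto_def S_def[abs_def])
  have \<epsilon>_nonneg: "0 \<le> \<epsilon> h" for h by (simp add: \<epsilon>_def)
  have \<epsilon>0: "\<epsilon> \<longlonglongrightarrow> 0"
  proof -
    have "S \<longlonglongrightarrow> ereal 0" using S0 by (simp add: zero_ereal_def)
    then have "(\<lambda>h. real_of_ereal (S h)) \<longlonglongrightarrow> 0" by (rule lim_real_of_ereal)
    from tendsto_max[OF tendsto_const[of 0] this] show ?thesis by (simp add: \<epsilon>_def[abs_def])
  qed
  have fin: "\<forall>\<^sub>F h in sequentially. S h < \<infinity>" by (rule order_tendstoD(2)[OF S0]) simp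
  have close: "AE x in lebesgue_on \<Omega>. \<bar>\<psi>h h x - \<psi> x\<bar> \<le> \<epsilon> h" if "S h < \<infinity>" for h
    using esssup_AE[of "\<lambda>x. ereal \<bar>\<psi>h h x - \<psi> x\<bar>" "lebesgue_on \<Omega>"]
  proof eventually_elim
    case (elim x)
    then have "ereal \<bar>\<psi>h h x - \<psi> x\<bar> \<le> S h" by (simp add: S_def)
    also have "S h \<le> ereal (\<epsilon> h)" using that by (cases "S h") (auto simp: \<epsilon>_def)
    finally show ?case by simp
  qed
  have v0_ge: "AE x in lebesgue_on \<Omega>. \<psi> x \<le> v0 x"
  proof -
    have "AE x in lebesgue_on \<Omega>. \<forall>h. \<psi>h h x \<le> v0 x" using assms(10) by (simp add: AE_all_countable)
    moreover have "AE x in lebesgue_on \<Omega>. \<forall>h. S h < \<infinity> \<longrightarrow> \<bar>\<psi>h h x - \<psi> x\<bar> \<le> \<epsilon> h"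
      using close by (subst AE_all_countable) auto
    ultimately show ?thesis
    proof eventually_elim
      case (elim x)
      have "(\<lambda>h. v0 x + \<epsilon> h) \<longlonglongrightarrow> v0 x + 0" by (intro tendsto_intros \<epsilon>0)
      moreover have "\<forall>\<^sub>F h in sequentially. \<psi> x \<le> v0 x + \<epsilon> h"
        using fin
      proof eventually_elim
        case (elim h)
        then have "\<bar>\<psi>h h x - \<psi> x\<bar> \<le> \<epsilon> h" "\<psi>h h x \<le> v0 x"
          using \<open>\<forall>h. S h < \<infinity> \<longrightarrow> \<bar>\<psi>h h x - \<psi> x\<bar> \<le> \<epsilon> h\<close> \<open>\<forall>h. \<psi>h h x \<le> v0 x\<close> by auto
        then show ?case by linarith
      qed
      ultimately show "\<psi> x \<le> v0 x" by (intro tendsto_lowerbound[of "\<lambda>h. v0 x + \<epsilon> h" "v0 x" sequentially]) auto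
    qed
  qed
  have u: "u \<in> ?H" and u_ge: "AE x in lebesgue_on \<Omega>. \<psi> x \<le> u x"
    and VI: "\<And>v. v \<in> obstacle_set s \<Omega> \<psi> \<Longrightarrow> f (\<lambda>x. v x - u x) \<le> frac_laplacian_dual s u (\<lambda>x. v x - u x)"
    using assms(13) by (auto simp: solves_obstacle_problem_def obstacle_set_def)
  have uh: "uh h \<in> ?H" and uh_ge: "AE x in lebesgue_on \<Omega>. \<psi>h h x \<le> uh h x"
    and VIh: "\<And>v. v \<in> obstacle_set s \<Omega> (\<psi>h h) \<Longrightarrow>
      f (\<lambda>x. v x - uh h x) \<le> frac_laplacian_dual s (uh h) (\<lambda>x. v x - uh h x)" for h
    using assms(11)[of h] by (auto simp: solves_obstacle_problem_def obstacle_set_def)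
  note L = Htilde_frac_symbol[OF b]
  have f_diff: "f (\<lambda>x. v x - w x) = f v - f w" if "v \<in> ?H" "w \<in> ?H" for v w
    using Htilde_dual_linear(1)[OF f that(1) Htilde_scale[OF b that(2), of "-1"]]
      Htilde_dual_linear(2)[OF f that(2), of "-1"] by simp
  have f_add: "f (\<lambda>x. v x + w x) = f v + f w" if "v \<in> ?H" "w \<in> ?H" for v w
    by (rule Htilde_dual_linear(1)[OF f that])
  have S_diff: "?S (\<lambda>x. v x - w x) = (\<lambda>\<xi>. ?S v \<xi> - ?S w \<xi>)" if "v \<in> ?H" "w \<in> ?H" for v w
    by (rule frac_symbol_diff[OF Htilde_Lsq_bdd[OF b that(1)] Htilde_Lsq_bdd[OF b that(2)]])
  have S_add: "?S (\<lambda>x. v x + w x) = (\<lambda>\<xi>. ?S v \<xi> + ?S w \<xi>)" if "v \<in> ?H" "w \<in> ?H" for v w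
    by (rule frac_symbol_add[OF Htilde_Lsq_bdd[OF b that(1)] Htilde_Lsq_bdd[OF b that(2)]])
  have dual_diff: "frac_laplacian_dual s w (\<lambda>x. v x - w x) = Lsq_inner (?S w) (?S v) - (Lsq_norm (?S w))\<^sup>2"
    if "v \<in> ?H" "w \<in> ?H" for v w
    using that by (simp add: frac_laplacian_dual_eq[OF b] Htilde_diff[OF b] S_diff Lsq_inner_diff_right L Lsq_norm_square)
  \<comment> \<open>The function \<open>v0\<close> is admissible for every \<open>h\<close>; comparing with it bounds the solutions.\<close>
  obtain C where C: "0 \<le> C" "\<And>v. v \<in> ?H \<Longrightarrow> \<bar>f v\<bar> \<le> C * Lsq_norm (?S v)"
    using Htilde_dual_bound[OF b f] by blast
  define M where "M = 1 + (Lsq_norm (?S v0) + C) + \<bar>f v0\<bar>"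
  have M: "Lsq_norm (?S (uh h)) \<le> M" for h
  proof -
    let ?x = "Lsq_norm (?S (uh h))"
    have "v0 \<in> obstacle_set s \<Omega> (\<psi>h h)" using v0 assms(10) by (simp add: obstacle_set_def)
    from VIh[OF this] have "f v0 - f (uh h) \<le> Lsq_inner (?S (uh h)) (?S v0) - ?x\<^sup>2"
      unfolding dual_diff[OF v0 uh] f_diff[OF v0 uh] .
    then have "?x\<^sup>2 \<le> Lsq_norm (?S v0) * ?x + C * ?x + \<bar>f v0\<bar>"
      using Lsq_Cauchy_Schwarz[OF L[OF uh[of h]] L[OF v0]] C(2)[OF uh[of h]] by (simp add: mult.commute)
    then have sq: "?x * ?x \<le> (Lsq_norm (?S v0) + C) * ?x + \<bar>f v0\<bar>"
      by (simp add: power2_eq_square algebra_simps)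
    show ?thesis
    proof (cases "?x \<le> 1")
      case True
      then show ?thesis
        using C(1) Lsq_norm_nonneg[of "?S v0"] abs_ge_zero[of "f v0"] unfolding M_def by linarith
    next
      case False
      then have "\<bar>f v0\<bar> \<le> \<bar>f v0\<bar> * ?x" by (simp add: mult_le_cancel_left1)
      with sq have "?x * ?x \<le> ((Lsq_norm (?S v0) + C) + \<bar>f v0\<bar>) * ?x" by (simp add: algebra_simps)
      then have "?x \<le> (Lsq_norm (?S v0) + C) + \<bar>f v0\<bar>" using False by (simp add: mult_le_cancel_right)
      then show ?thesis by (simp add: M_def)
    qed
  qed
  have M0: "0 \<le> M" using M[of 0] Lsq_norm_nonneg[of "?S (uh 0)"] by linarith
  \<comment> \<open>Where \<open>u\<close> is below \<open>v0\<close>, \<open>u + e h\<close> is \<open>min (u + \<epsilon> h) v0\<close>, and likewise for \<open>uh h + d h\<close>: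
    the shift by \<open>\<epsilon> h\<close> lifts above the other obstacle, and \<open>v0\<close> keeps the correction in the space.\<close>
  define e where "e h x = cap (\<epsilon> h) (v0 x - u x)" for h x
  define d where "d h x = cap (\<epsilon> h) (v0 x - uh h x)" for h x
  note we = Htilde_diff[OF b v0 u] and wd = Htilde_diff[OF b v0 uh]
  have eH: "e h \<in> ?H" and dH: "d h \<in> ?H" for h
    unfolding e_def[abs_def] d_def[abs_def] by (rule Htilde_cap(1)[OF b s _ \<epsilon>_nonneg], rule we wd)+
  have null: "(\<lambda>h. \<epsilon> h * Lsq_norm (indicator (closure \<Omega>) :: real ^ 'n \<Rightarrow> real)) \<longlonglongrightarrow> 0"
    using tendsto_mult_right_zero[OF \<epsilon>0] tendsto_mult_left_zero[OF \<epsilon>0] by blast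
  have e_L2: "(\<lambda>h. Lsq_norm (e h)) \<longlonglongrightarrow> 0"
    by (rule tendsto_sandwich[OF _ _ tendsto_const null])
       (use Lsq_norm_cap_le[OF b eH[unfolded e_def[abs_def]] \<epsilon>_nonneg] in \<open>auto simp: e_def[abs_def] always_eventually\<close>)
  have d_L2: "(\<lambda>h. Lsq_norm (d h)) \<longlonglongrightarrow> 0"
    by (rule tendsto_sandwich[OF _ _ tendsto_const null])
       (use Lsq_norm_cap_le[OF b dH[unfolded d_def[abs_def]] \<epsilon>_nonneg] in \<open>auto simp: d_def[abs_def] always_eventually\<close>)
  have e_bound: "Lsq_norm (?S (e h)) \<le> Lsq_norm (?S (\<lambda>x. v0 x - u x))" for h
    using Htilde_cap(3)[OF b s we \<epsilon>_nonneg[of h]] by (simp add: e_def[abs_def])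
  have d_bound: "Lsq_norm (?S (d h)) \<le> Lsq_norm (?S v0) + M" for h
  proof -
    have "Lsq_norm (?S (d h)) \<le> Lsq_norm (?S (\<lambda>x. v0 x - uh h x))"
      using Htilde_cap(3)[OF b s wd \<epsilon>_nonneg[of h]] by (simp add: d_def[abs_def])
    also have "\<dots> \<le> Lsq_norm (?S v0) + Lsq_norm (?S (uh h))"
      using Lsq_norm_triangle_diff[OF L[OF v0] Lsq_zero L[OF uh[of h]]] Lsq_norm_minus[of "\<lambda>x. 0" "?S (uh h)"]
      by (simp add: S_diff[OF v0 uh])
    finally show ?thesis using M[of h] by linarith
  qed
  note weak_e = frac_symbol_weakly_null[OF _ s(1) Htilde_Lsq_bdd[OF b eH] L[OF eH] e_bound e_L2]
  note weak_d = frac_symbol_weakly_null[OF _ s(1) Htilde_Lsq_bdd[OF b dH] L[OF dH] d_bound d_L2]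
  \<comment> \<open>Weak convergence becomes strong because \<open>\<parallel>e h\<parallel>\<^sup>2 \<le> \<langle>v0 - u, e h\<rangle>\<close> with a fixed first argument.\<close>
  have e_strong: "(\<lambda>h. Lsq_norm (?S (e h))) \<longlonglongrightarrow> 0"
  proof -
    have "(\<lambda>h. (Lsq_norm (?S (e h)))\<^sup>2) \<longlonglongrightarrow> 0"
    proof (rule tendsto_sandwich[OF _ _ tendsto_const weak_e[OF L[OF we]]])
      show "\<forall>\<^sub>F h in sequentially. (Lsq_norm (?S (e h)))\<^sup>2 \<le> Lsq_inner (?S (\<lambda>x. v0 x - u x)) (?S (e h))"
        using Htilde_cap(2)[OF b s we \<epsilon>_nonneg] by (simp add: e_def[abs_def])
    qed simp
    from tendsto_real_sqrt[OF this] show ?thesis by simp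
  qed
  \<comment> \<open>The sum of the two variational inequalities, tested with the corrected solutions, bounds
    \<open>\<parallel>uh h - u\<parallel>\<^sup>2\<close> by \<open>\<langle>uh h, e h\<rangle> + \<langle>u, d h\<rangle> - f (e h) - f (d h)\<close>.\<close>
  define r where "r h = M * Lsq_norm (?S (e h)) + Lsq_inner (?S u) (?S (d h)) - f (e h) - f (d h)" for h
  have r0: "r \<longlonglongrightarrow> 0"
  proof -
    have "r \<longlonglongrightarrow> M * 0 + 0 - 0 - 0"
      unfolding r_def[abs_def]
      by (intro tendsto_intros e_strong weak_d[OF L[OF u]]
          Htilde_dual_weakly_null[OF b s(1) f eH e_bound e_L2] Htilde_dual_weakly_null[OF b s(1) f dH d_bound d_L2])
    then show ?thesis by simp
  qed
  have est: "(Lsq_norm (\<lambda>\<xi>. ?S (uh h) \<xi> - ?S u \<xi>))\<^sup>2 \<le> r h" if h: "S h < \<infinity>" for h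
  proof -
    have ue: "(\<lambda>x. u x + e h x) \<in> ?H" and ud: "(\<lambda>x. uh h x + d h x) \<in> ?H"
      by (intro Htilde_add[OF b] u uh eH dH)+
    have "AE x in lebesgue_on \<Omega>. \<psi>h h x \<le> u x + e h x"
      using close[OF h] u_ge assms(10)[of h]
      by eventually_elim (auto simp: e_def cap_def min_def max_def)
    then have "(\<lambda>x. u x + e h x) \<in> obstacle_set s \<Omega> (\<psi>h h)" using ue by (simp add: obstacle_set_def)
    from VIh[OF this] have 1: "f u + f (e h) - f (uh h)
        \<le> Lsq_inner (?S (uh h)) (?S u) + Lsq_inner (?S (uh h)) (?S (e h)) - (Lsq_norm (?S (uh h)))\<^sup>2"
      unfolding dual_diff[OF ue uh] f_diff[OF ue uh] f_add[OF u eH] S_add[OF u eH]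
      by (simp add: Lsq_inner_add_right L u uh eH)
    have "AE x in lebesgue_on \<Omega>. \<psi> x \<le> uh h x + d h x"
      using close[OF h] uh_ge[of h] v0_ge
      by eventually_elim (auto simp: d_def cap_def min_def max_def)
    then have "(\<lambda>x. uh h x + d h x) \<in> obstacle_set s \<Omega> \<psi>" using ud by (simp add: obstacle_set_def)
    from VI[OF this] have 2: "f (uh h) + f (d h) - f u
        \<le> Lsq_inner (?S u) (?S (uh h)) + Lsq_inner (?S u) (?S (d h)) - (Lsq_norm (?S u))\<^sup>2"
      unfolding dual_diff[OF ud u] f_diff[OF ud u] f_add[OF uh dH] S_add[OF uh dH]
      by (simp add: Lsq_inner_add_right L u uh dH)
    have 3: "Lsq_inner (?S (uh h)) (?S (e h)) \<le> M * Lsq_norm (?S (e h))"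
      using Lsq_Cauchy_Schwarz[OF L[OF uh[of h]] L[OF eH[of h]]]
        mult_right_mono[OF M[of h] Lsq_norm_nonneg[of "?S (e h)"]] by linarith
    have 4: "(Lsq_norm (\<lambda>\<xi>. ?S (uh h) \<xi> - ?S u \<xi>))\<^sup>2
        = (Lsq_norm (?S (uh h)))\<^sup>2 - 2 * Lsq_inner (?S (uh h)) (?S u) + (Lsq_norm (?S u))\<^sup>2"
      by (rule Lsq_norm_diff_square[OF L[OF uh] L[OF u]])
    show ?thesis
      unfolding r_def 4 using 1 2 3 Lsq_inner_commute[of "?S u" "?S (uh h)"] by linarith
  qed
  have "(\<lambda>h. (Lsq_norm (\<lambda>\<xi>. ?S (uh h) \<xi> - ?S u \<xi>))\<^sup>2) \<longlonglongrightarrow> 0"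
  proof (rule tendsto_sandwich[OF _ _ tendsto_const r0])
    show "\<forall>\<^sub>F h in sequentially. (Lsq_norm (\<lambda>\<xi>. ?S (uh h) \<xi> - ?S u \<xi>))\<^sup>2 \<le> r h"
      using fin by eventually_elim (rule est)
  qed simp
  from tendsto_real_sqrt[OF this]
  have "(\<lambda>h. Lsq_norm (\<lambda>\<xi>. ?S (uh h) \<xi> - ?S u \<xi>)) \<longlonglongrightarrow> 0" by simp
  then show ?thesis
    by (simp add: Htilde_norm_eq[OF b Htilde_diff[OF b uh u]] S_diff[OF uh u])
qed

end
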